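(* Let $p$ be a prime and let $G$ be a finite $p$-group such that $G_3\cong C_p$, $\Phi(G')G_3\cong C_p^2$, $G/\Phi(G')G_3\cong M_p(n,m,1)$ where $n>m$, and the type of $C_G(G')/\Phi(G')G_3$ is $(p^{n-1},p^m,p)$. Then $G$ is one of the following non-isomorphic groups: (M1) $\langle a,b,c\mid a^{p^{n+1}}=b^{p^{m+1}}=1,[a,b]=c,c^p=a^{p^n}b^{s\nu p^m},[a,c]=b^{\nu p^m},[b,c]=1\rangle$, where $n>m\ge 2$, $\nu=1$ or a fixed quadratic non-residue modulo $p$, $s=0,1,\dots,\frac{p-1}{2}$; (M2) $\langle a,b,c\mid a^{p^{n+1}}=b^{p^m}=c^{p^2}=1,[a,b]=c,[c,b]=1,[c,a]=c^pa^{-p^n},[a^{p^n},b]=1\rangle$, where $n>m\ge 2$; (M3) $\langle a,b,c,d\mid a^{p^{n+1}}=b^{p^m}=d^p=1,[a,b]=c,c^p=a^{p^n},[c,a]=d,[c,b]=1,[d,a]=[d,b]=1\rangle$, where $n>m\ge 2$; (M4) $\langle a,b,c\mid a^{p^{n+1}}=b^{p^{m+1}}=1,[a,b]=c,c^p=b^{p^m},[b,c]=1,[a,c]=a^{p^n}\rangle$, where $n>m\ge 2$; (M5) $\langle a,b,c\mid a^{p^{n+1}}=b^{p^m}=c^{p^2}=1,[a,b]=c,[b,c]=1,[a,c]=a^{p^n}\rangle$, where $n>m\ge 2$; (M6) $\langle a,b,c\mid a^{p^n}=b^{p^{m+1}}=c^{p^2}=1,[a,b]=c,[c,b]=1,[c,a]=c^{tp}b^{-tp^m},[b^{p^m},a]=1\rangle$,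 where $n>m\ge 2$ and $t\in F_p^*$; (M7) $\langle a,b,c,d\mid a^{p^n}=b^{p^{m+1}}=d^p=1,c^p=b^{p^m},[a,b]=c,[c,b]=1,[c,a]=d,[d,a]=[d,b]=1\rangle$, where $n>m\ge 2$; (M8) $\langle a,b,c\mid a^{p^n}=b^{p^{m+1}}=c^{p^2}=1,[a,b]=c,[c,b]=1,[a,c]=b^{\nu p^m}\rangle$, where $n>m\ge 2$, $\nu=1$ or a fixed quadratic non-residue modulo $p$; (M9) $\langle a,b,c,d\mid a^{p^n}=b^{p^m}=c^{p^2}=d^p=1,[a,b]=c,[c,b]=1,[c,a]=d,[d,a]=[d,b]=1\rangle$, where $n>m\ge 2$.
   Context: All groups are finite $p$-groups; $G'$ is the derived subgroup, $G_3=[G',G]$, $\Phi(H)$ is the Frattini subgroup of $H$, $C_G(G')$ is the centralizer of $G'$ in $G$, $C_p$ is the cyclic group of order $p$, and $[x,y]$ denotes the commutator of $x$ and $y$. For $n\ge m\ge 1$ (with $n>1$ if $p=2$), $M_p(n,m,1)=\langle a,b,c\mid a^{p^n}=b^{p^m}=c^p=1,\ [a,b]=c,\ [c,a]=[c,b]=1\rangle$. An abelian group has type $(p^{e_1},p^{e_2},p^{e_3})$ if it is isomorphic to $C_{p^{e_1}}\times C_{p^{e_2}}\times C_{p^{e_3}}$. $F_p^*$ is the multiplicative group of the field $F_p$ with $p$ elements; elements of $F_p$ appearing in exponents are represented by integers.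
   Formalization: For p = 2 the range s = 0,1,…,(p−1)/2 in (M1) ends at 1/2; it is taken as s = 0,1 (and ν = 1 only), because the group (M1) with p = 2, s = 1 satisfies the hypotheses and is isomorphic to no other group in the list. For odd p nothing is changed. *)

theory Defs
  imports "HOL-Algebra.Elementary_Groups" "HOL-Algebra.Generated_Groups"
    "HOL-Number_Theory.Number_Theory"
begin

section \<open>Groups given by generators and relations\<close>

text \<open>A letter \<open>(g, True)\<close> stands for the generator \<open>g\<close>, and \<open>(g, False)\<close> for its formal inverse.
  A relation \<open>u = v\<close> is encoded as the pair \<open>(u, v)\<close>; the empty word plays the role of \<open>1\<close>.\<close>

type_synonym 'g gword = "('g \<times> bool) list"

definition gen_words :: "'g set \<Rightarrow> 'g gword set" where
  "gen_words S = lists (S \<times> UNIV)"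

definition winv :: "'g gword \<Rightarrow> 'g gword" where
  "winv w = rev (map (\<lambda>(g, e). (g, \<not> e)) w)"

definition wpow :: "'g gword \<Rightarrow> int \<Rightarrow> 'g gword" (infixr \<open>\<up>\<close> 80) where
  "w \<up> k = (if 0 \<le> k then concat (replicate (nat k) w)
            else concat (replicate (nat (- k)) (winv w)))"

text \<open>The convention is \<open>[x, y] = x\<^sup>-\<^sup>1 y\<^sup>-\<^sup>1 x y\<close>.\<close>

definition wcomm :: "'g gword \<Rightarrow> 'g gword \<Rightarrow> 'g gword" where
  "wcomm x y = winv x @ winv y @ x @ y"

inductive pres_eq :: "'g set \<Rightarrow> ('g gword \<times> 'g gword) set \<Rightarrow> 'g gword \<Rightarrow> 'g gword \<Rightarrow> bool"
  for S R where
  refl: "w \<in> gen_words S \<Longrightarrow> pres_eq S R w w"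
| sym: "pres_eq S R u v \<Longrightarrow> pres_eq S R v u"
| trans: "pres_eq S R u v \<Longrightarrow> pres_eq S R v w \<Longrightarrow> pres_eq S R u w"
| append: "pres_eq S R u v \<Longrightarrow> pres_eq S R u' v' \<Longrightarrow> pres_eq S R (u @ u') (v @ v')"
| cancel: "g \<in> S \<Longrightarrow> pres_eq S R [(g, e), (g, \<not> e)] []"
| relation: "(u, v) \<in> R \<Longrightarrow> u \<in> gen_words S \<Longrightarrow> v \<in> gen_words S \<Longrightarrow> pres_eq S R u v"

definition pres_class ::
    "'g set \<Rightarrow> ('g gword \<times> 'g gword) set \<Rightarrow> 'g gword \<Rightarrow> 'g gword set" where
  "pres_class S R w = {v. pres_eq S R w v}"

definition presented_group ::
    "'g set \<Rightarrow> ('g gword \<times> 'g gword) set \<Rightarrow> 'g gword set monoid" where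
  "presented_group S R =
    \<lparr> carrier = pres_class S R ` gen_words S,
      monoid.mult = (\<lambda>X Y. {w. \<exists>x \<in> X. \<exists>y \<in> Y. pres_eq S R (x @ y) w}),
      one = pres_class S R [] \<rparr>"

lemma pres_eq_in_words:
  "pres_eq S R u v \<Longrightarrow> u \<in> gen_words S \<and> v \<in> gen_words S"
  by (induction rule: pres_eq.induct) (auto simp: gen_words_def)

lemma pres_class_eqI: "pres_eq S R u v \<Longrightarrow> pres_class S R u = pres_class S R v"
  unfolding pres_class_def by (auto intro: pres_eq.sym pres_eq.trans)

lemma presented_group_mult:
  assumes "u \<in> gen_words S" "v \<in> gen_words S"
  shows "pres_class S R u \<otimes>\<^bsub>presented_group S R\<^esub> pres_class S R v = pres_class S R (u @ v)"
  using assms unfolding presented_group_def pres_class_def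
  by (auto intro: pres_eq.refl pres_eq.append pres_eq.trans)

lemma winv_in_words: "w \<in> gen_words S \<Longrightarrow> winv w \<in> gen_words S"
  by (auto simp: gen_words_def winv_def)

lemma winv_left: "w \<in> gen_words S \<Longrightarrow> pres_eq S R (winv w @ w) []"
proof (induction w)
  case Nil
  then show ?case by (simp add: winv_def pres_eq.refl gen_words_def)
next
  case (Cons x w)
  obtain g e where x: "x = (g, e)" by force
  have g: "g \<in> S" and w: "w \<in> gen_words S" using Cons.prems by (auto simp: gen_words_def x)
  have "pres_eq S R ([(g, \<not> e), (g, \<not> \<not> e)] @ w) ([] @ w)"
    by (intro pres_eq.append pres_eq.cancel pres_eq.refl g w)
  then have "pres_eq S R (winv w @ [(g, \<not> e), (g, e)] @ w) (winv w @ w)"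
    using pres_eq.append[OF pres_eq.refl[OF winv_in_words[OF w]]] by simp
  then show ?case
    using Cons.IH[OF w] by (auto simp: winv_def x intro: pres_eq.trans)
qed

lemma group_presented_group: "group (presented_group S R)"
proof (rule groupI)
  have app: "u @ v \<in> gen_words S" if "u \<in> gen_words S" "v \<in> gen_words S" for u v
    using that by (auto simp: gen_words_def)
  have nil: "[] \<in> gen_words S" by (simp add: gen_words_def)
  have car: "carrier (presented_group S R) = pres_class S R ` gen_words S"
    and one: "\<one>\<^bsub>presented_group S R\<^esub> = pres_class S R []"
    by (simp_all add: presented_group_def)
  note simps = car one presented_group_mult app nil winv_in_words
  show "\<one>\<^bsub>presented_group S R\<^esub> \<in> carrier (presented_group S R)"
    by (simp add: simps)
  show "x \<otimes>\<^bsub>presented_group S R\<^esub> y \<in> carrier (presented_group S R)"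
    if "x \<in> carrier (presented_group S R)" "y \<in> carrier (presented_group S R)" for x y
    using that by (auto simp: simps)
  show "x \<otimes>\<^bsub>presented_group S R\<^esub> y \<otimes>\<^bsub>presented_group S R\<^esub> z =
      x \<otimes>\<^bsub>presented_group S R\<^esub> (y \<otimes>\<^bsub>presented_group S R\<^esub> z)"
    if "x \<in> carrier (presented_group S R)" "y \<in> carrier (presented_group S R)"
      "z \<in> carrier (presented_group S R)" for x y z
    using that by (auto simp: simps)
  show "\<one>\<^bsub>presented_group S R\<^esub> \<otimes>\<^bsub>presented_group S R\<^esub> x = x"
    if xcar: "x \<in> carrier (presented_group S R)" for x
    using xcar by (auto simp: simps)
  show "\<exists>y\<in>carrier (presented_group S R). y \<otimes>\<^bsub>presented_group S R\<^esub> x = \<one>\<^bsub>presented_group S R\<^esub>"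
    if xcar: "x \<in> carrier (presented_group S R)" for x
  proof -
    obtain w where w: "w \<in> gen_words S" "x = pres_class S R w"
      using xcar by (auto simp: car)
    then have "pres_class S R (winv w) \<otimes>\<^bsub>presented_group S R\<^esub> x = \<one>\<^bsub>presented_group S R\<^esub>"
      by (simp add: simps pres_class_eqI[OF winv_left])
    then show ?thesis using w by (auto simp: car intro: winv_in_words)
  qed
qed

section \<open>Subgroups\<close>

definition commutator_subgroup :: "('a, 'b) monoid_scheme \<Rightarrow> 'a set \<Rightarrow> 'a set \<Rightarrow> 'a set" where
  "commutator_subgroup G H K =
    generate G (\<Union>h \<in> H. \<Union>k \<in> K. {h \<otimes>\<^bsub>G\<^esub> k \<otimes>\<^bsub>G\<^esub> inv\<^bsub>G\<^esub> h \<otimes>\<^bsub>G\<^esub> inv\<^bsub>G\<^esub> k})"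

definition maximal_subgroup :: "'a set \<Rightarrow> ('a, 'b) monoid_scheme \<Rightarrow> bool" where
  "maximal_subgroup M G \<longleftrightarrow> subgroup M G \<and> M \<noteq> carrier G \<and>
    (\<forall>K. subgroup K G \<and> M \<subseteq> K \<longrightarrow> K = M \<or> K = carrier G)"

text \<open>The intersection with the carrier only matters when there is no maximal subgroup.\<close>

definition frattini :: "('a, 'b) monoid_scheme \<Rightarrow> 'a set" where
  "frattini G = carrier G \<inter> \<Inter> {M. maximal_subgroup M G}"

definition centralizer :: "('a, 'b) monoid_scheme \<Rightarrow> 'a set \<Rightarrow> 'a set" where
  "centralizer G S = {g \<in> carrier G. \<forall>s \<in> S. g \<otimes>\<^bsub>G\<^esub> s = s \<otimes>\<^bsub>G\<^esub> g}"

abbreviation subgrp :: "('a, 'b) monoid_scheme \<Rightarrow> 'a set \<Rightarrow> ('a, 'b) monoid_scheme" where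
  "subgrp G H \<equiv> G\<lparr>carrier := H\<rparr>"

definition finite_p_group :: "nat \<Rightarrow> ('a, 'b) monoid_scheme \<Rightarrow> bool" where
  "finite_p_group p G \<longleftrightarrow> group G \<and> finite (carrier G) \<and> (\<exists>k. order G = p ^ k)"

definition derived_subgrp :: "('a, 'b) monoid_scheme \<Rightarrow> 'a set" where
  "derived_subgrp G = derived G (carrier G)"

definition third_term :: "('a, 'b) monoid_scheme \<Rightarrow> 'a set" where
  "third_term G = commutator_subgroup G (derived_subgrp G) (carrier G)"

text \<open>The subgroup \<open>\<Phi>(G')G\<^sub>3\<close>.\<close>

definition frattini_third :: "('a, 'b) monoid_scheme \<Rightarrow> 'a set" where
  "frattini_third G = frattini (subgrp G (derived_subgrp G)) <#>\<^bsub>G\<^esub> third_term G"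

definition abelian_type3 :: "('a, 'b) monoid_scheme \<Rightarrow> nat \<Rightarrow> nat \<Rightarrow> nat \<Rightarrow> bool" where
  "abelian_type3 A q1 q2 q3 \<longleftrightarrow>
    A \<cong> integer_mod_group q1 \<times>\<times> (integer_mod_group q2 \<times>\<times> integer_mod_group q3)"

section \<open>The groups of the classification\<close>

datatype gen = Gen_a | Gen_b | Gen_c | Gen_d

abbreviation wa :: "gen gword" where "wa \<equiv> [(Gen_a, True)]"
abbreviation wb :: "gen gword" where "wb \<equiv> [(Gen_b, True)]"
abbreviation wc :: "gen gword" where "wc \<equiv> [(Gen_c, True)]"
abbreviation wd :: "gen gword" where "wd \<equiv> [(Gen_d, True)]"

definition M_p :: "nat \<Rightarrow> nat \<Rightarrow> nat \<Rightarrow> gen gword set monoid" where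
  "M_p p n m = presented_group {Gen_a, Gen_b, Gen_c}
    {(wa \<up> (int p ^ n), []), (wb \<up> (int p ^ m), []), (wc \<up> int p, []),
     (wcomm wa wb, wc), (wcomm wc wa, []), (wcomm wc wb, [])}"

text \<open>The labels carry the parameters other than \<open>p\<close>, \<open>n\<close>, \<open>m\<close>:
  \<open>M1 \<nu> s\<close>, \<open>M6 t\<close> and \<open>M8 \<nu>\<close>.\<close>

datatype M_label = M1 int nat | M2 | M3 | M4 | M5 | M6 nat | M7 | M8 int | M9

fun M_group :: "nat \<Rightarrow> nat \<Rightarrow> nat \<Rightarrow> M_label \<Rightarrow> gen gword set monoid" where
  "M_group p n m (M1 \<nu> s) = presented_group {Gen_a, Gen_b, Gen_c}
    {(wa \<up> (int p ^ (n + 1)), []), (wb \<up> (int p ^ (m + 1)), []),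
     (wcomm wa wb, wc), (wc \<up> int p, wa \<up> (int p ^ n) @ wb \<up> (int s * \<nu> * int p ^ m)),
     (wcomm wa wc, wb \<up> (\<nu> * int p ^ m)), (wcomm wb wc, [])}"
| "M_group p n m M2 = presented_group {Gen_a, Gen_b, Gen_c}
    {(wa \<up> (int p ^ (n + 1)), []), (wb \<up> (int p ^ m), []), (wc \<up> (int p ^ 2), []),
     (wcomm wa wb, wc), (wcomm wc wb, []),
     (wcomm wc wa, wc \<up> int p @ wa \<up> (- (int p ^ n))),
     (wcomm (wa \<up> (int p ^ n)) wb, [])}"
| "M_group p n m M3 = presented_group {Gen_a, Gen_b, Gen_c, Gen_d}
    {(wa \<up> (int p ^ (n + 1)), []), (wb \<up> (int p ^ m), []), (wd \<up> int p, []),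
     (wcomm wa wb, wc), (wc \<up> int p, wa \<up> (int p ^ n)),
     (wcomm wc wa, wd), (wcomm wc wb, []), (wcomm wd wa, []), (wcomm wd wb, [])}"
| "M_group p n m M4 = presented_group {Gen_a, Gen_b, Gen_c}
    {(wa \<up> (int p ^ (n + 1)), []), (wb \<up> (int p ^ (m + 1)), []),
     (wcomm wa wb, wc), (wc \<up> int p, wb \<up> (int p ^ m)),
     (wcomm wb wc, []), (wcomm wa wc, wa \<up> (int p ^ n))}"
| "M_group p n m M5 = presented_group {Gen_a, Gen_b, Gen_c}
    {(wa \<up> (int p ^ (n + 1)), []), (wb \<up> (int p ^ m), []), (wc \<up> (int p ^ 2), []),
     (wcomm wa wb, wc), (wcomm wb wc, []), (wcomm wa wc, wa \<up> (int p ^ n))}"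
| "M_group p n m (M6 t) = presented_group {Gen_a, Gen_b, Gen_c}
    {(wa \<up> (int p ^ n), []), (wb \<up> (int p ^ (m + 1)), []), (wc \<up> (int p ^ 2), []),
     (wcomm wa wb, wc), (wcomm wc wb, []),
     (wcomm wc wa, wc \<up> (int t * int p) @ wb \<up> (- (int t * int p ^ m))),
     (wcomm (wb \<up> (int p ^ m)) wa, [])}"
| "M_group p n m M7 = presented_group {Gen_a, Gen_b, Gen_c, Gen_d}
    {(wa \<up> (int p ^ n), []), (wb \<up> (int p ^ (m + 1)), []), (wd \<up> int p, []),
     (wc \<up> int p, wb \<up> (int p ^ m)), (wcomm wa wb, wc), (wcomm wc wb, []),
     (wcomm wc wa, wd), (wcomm wd wa, []), (wcomm wd wb, [])}"
| "M_group p n m (M8 \<nu>) = presented_group {Gen_a, Gen_b, Gen_c}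
    {(wa \<up> (int p ^ n), []), (wb \<up> (int p ^ (m + 1)), []), (wc \<up> (int p ^ 2), []),
     (wcomm wa wb, wc), (wcomm wc wb, []), (wcomm wa wc, wb \<up> (\<nu> * int p ^ m))}"
| "M_group p n m M9 = presented_group {Gen_a, Gen_b, Gen_c, Gen_d}
    {(wa \<up> (int p ^ n), []), (wb \<up> (int p ^ m), []), (wc \<up> (int p ^ 2), []), (wd \<up> int p, []),
     (wcomm wa wb, wc), (wcomm wc wb, []), (wcomm wc wa, wd),
     (wcomm wd wa, []), (wcomm wd wb, [])}"

text \<open>\<open>\<nu>\<^sub>0\<close> is the fixed quadratic non-residue; there is none for \<open>p = 2\<close>, and then only
  \<open>\<nu> = 1\<close> is left. For odd \<open>p\<close>, \<open>p div 2\<close> is \<open>(p - 1) / 2\<close>. For \<open>p = 2\<close>, where \<open>(p - 1) / 2\<close> is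
  not an integer, the list \<open>0, 1, \<dots>, (p - 1) / 2\<close> is read as \<open>0, 1\<close>: the group \<open>M1 1 1\<close> satisfies
  the hypotheses of the classification for \<open>p = 2\<close> and is isomorphic to no other group in the list.
  The elements of \<open>F\<^sub>p\<^sup>*\<close> are represented by \<open>1, \<dots>, p - 1\<close>.\<close>

definition nu_range :: "nat \<Rightarrow> int \<Rightarrow> int set" where
  "nu_range p \<nu>\<^sub>0 = (if p = 2 then {1} else {1, \<nu>\<^sub>0})"

definition M_labels :: "nat \<Rightarrow> int \<Rightarrow> M_label set" where
  "M_labels p \<nu>\<^sub>0 =
    {M1 \<nu> s | \<nu> s. \<nu> \<in> nu_range p \<nu>\<^sub>0 \<and> s \<le> p div 2} \<union>
    {M2, M3, M4, M5} \<union>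
    {M6 t | t. 1 \<le> t \<and> t < p} \<union>
    {M7} \<union> {M8 \<nu> | \<nu>. \<nu> \<in> nu_range p \<nu>\<^sub>0} \<union> {M9}"

end

theory Submission
  imports Defs
begin

text \<open>Put \<open>c = [a, b]\<close>, \<open>d = [c, a]\<close> and \<open>N = \<Phi>(G')G\<^sub>3\<close>. Under the hypotheses \<open>N\<close> is central and
  the direct product of \<open>\<langle>c\<^sup>p\<rangle>\<close> and \<open>\<langle>d\<rangle>\<close>, and the type of \<open>C\<^sub>G(G')/N\<close> forces \<open>[c, b] = 1\<close> for the
  standard generators \<open>a, b\<close> modulo \<open>N\<close>. Hence \<open>G\<close> is determined by the exponents modulo \<open>p\<close> in
  \<open>a ^ (p ^ n) = c ^ (p \<alpha>1) d ^ \<alpha>2\<close> and \<open>b ^ (p ^ m) = c ^ (p \<beta>1) d ^ \<beta>2\<close>. All these groups are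
  quotients of one torsion-free nilpotent group on \<open>\<int>\<^sup>4\<close>, where powers and commutators are polynomial.
  Every isomorphism between two of them comes from a change of generators
  \<open>a' = a ^ i b ^ j \<dots>\<close>, \<open>b' = a ^ (l p ^ (n - m)) b ^ k \<dots>\<close>, which acts on the matrix of exponents by an
  explicit formula; the orbits of this action are the labels M1 to M9.\<close>

section \<open>The covering group\<close>

text \<open>Collection is done once, over the integers. A pair of elements satisfying the relations
  then gives a homomorphism from \<open>cover\<close>, and only its image and kernel have to be
  found. The concrete quotients of \<open>cover\<close> also guard against collapse, which a
  presentation by itself cannot rule out. The obstacle is the prime 2, which is not excluded. Powers
  produce binomial coefficients, which must vanish modulo p, and modulo p^2 in the exponent of c.
  The bounds m \<ge> 2 and n \<ge> 3 supply this, except that \<open>p ^ m choose 2\<close> may lack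
  one factor p; the exponent \<open>l p ^ (n - m)\<close> of a in b' provides it, so the change of
  generators needs no case distinction on p. The bound m \<ge> 2 is itself a conclusion of the
  theorem. The form of b' is forced: \<open>b' ^ (p ^ m)\<close> has to lie in the subgroup
  generated by c and d, so the exponent of a is divisible by \<open>p ^ (n - m)\<close>. This holds
  for the image of b under an arbitrary isomorphism too, hence the same congruences construct the
  isomorphisms between models and exclude all others.\<close>

definition tri :: "int \<Rightarrow> int" where "tri x = x * (x - 1) div 2"

text \<open>Doubling removes the division, so that identities for \<open>tri\<close>, the binomial
  coefficient x choose 2 extended to negative x, become ring identities.\<close>

lemma two_tri: "2 * tri x = x * (x - 1)"
  unfolding tri_def by (simp add: dvd_mult_div_cancel)

lemma tri_add: "tri (x + y) = tri x + tri y + x * y"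
proof -
  have "2 * tri (x + y) = 2 * (tri x + tri y + x * y)"
    by (simp only: two_tri distrib_left) (simp add: algebra_simps)
  then show ?thesis by simp
qed

lemma tri_0 [simp]: "tri 0 = 0" and tri_1 [simp]: "tri 1 = 0" and tri_minus: "tri (- x) = tri x + x"
proof -
  show "tri 0 = 0" "tri 1 = 0" by (simp_all add: tri_def)
  have "2 * tri (- x) = 2 * (tri x + x)"
    by (simp only: two_tri distrib_left) (simp add: algebra_simps)
  then show "tri (- x) = tri x + x" by simp
qed

type_synonym quad = "int \<times> int \<times> int \<times> int"

text \<open>\<open>(x, y, u, v)\<close> stands for \<open>a ^ x b ^ y c ^ u d ^ v\<close> where \<open>c = [a, b]\<close>, \<open>d = [c, a]\<close>, \<open>[c, b] = 1\<close> and
  \<open>d\<close> is central; then \<open>c ^ u a ^ x = a ^ x c ^ u d ^ (u x)\<close> and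
  \<open>b ^ y a ^ x = a ^ x b ^ y c ^ (- x y) d ^ (- y tri x)\<close>.\<close>

fun cover_mult :: "quad \<Rightarrow> quad \<Rightarrow> quad" where
  "cover_mult (x, y, u, v) (x', y', u', v') =
     (x + x', y + y', u + u' - x' * y, v + v' + u * x' - y * tri x')"

definition cover :: "quad monoid" where
  "cover = \<lparr>carrier = UNIV, monoid.mult = cover_mult, one = (0, 0, 0, 0)\<rparr>"

lemma cover_simps [simp]: "carrier cover = UNIV" "\<one>\<^bsub>cover\<^esub> = (0, 0, 0, 0)" "g \<otimes>\<^bsub>cover\<^esub> h = cover_mult g h"
  by (simp_all add: cover_def)

lemma group_cover: "group cover"
proof (rule groupI)
  fix g h k
  show "g \<otimes>\<^bsub>cover\<^esub> h \<otimes>\<^bsub>cover\<^esub> k = g \<otimes>\<^bsub>cover\<^esub> (h \<otimes>\<^bsub>cover\<^esub> k)"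
    by (cases g; cases h; cases k) (simp add: tri_add algebra_simps)
  show "\<one>\<^bsub>cover\<^esub> \<otimes>\<^bsub>cover\<^esub> g = g" by (cases g) simp
  obtain x y u v where g: "g = (x, y, u, v)" by (cases g)
  have "y * (2 * tri x) = y * (x * (x - 1))" by (simp only: two_tri)
  then have "cover_mult (- x, - y, - u - x * y, - v + u * x + y * (tri x + x)) g = (0, 0, 0, 0)"
    by (simp add: g algebra_simps)
  then show "\<exists>h\<in>carrier cover. h \<otimes>\<^bsub>cover\<^esub> g = \<one>\<^bsub>cover\<^esub>" by auto
qed simp_all

lemma cover_inv [simp]: "inv\<^bsub>cover\<^esub> (x, y, u, v) = (- x, - y, - u - x * y, - v + u * x + y * (tri x + x))"
proof (rule group.inv_equality[OF group_cover])
  have "y * (2 * tri x) = y * (x * (x - 1))" by (simp only: two_tri)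
  then show "(- x, - y, - u - x * y, - v + u * x + y * (tri x + x)) \<otimes>\<^bsub>cover\<^esub> (x, y, u, v) = \<one>\<^bsub>cover\<^esub>"
    by (simp add: algebra_simps)
qed simp_all

text \<open>Collection in class 3 produces binomial coefficients up to \<open>N choose 3\<close>:
  that term counts the factors c created by a letter b and a later letter a and then moved past a
  third letter a. The induction step is Pascal's rule.\<close>

lemma cover_pow:
  "(x, y, u, v) [^]\<^bsub>cover\<^esub> (N :: nat) =
     (int N * x, int N * y, int N * u - int (N choose 2) * x * y,
      int N * v + int (N choose 2) * x * u - int (N choose 3) * x * x * y - int (N choose 2) * y * tri x)"
proof (induction N)
  case (Suc N)
  have [simp]: "Suc N choose 2 = (N choose 2) + N" "Suc N choose 3 = (N choose 3) + (N choose 2)"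
    by (simp_all add: numeral_eq_Suc)
  show ?case by (simp add: Suc.IH algebra_simps)
qed (simp_all add: numeral_eq_Suc)

text \<open>The convention is that of \<open>wcomm\<close>, so that words evaluate to
  \<open>gcomm\<close>. The commutators generating \<open>derived\<close> and
  \<open>third_term\<close> have the form \<open>h k h^-1 k^-1\<close>; the two agree after the
  arguments are replaced by their inverses.\<close>

definition gcomm :: "('a, 'b) monoid_scheme \<Rightarrow> 'a \<Rightarrow> 'a \<Rightarrow> 'a" where
  "gcomm G x y = inv\<^bsub>G\<^esub> x \<otimes>\<^bsub>G\<^esub> inv\<^bsub>G\<^esub> y \<otimes>\<^bsub>G\<^esub> x \<otimes>\<^bsub>G\<^esub> y"

lemma (in group) gcomm_closed [simp, intro]:
  "x \<in> carrier G \<Longrightarrow> y \<in> carrier G \<Longrightarrow> gcomm G x y \<in> carrier G"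
  by (simp add: gcomm_def)

lemma (in group) gcomm_eq_iff:
  assumes "x \<in> carrier G" "y \<in> carrier G" "z \<in> carrier G"
  shows "gcomm G x y = z \<longleftrightarrow> x \<otimes> y = y \<otimes> x \<otimes> z"
proof -
  have "gcomm G x y = inv (y \<otimes> x) \<otimes> (x \<otimes> y)"
    using assms by (simp add: gcomm_def inv_mult_group m_assoc)
  then show ?thesis
    using assms inv_solve_left[of "x \<otimes> y" "y \<otimes> x" z] by (metis gcomm_closed inv_solve_left m_closed)
qed

lemma (in group) gcomm_one_iff:
  assumes "x \<in> carrier G" "y \<in> carrier G"
  shows "gcomm G x y = \<one> \<longleftrightarrow> x \<otimes> y = y \<otimes> x"
  using gcomm_eq_iff[OF assms one_closed] assms by simp

lemma cover_gcomm:
  "gcomm cover (x, y, u, v) (x', y', u', v') =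
    (0, 0, x * y' - x' * y, u * x' - y * tri x' - (u' * x - y' * tri x))"
  by (subst group.gcomm_eq_iff[OF group_cover]) (simp_all add: algebra_simps)

section \<open>Conjugation and commuting powers in an arbitrary group\<close>

lemma (in group) inv_cancel [simp]:
  assumes "g \<in> carrier G" "z \<in> carrier G"
  shows "g \<otimes> (inv g \<otimes> z) = z" "inv g \<otimes> (g \<otimes> z) = z"
  using assms by (simp_all add: m_assoc[symmetric])

lemma (in group) int_pow_conj:
  assumes "g \<in> carrier G" "h \<in> carrier G"
  shows "(inv g \<otimes> h \<otimes> g) [^] (u :: int) = inv g \<otimes> h [^] u \<otimes> g"
proof -
  have "(\<lambda>h. inv g \<otimes> h \<otimes> g) \<in> hom G G"
    using assms by (intro homI) (simp_all add: m_assoc)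
  from hom_int_pow[OF this] assms show ?thesis by (simp add: is_group)
qed

lemma (in group) comm_nat_pow:
  assumes "x \<in> carrier G" "y \<in> carrier G" "x \<otimes> y = y \<otimes> x"
  shows "x [^] (n :: nat) \<otimes> y = y \<otimes> x [^] n"
proof (induction n)
  case (Suc n)
  have "x [^] Suc n \<otimes> y = x [^] n \<otimes> y \<otimes> x" using assms by (simp add: m_assoc)
  then show ?case using assms Suc by (simp add: m_assoc)
qed (use assms in simp)

lemma (in group) comm_inv:
  assumes "x \<in> carrier G" "y \<in> carrier G" "x \<otimes> y = y \<otimes> x"
  shows "inv x \<otimes> y = y \<otimes> inv x"
  using assms by (metis inv_closed inv_solve_left inv_solve_right m_assoc m_closed)

lemma (in group) comm_int_pow:
  assumes "x \<in> carrier G" "y \<in> carrier G" "x \<otimes> y = y \<otimes> x"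
  shows "x [^] (k :: int) \<otimes> y = y \<otimes> x [^] k"
proof (cases k rule: int_cases2)
  case (nonneg n)
  then show ?thesis using comm_nat_pow[OF assms] by (simp add: int_pow_int)
next
  case (nonpos n)
  then show ?thesis using comm_inv[OF _ _ comm_nat_pow[OF assms]] assms
    by (simp add: int_pow_neg_int)
qed

lemma (in group) comm_int_pow2:
  assumes "x \<in> carrier G" "y \<in> carrier G" "x \<otimes> y = y \<otimes> x"
  shows "x [^] (k :: int) \<otimes> y [^] (l :: int) = y [^] l \<otimes> x [^] k"
  using comm_int_pow[of x "y [^] l" k] comm_int_pow[of y x l] assms by simp

text \<open>These rules collect any word in the generators into the form
  \<open>a ^ x b ^ y c ^ u d ^ v\<close>. They bound no orders, so every frame receives a
  homomorphism from \<open>cover\<close>.\<close>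

locale frame = group +
  fixes a b c d
  assumes a [simp]: "a \<in> carrier G" and b [simp]: "b \<in> carrier G"
    and c [simp]: "c \<in> carrier G" and d [simp]: "d \<in> carrier G"
    and ab: "a \<otimes> b = b \<otimes> a \<otimes> c" and ca: "c \<otimes> a = a \<otimes> c \<otimes> d"
    and cb: "c \<otimes> b = b \<otimes> c" and da: "d \<otimes> a = a \<otimes> d" and db: "d \<otimes> b = b \<otimes> d"
begin

text \<open>By \<open>ab\<close>, c is a word in a and b, and d commutes with both.\<close>

lemma dc: "d \<otimes> c = c \<otimes> d"
proof -
  have c: "c = inv (b \<otimes> a) \<otimes> (a \<otimes> b)"
    using ab by (simp add: inv_solve_left)
  have "d \<otimes> (a \<otimes> b) = (a \<otimes> b) \<otimes> d" "d \<otimes> (b \<otimes> a) = (b \<otimes> a) \<otimes> d"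
    using da db by (metis a b d m_assoc)+
  moreover from this(2) have "d \<otimes> inv (b \<otimes> a) = inv (b \<otimes> a) \<otimes> d"
    using comm_inv[of "b \<otimes> a" d] by simp
  ultimately show ?thesis unfolding c by (metis a b d m_assoc m_closed inv_closed)
qed

lemma c_pow_a: "c \<otimes> a [^] (x :: int) = a [^] x \<otimes> (c \<otimes> d [^] x)"
proof (induction x rule: int_induct[of _ 0])
  case base show ?case by simp
next
  case (step1 x)
  have "c \<otimes> a [^] (x + 1) = (c \<otimes> a [^] x) \<otimes> a" by (simp add: int_pow_mult m_assoc)
  also have "\<dots> = a [^] x \<otimes> (c \<otimes> (d [^] x \<otimes> a))" by (simp add: step1 m_assoc)
  also have "\<dots> = a [^] x \<otimes> (c \<otimes> a \<otimes> d [^] x)" using comm_int_pow[OF d a da] by (simp add: m_assoc)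
  also have "\<dots> = a [^] x \<otimes> a \<otimes> (c \<otimes> (d \<otimes> d [^] x))" by (simp add: ca m_assoc)
  also have "d \<otimes> d [^] x = d [^] (x + 1)" by (simp add: int_pow_mult add.commute[of x])
  finally show ?case by (simp add: int_pow_mult)
next
  case (step2 x)
  have ca': "c \<otimes> inv a = inv a \<otimes> (c \<otimes> inv d)"
  proof -
    have "a \<otimes> (c \<otimes> inv a) \<otimes> a = (c \<otimes> inv d) \<otimes> a"
    proof -
      have "(c \<otimes> inv d) \<otimes> a = c \<otimes> a \<otimes> inv d" using comm_inv[OF d a da] by (simp add: m_assoc)
      also have "\<dots> = a \<otimes> c" by (simp add: ca m_assoc)
      finally show ?thesis by (simp add: m_assoc)
    qed
    then have "a \<otimes> (c \<otimes> inv a) = c \<otimes> inv d" by (simp del: m_assoc)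
    then show ?thesis by (simp add: inv_solve_left)
  qed
  have "c \<otimes> a [^] (x - 1) = (c \<otimes> a [^] x) \<otimes> inv a" by (simp add: int_pow_diff m_assoc)
  also have "\<dots> = a [^] x \<otimes> (c \<otimes> (d [^] x \<otimes> inv a))" by (simp add: step2 m_assoc)
  also have "\<dots> = a [^] x \<otimes> (c \<otimes> inv a \<otimes> d [^] x)"
    using comm_inv[of a "d [^] x"] comm_int_pow[OF d a da, of x] by (simp add: m_assoc)
  also have "\<dots> = a [^] x \<otimes> inv a \<otimes> (c \<otimes> (inv d \<otimes> d [^] x))" by (simp add: ca' m_assoc)
  also have "inv d \<otimes> d [^] x = d [^] (x - 1)"
    using int_pow_mult[of d "-1" x] by (simp add: int_pow_neg add.commute)
  finally show ?case by (simp add: int_pow_diff)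
qed

definition cd :: "int \<Rightarrow> int \<Rightarrow> 'a" where "cd u v = c [^] u \<otimes> d [^] v"

lemma cd_closed [simp]: "cd u v \<in> carrier G" by (simp add: cd_def)

lemma cd_mult: "cd u v \<otimes> cd u' v' = cd (u + u') (v + v')"
proof -
  have "cd u v \<otimes> cd u' v' = c [^] u \<otimes> (d [^] v \<otimes> c [^] u') \<otimes> d [^] v'"
    by (simp add: cd_def m_assoc)
  also have "d [^] v \<otimes> c [^] u' = c [^] u' \<otimes> d [^] v"
    by (rule comm_int_pow2[OF d c dc])
  finally show ?thesis by (simp add: cd_def int_pow_mult m_assoc)
qed

lemma cd_pow: "cd u v [^] (k :: int) = cd (u * k) (v * k)"
  unfolding cd_def using comm_int_pow2[OF d c dc] by (simp add: int_pow_mult_distrib int_pow_pow)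

lemma cd_b: "cd u v \<otimes> b [^] (y :: int) = b [^] y \<otimes> cd u v"
proof -
  have "cd u v \<otimes> b [^] y = c [^] u \<otimes> (b [^] y \<otimes> d [^] v)"
    using comm_int_pow2[OF d b db, of v y] by (simp add: cd_def m_assoc)
  also have "\<dots> = b [^] y \<otimes> (c [^] u \<otimes> d [^] v)"
    using comm_int_pow2[OF c b cb, of u y] by (simp add: m_assoc[symmetric])
  finally show ?thesis by (simp add: cd_def)
qed

lemma cd_b': "z \<in> carrier G \<Longrightarrow> cd u v \<otimes> (b [^] (y :: int) \<otimes> z) = b [^] y \<otimes> (cd u v \<otimes> z)"
  by (simp add: m_assoc[symmetric] cd_b)

lemma cd_a: "cd u v \<otimes> a [^] (x :: int) = a [^] x \<otimes> cd u (v + u * x)"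
proof -
  have "inv (a [^] x) \<otimes> c \<otimes> a [^] x = c \<otimes> d [^] x"
    by (simp add: m_assoc c_pow_a)
  then have "inv (a [^] x) \<otimes> c [^] u \<otimes> a [^] x = (c \<otimes> d [^] x) [^] u"
    using int_pow_conj[of "a [^] x" c u] by simp
  also have "\<dots> = cd u (u * x)"
    using comm_int_pow[OF d c dc] by (simp add: cd_def int_pow_mult_distrib int_pow_pow mult.commute)
  finally have "c [^] u \<otimes> a [^] x = a [^] x \<otimes> cd u (u * x)"
    by (metis a c cd_closed int_pow_closed inv_solve_left m_assoc m_closed inv_closed)
  moreover have "cd u v \<otimes> a [^] x = c [^] u \<otimes> a [^] x \<otimes> d [^] v"
    using comm_int_pow2[OF d a da, of v x] by (simp add: cd_def m_assoc)
  moreover have "d [^] v = cd 0 v" by (simp add: cd_def)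
  ultimately show ?thesis by (simp add: m_assoc cd_mult add.commute)
qed

text \<open>Each letter a that b passes leaves a factor c^-1, and every later letter a adds d^-1 to
  that factor. This sums up to 0 + 1 + ... + (x - 1) = \<open>tri x\<close> factors d^-1; the
  downward induction covers negative x.\<close>

lemma b_a_pow: "b \<otimes> a [^] (x :: int) = a [^] x \<otimes> (b \<otimes> cd (- x) (- tri x))"
proof (induction x rule: int_induct[of _ 0])
  case base show ?case by (simp add: cd_def)
next
  case (step1 x)
  have ba: "b \<otimes> a = a \<otimes> (b \<otimes> cd (-1) 0)"
    by (simp add: cd_def int_pow_neg m_assoc[symmetric] ab) (simp add: m_assoc)
  have "b \<otimes> a [^] (x + 1) = (b \<otimes> a [^] x) \<otimes> a" by (simp add: int_pow_mult m_assoc)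
  also have "\<dots> = a [^] x \<otimes> (b \<otimes> (cd (- x) (- tri x) \<otimes> a))" by (simp add: step1 m_assoc)
  also have "\<dots> = a [^] x \<otimes> (b \<otimes> a \<otimes> cd (- x) (- tri x - x))"
    using cd_a[of "-x" "- tri x" 1] by (simp add: m_assoc)
  also have "\<dots> = a [^] x \<otimes> a \<otimes> (b \<otimes> (cd (-1) 0 \<otimes> cd (- x) (- tri x - x)))"
    by (simp add: ba m_assoc)
  finally have "b \<otimes> a [^] (x + 1) = a [^] (x + 1) \<otimes> (b \<otimes> cd (-1 - x) (- tri x - x))"
    by (simp add: int_pow_mult cd_mult)
  moreover have "- 1 - x = - (x + 1)" "- tri x - x = - tri (x + 1)" by (simp_all add: tri_add)
  ultimately show ?case by metis
next
  case (step2 x)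
  have bi: "b \<otimes> inv a = inv a \<otimes> (b \<otimes> cd 1 (-1))"
  proof -
    have "a \<otimes> b = b \<otimes> (a \<otimes> cd 1 0)" using ab by (simp add: cd_def m_assoc)
    also have "a \<otimes> cd 1 0 = cd 1 (-1) \<otimes> a" using cd_a[of 1 "-1" 1] by simp
    finally have "a \<otimes> b = b \<otimes> cd 1 (-1) \<otimes> a" by (simp add: m_assoc)
    then have "b \<otimes> cd 1 (-1) = a \<otimes> b \<otimes> inv a"
      by (subst inv_solve_right) simp_all
    then show ?thesis by (simp add: m_assoc)
  qed
  have "b \<otimes> a [^] (x - 1) = (b \<otimes> a [^] x) \<otimes> inv a" by (simp add: int_pow_diff m_assoc)
  also have "\<dots> = a [^] x \<otimes> (b \<otimes> (cd (- x) (- tri x) \<otimes> inv a))" by (simp add: step2 m_assoc)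
  also have "\<dots> = a [^] x \<otimes> (b \<otimes> inv a \<otimes> cd (- x) (- tri x + x))"
    using cd_a[of "-x" "- tri x" "-1"] by (simp add: m_assoc int_pow_neg)
  also have "\<dots> = a [^] x \<otimes> inv a \<otimes> (b \<otimes> (cd 1 (-1) \<otimes> cd (- x) (- tri x + x)))"
    by (simp add: bi m_assoc)
  finally have "b \<otimes> a [^] (x - 1) = a [^] (x - 1) \<otimes> (b \<otimes> cd (1 - x) (- 1 - tri x + x))"
    by (simp add: int_pow_diff cd_mult algebra_simps)
  moreover have "1 - x = - (x - 1)" "- 1 - tri x + x = - tri (x - 1)"
    using tri_add[of x "-1"] tri_minus[of 1] by simp_all
  ultimately show ?case by metis
qed

lemma b_pow_a: "b [^] (y :: int) \<otimes> a [^] (x :: int) = a [^] x \<otimes> (b [^] y \<otimes> cd (- x * y) (- tri x * y))"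
proof -
  have "inv (a [^] x) \<otimes> b \<otimes> a [^] x = b \<otimes> cd (- x) (- tri x)"
    by (simp add: m_assoc b_a_pow)
  then have "inv (a [^] x) \<otimes> b [^] y \<otimes> a [^] x = (b \<otimes> cd (- x) (- tri x)) [^] y"
    using int_pow_conj[of "a [^] x" b y] by simp
  also have "\<dots> = b [^] y \<otimes> cd (- x * y) (- tri x * y)"
    using cd_b[of "- x" "- tri x" 1] by (simp add: int_pow_mult_distrib cd_pow)
  finally have "a [^] x \<otimes> (inv (a [^] x) \<otimes> b [^] y \<otimes> a [^] x) = a [^] x \<otimes> (b [^] y \<otimes> cd (- x * y) (- tri x * y))"
    by simp
  then show ?thesis by (simp add: m_assoc)
qed

definition hm :: "quad \<Rightarrow> 'a" where
  "hm = (\<lambda>(x, y, u, v). a [^] x \<otimes> b [^] y \<otimes> cd u v)"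

text \<open>\<open>cover_mult\<close> records the outcome of merging two collected words with the
  rules \<open>cd_a\<close>, \<open>b_pow_a\<close> and \<open>cd_b\<close>.\<close>

lemma hm_hom: "hm \<in> hom cover G"
proof (rule homI)
  fix g h :: quad
  obtain x y u v where g: "g = (x, y, u, v)" by (cases g)
  obtain x' y' u' v' where h: "h = (x', y', u', v')" by (cases h)
  show "hm g \<in> carrier G" by (simp add: g hm_def)
  have "hm g \<otimes> hm h = a [^] x \<otimes> (b [^] y \<otimes> ((cd u v \<otimes> a [^] x') \<otimes> (b [^] y' \<otimes> cd u' v')))"
    by (simp add: g h hm_def m_assoc)
  also have "\<dots> = a [^] x \<otimes> ((b [^] y \<otimes> a [^] x') \<otimes> ((cd u (v + u * x') \<otimes> b [^] y') \<otimes> cd u' v'))"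
    by (simp add: cd_a m_assoc)
  also have "\<dots> = a [^] x \<otimes> (a [^] x' \<otimes> (b [^] y \<otimes> (cd (- x' * y) (- tri x' * y) \<otimes> b [^] y' \<otimes> (cd u (v + u * x') \<otimes> cd u' v'))))"
    by (simp add: b_pow_a cd_b cd_b' m_assoc)
  also have "\<dots> = a [^] (x + x') \<otimes> b [^] (y + y') \<otimes> (cd (- x' * y) (- tri x' * y) \<otimes> (cd u (v + u * x') \<otimes> cd u' v'))"
    by (simp add: cd_b' int_pow_mult m_assoc)
  finally show "hm (g \<otimes>\<^bsub>cover\<^esub> h) = hm g \<otimes> hm h"
    by (simp add: g h hm_def cd_mult algebra_simps)
qed

sublocale hm: group_hom cover G hm
  by (simp add: group_hom_def group_hom_axioms_def group_cover is_group hm_hom)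

end

text \<open>The square in the hypothesis makes up for the halving in \<open>tri\<close>, which costs
  a factor when p = 2.\<close>

lemma prime_dvd_tri:
  assumes "prime p" "(int p)\<^sup>2 dvd x"
  shows "int p dvd tri x"
proof -
  have "(int p)\<^sup>2 dvd 2 * tri x" using assms(2) by (simp add: two_tri)
  then have "int p * int p dvd 2 * tri x" by (simp add: power2_eq_square)
  show ?thesis
  proof (cases "p = 2")
    case True
    then have "4 dvd 2 * tri x" using \<open>int p * int p dvd 2 * tri x\<close> by simp
    then show ?thesis using True by presburger
  next
    case False
    then have "coprime (int p) 2"
      using assms(1) by (metis coprime_commute int_ops(3) of_nat_numeral coprime_int_iff primes_coprime two_is_prime_nat)
    moreover have "int p dvd 2 * tri x" using \<open>int p * int p dvd 2 * tri x\<close> by (rule dvd_mult_left)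
    ultimately show ?thesis by (simp add: coprime_dvd_mult_right_iff)
  qed
qed

section \<open>The groups with given exponents\<close>

text \<open>The kernel of the map onto the group in which \<open>c ^ (p\<^sup>2) = d ^ p = 1\<close>,
  \<open>a ^ (p ^ n) = c ^ (p \<alpha>1) d ^ \<alpha>2\<close> and \<open>b ^ (p ^ m) = c ^ (p \<beta>1) d ^ \<beta>2\<close>; \<open>M_p_relators\<close> is the
  kernel of the map onto \<open>M_p(n, m, 1)\<close>.\<close>

fun relators :: "nat \<Rightarrow> nat \<Rightarrow> nat \<Rightarrow> quad \<Rightarrow> quad set" where
  "relators p n m (\<alpha>1, \<alpha>2, \<beta>1, \<beta>2) =
    {(x, y, u, v). \<exists>i j. x = int p ^ n * i \<and> y = int p ^ m * j \<and>
       (int p)\<^sup>2 dvd u + int p * (\<alpha>1 * i + \<beta>1 * j) \<and> int p dvd v + \<alpha>2 * i + \<beta>2 * j}"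

definition M_p_relators :: "nat \<Rightarrow> nat \<Rightarrow> nat \<Rightarrow> quad set" where
  "M_p_relators p n m = {(x, y, u, v). int p ^ n dvd x \<and> int p ^ m dvd y \<and> int p dvd u}"

lemma relatorsI:
  assumes "(int p)\<^sup>2 dvd u + int p * (\<alpha>1 * i + \<beta>1 * j)" "int p dvd v + \<alpha>2 * i + \<beta>2 * j"
    "x = int p ^ n * i" "y = int p ^ m * j"
  shows "(x, y, u, v) \<in> relators p n m (\<alpha>1, \<alpha>2, \<beta>1, \<beta>2)"
  using assms by auto

lemma dvd_trans_diff: "(k :: int) dvd a \<Longrightarrow> k dvd b - a \<Longrightarrow> k dvd b"
  using dvd_add by fastforce

text \<open>The exponents i and j of the two power relations add up under multiplication. The
  corrections to the c-coordinate carry a factor x or y and hence p^2; here 2 \<le> m is decisive,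
  since conjugation by a changes this coordinate by a multiple of y. The corrections to the
  d-coordinate need p only, and p divides u as well.\<close>

lemma normal_relators:
  assumes p: "prime p" and m: "2 \<le> m" "m < n"
  shows "relators p n m w \<lhd> cover"
proof -
  obtain \<alpha>1 \<alpha>2 \<beta>1 \<beta>2 where w: "w = (\<alpha>1, \<alpha>2, \<beta>1, \<beta>2)" by (cases w)
  let ?p = "int p"
  have pm: "?p\<^sup>2 dvd ?p ^ m * j" "?p\<^sup>2 dvd ?p ^ n * j" for j
    using m by (auto intro!: dvd_mult2 le_imp_power_dvd)
  have pm1: "?p dvd ?p ^ m * j" "?p dvd ?p ^ n * j" for j using m by auto
  have ptri: "?p dvd tri (?p ^ n * i)" for i using prime_dvd_tri[OF p pm(2)] .
  have psq: "?p dvd u" if "?p\<^sup>2 dvd u + ?p * k" for u k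
    using that by (metis dvd_add_left_iff dvd_mult_left dvd_triv_left power2_eq_square)
  interpret group cover by (rule group_cover)
  have sub: "subgroup (relators p n m w) cover"
  proof (rule subgroupI)
    have "(0, 0, 0, 0) \<in> relators p n m w" unfolding w by (rule relatorsI[where i = 0 and j = 0]) simp_all
    then show "relators p n m w \<noteq> {}" by auto
    fix g assume "g \<in> relators p n m w"
    then obtain i j u v where g: "g = (?p ^ n * i, ?p ^ m * j, u, v)"
      and u: "?p\<^sup>2 dvd u + ?p * (\<alpha>1 * i + \<beta>1 * j)" and v: "?p dvd v + \<alpha>2 * i + \<beta>2 * j"
      unfolding w by auto
    show "inv\<^bsub>cover\<^esub> g \<in> relators p n m w"
      unfolding g w cover_inv
    proof (rule relatorsI[where i = "-i" and j = "-j"])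
      show "?p\<^sup>2 dvd - u - ?p ^ n * i * (?p ^ m * j) + ?p * (\<alpha>1 * - i + \<beta>1 * - j)"
        by (rule dvd_trans_diff[OF dvd_minus_iff[THEN iffD2, OF u]])
          (simp add: algebra_simps pm)
      show "?p dvd - v + u * (?p ^ n * i) + ?p ^ m * j * (tri (?p ^ n * i) + ?p ^ n * i) + \<alpha>2 * - i + \<beta>2 * - j"
        by (rule dvd_trans_diff[OF dvd_minus_iff[THEN iffD2, OF v]])
          (use pm1(1)[of 1] pm1(2)[of 1] ptri[of i] in \<open>auto simp: algebra_simps intro!: dvd_add dvd_mult\<close>)
    qed simp_all
    fix h assume "h \<in> relators p n m w"
    then obtain i' j' u' v' where h: "h = (?p ^ n * i', ?p ^ m * j', u', v')"
      and u': "?p\<^sup>2 dvd u' + ?p * (\<alpha>1 * i' + \<beta>1 * j')" and v': "?p dvd v' + \<alpha>2 * i' + \<beta>2 * j'"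
      unfolding w by auto
    show "g \<otimes>\<^bsub>cover\<^esub> h \<in> relators p n m w"
      unfolding g h w cover_simps cover_mult.simps
    proof (rule relatorsI[where i = "i + i'" and j = "j + j'"])
      show "?p\<^sup>2 dvd u + u' - ?p ^ n * i' * (?p ^ m * j) + ?p * (\<alpha>1 * (i + i') + \<beta>1 * (j + j'))"
        by (rule dvd_trans_diff[OF dvd_add[OF u u']]) (simp add: algebra_simps pm)
      show "?p dvd v + v' + u * (?p ^ n * i') - ?p ^ m * j * tri (?p ^ n * i') + \<alpha>2 * (i + i') + \<beta>2 * (j + j')"
        by (rule dvd_trans_diff[OF dvd_add[OF v v']])
          (use pm1(1)[of 1] pm1(2)[of 1] in \<open>auto simp: algebra_simps intro!: dvd_diff dvd_mult\<close>)
    qed (simp_all add: algebra_simps)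
  qed simp
  show ?thesis
    unfolding normal_inv_iff
  proof (intro conjI ballI sub)
    fix g h :: quad assume "h \<in> relators p n m w"
    then obtain i j u v where h: "h = (?p ^ n * i, ?p ^ m * j, u, v)"
      and u: "?p\<^sup>2 dvd u + ?p * (\<alpha>1 * i + \<beta>1 * j)" and v: "?p dvd v + \<alpha>2 * i + \<beta>2 * j"
      unfolding w by auto
    obtain X Y U V where g: "g = (X, Y, U, V)" by (cases g)
    have pu: "?p dvd u" using psq[OF u] .
    \<comment> \<open>Only the divisibility of x and y matters in the following; hiding i and j
      keeps the polynomial identities small.\<close>
    define x y where "x = ?p ^ n * i" and "y = ?p ^ m * j"
    have h': "h = (x, y, u, v)" by (simp add: h x_def y_def)
    have xy: "?p\<^sup>2 dvd x" "?p\<^sup>2 dvd y" "?p dvd x" "?p dvd y" "?p dvd tri x"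
      using pm pm1 ptri by (simp_all add: x_def y_def)
    have "g \<otimes>\<^bsub>cover\<^esub> h \<otimes>\<^bsub>cover\<^esub> inv\<^bsub>cover\<^esub> g =
      (x, y, u + (X * y - x * Y),  v + (U * x - Y * tri x - u * X + x * Y * X - y * tri X - y * X))"
      by (simp add: g h' tri_minus algebra_simps)
    also have "\<dots> \<in> relators p n m w"
      unfolding w
    proof (rule relatorsI[where i = i and j = j, OF _ _ x_def y_def])
      show "?p\<^sup>2 dvd u + (X * y - x * Y) + ?p * (\<alpha>1 * i + \<beta>1 * j)"
        by (rule dvd_trans_diff[OF u]) (use xy in \<open>simp add: algebra_simps\<close>)
      show "?p dvd v + (U * x - Y * tri x - u * X + x * Y * X - y * tri X - y * X) + \<alpha>2 * i + \<beta>2 * j"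
        by (rule dvd_trans_diff[OF v]) (use xy pu in \<open>simp add: algebra_simps\<close>)
    qed
    finally show "g \<otimes>\<^bsub>cover\<^esub> h \<otimes>\<^bsub>cover\<^esub> inv\<^bsub>cover\<^esub> g \<in> relators p n m w" .
  qed
qed

text \<open>The d-coordinate is free and the c-coordinate counts modulo p only, so 1 \<le> m
  suffices. This quotient has to be available before 2 \<le> m is established.\<close>

lemma normal_M_p_relators:
  assumes m: "1 \<le> m" "m < n"
  shows "M_p_relators p n m \<lhd> cover"
proof -
  let ?p = "int p"
  have pm: "?p dvd y" if "?p ^ m dvd y" for y using m that by (metis dvd_trans dvd_power not_one_le_zero gr0I)
  have pn: "?p dvd y" if "?p ^ n dvd y" for y using m that by (metis dvd_trans dvd_power not_less_zero gr0I)
  interpret group cover by (rule group_cover)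
  have "subgroup (M_p_relators p n m) cover"
    by (rule subgroupI) (auto simp: M_p_relators_def pm pn)
  then show ?thesis
    unfolding normal_inv_iff by (auto simp: M_p_relators_def pm pn algebra_simps)
qed


section \<open>Quotients of the covering group\<close>

lemma (in group_hom) hom_gcomm:
  assumes "x \<in> carrier G" "y \<in> carrier G"
  shows "h (gcomm G x y) = gcomm H (h x) (h y)"
  using assms by (simp add: gcomm_def)

lemma cover_int_pow_cd: "(0, 0, u, v) [^]\<^bsub>cover\<^esub> (k :: int) = (0, 0, k * u, k * v)"
  by (cases k rule: int_cases2) (simp_all add: int_pow_int group.int_pow_neg_int[OF group_cover] cover_pow)

lemma cover_int_pow_a: "(x, 0, 0, 0) [^]\<^bsub>cover\<^esub> (k :: int) = (k * x, 0, 0, 0)"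
  by (cases k rule: int_cases2) (simp_all add: int_pow_int group.int_pow_neg_int[OF group_cover] cover_pow)

lemma cover_int_pow_b: "(0, y, 0, 0) [^]\<^bsub>cover\<^esub> (k :: int) = (0, k * y, 0, 0)"
  by (cases k rule: int_cases2) (simp_all add: int_pow_int group.int_pow_neg_int[OF group_cover] cover_pow)

lemma cover_int_pow_xy: "\<exists>u' v'. (x, y, u, v) [^]\<^bsub>cover\<^esub> (k :: int) = (k * x, k * y, u', v')"
  by (cases k rule: int_cases2) (simp_all add: int_pow_int group.int_pow_neg_int[OF group_cover] cover_pow)

lemma normal_quotient:
  assumes "N \<lhd> G" "group G"
  shows "group (G Mod N)" "(\<lambda>g. N #>\<^bsub>G\<^esub> g) \<in> hom G (G Mod N)"
    "carrier (G Mod N) = (\<lambda>g. N #>\<^bsub>G\<^esub> g) ` carrier G"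
  by (auto simp: assms normal.factorgroup_is_group normal.r_coset_hom_Mod carrier_FactGroup)

lemma coset_eq_iff:
  assumes "N \<lhd> G" "group G" "g \<in> carrier G" "h \<in> carrier G"
  shows "N #>\<^bsub>G\<^esub> g = N #>\<^bsub>G\<^esub> h \<longleftrightarrow> g \<otimes>\<^bsub>G\<^esub> inv\<^bsub>G\<^esub> h \<in> N"
proof -
  interpret N: normal N G by (rule assms)
  show ?thesis
  proof
    assume "N #>\<^bsub>G\<^esub> g = N #>\<^bsub>G\<^esub> h"
    then have "g \<in> N #>\<^bsub>G\<^esub> h" using group.rcos_self[OF assms(2,3) N.subgroup_axioms] by simp
    then show "g \<otimes>\<^bsub>G\<^esub> inv\<^bsub>G\<^esub> h \<in> N" using N.rcos_module_imp[OF assms(2) assms(4)] by simp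
  next
    assume "g \<otimes>\<^bsub>G\<^esub> inv\<^bsub>G\<^esub> h \<in> N"
    then have "g \<in> N #>\<^bsub>G\<^esub> h" using N.rcos_module_rev[OF assms(2)] assms by simp
    then show "N #>\<^bsub>G\<^esub> g = N #>\<^bsub>G\<^esub> h"
      using group.repr_independence[OF assms(2) _ assms(4) N.subgroup_axioms] by simp
  qed
qed

text \<open>With m = 1 the sets \<open>relators\<close> would not be normal: conjugation by a moves
  the c-coordinate of a relator with y = p by p, which is not 0 modulo p^2. For the groups of the
  theorem the bound is proved in \<open>model_iso\<close>.\<close>

locale pnm =
  fixes p n m :: nat
  assumes p: "prime p" and m2: "2 \<le> m" and mn: "m < n"
begin

definition model where "model w = cover Mod relators p n m w"
definition q where "q w g = relators p n m w #>\<^bsub>cover\<^esub> g"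

lemma group_model: "group (model w)"
  unfolding model_def by (rule normal_quotient[OF normal_relators[OF p m2 mn] group_cover])

lemma q_hom: "group_hom cover (model w) (q w)"
  unfolding group_hom_def group_hom_axioms_def
  using normal_quotient(2)[OF normal_relators[OF p m2 mn] group_cover, of w] group_model[of w]
  by (simp add: model_def q_def[abs_def] group_cover)

lemma carrier_model: "carrier (model w) = range (q w)"
  unfolding model_def q_def[abs_def] by (simp add: carrier_FactGroup)

lemma q_closed [simp]: "q w g \<in> carrier (model w)" by (simp add: carrier_model)

lemma q_eq: "q w g = q w h \<longleftrightarrow> cover_mult g (inv\<^bsub>cover\<^esub> h) \<in> relators p n m w"
  unfolding q_def using coset_eq_iff[OF normal_relators[OF p m2 mn] group_cover, of g h w] by simp

lemma q_mult: "q w g \<otimes>\<^bsub>model w\<^esub> q w h = q w (cover_mult g h)"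
  using group_hom.hom_mult[OF q_hom, of g h w] by simp

lemma q_one: "\<one>\<^bsub>model w\<^esub> = q w (0, 0, 0, 0)"
  using group_hom.hom_one[OF q_hom, of w] by simp

lemma q_pow: "q w g [^]\<^bsub>model w\<^esub> (k :: int) = q w (g [^]\<^bsub>cover\<^esub> k)"
  using group_hom.hom_int_pow[OF q_hom, of g w k] by simp

lemma q_gcomm: "gcomm (model w) (q w g) (q w h) = q w (gcomm cover g h)"
  using group_hom.hom_gcomm[OF q_hom, of g h w] by simp

lemma q_pows:
  "q (\<alpha>1, \<alpha>2, \<beta>1, \<beta>2) (int p ^ n * i, int p ^ m * j, u, v) =
   q (\<alpha>1, \<alpha>2, \<beta>1, \<beta>2) (0, 0, u + int p * (\<alpha>1 * i + \<beta>1 * j), v + \<alpha>2 * i + \<beta>2 * j)"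
  unfolding q_eq cover_inv cover_mult.simps
  by (rule relatorsI[where i = i and j = j]) simp_all

lemma p_nonzero [simp]: "int p \<noteq> 0" "p \<noteq> 0" using p by auto

text \<open>A relator with x = y = 0 has i = j = 0, so c and d keep the orders p^2 and p and stay
  independent. The non-triviality arguments in the models rest on this and on
  \<open>q_dvd\<close>.\<close>

lemma q_cd_eq: "q w (0, 0, u, v) = q w (0, 0, u', v') \<longleftrightarrow> (int p)\<^sup>2 dvd u - u' \<and> int p dvd v - v'"
  by (cases w) (auto simp: q_eq)

lemma q_dvd:
  assumes "q w (x, y, u, v) = q w (0, 0, u', v')"
  shows "int p ^ n dvd x \<and> int p ^ m dvd y"
  using assms by (cases w) (auto simp: q_eq)

lemma q_split: "q w (x, y, u, v) =
   q w (1, 0, 0, 0) [^]\<^bsub>model w\<^esub> x \<otimes>\<^bsub>model w\<^esub> q w (0, 1, 0, 0) [^]\<^bsub>model w\<^esub> y \<otimes>\<^bsub>model w\<^esub>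
   (q w (0, 0, 1, 0) [^]\<^bsub>model w\<^esub> u \<otimes>\<^bsub>model w\<^esub> q w (0, 0, 0, 1) [^]\<^bsub>model w\<^esub> v)"
  by (simp add: q_pow q_mult cover_int_pow_cd cover_int_pow_a cover_int_pow_b)

text \<open>Only relations are asserted: a and b need not generate G, and c and d may have smaller
  order. Hence the property passes along homomorphisms, while generation and kernel are treated
  separately in \<open>iso_model\<close>.\<close>

fun has_params :: "quad \<Rightarrow> ('a, 'b) monoid_scheme \<Rightarrow> 'a \<Rightarrow> 'a \<Rightarrow> bool" where
  "has_params (\<alpha>1, \<alpha>2, \<beta>1, \<beta>2) G a b \<longleftrightarrow> a \<in> carrier G \<and> b \<in> carrier G \<and>
    (let c = gcomm G a b; d = gcomm G c a in
      gcomm G c b = \<one>\<^bsub>G\<^esub> \<and> gcomm G d a = \<one>\<^bsub>G\<^esub> \<and> gcomm G d b = \<one>\<^bsub>G\<^esub> \<and>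
      d [^]\<^bsub>G\<^esub> int p = \<one>\<^bsub>G\<^esub> \<and> c [^]\<^bsub>G\<^esub> ((int p)\<^sup>2) = \<one>\<^bsub>G\<^esub> \<and>
      a [^]\<^bsub>G\<^esub> (int p ^ n) = c [^]\<^bsub>G\<^esub> (int p * \<alpha>1) \<otimes>\<^bsub>G\<^esub> d [^]\<^bsub>G\<^esub> \<alpha>2 \<and>
      b [^]\<^bsub>G\<^esub> (int p ^ m) = c [^]\<^bsub>G\<^esub> (int p * \<beta>1) \<otimes>\<^bsub>G\<^esub> d [^]\<^bsub>G\<^esub> \<beta>2)"

lemma has_params_frame:
  assumes "group G" "has_params w G a b"
  shows "frame G a b (gcomm G a b) (gcomm G (gcomm G a b) a)"
proof -
  interpret group G by (rule assms)
  obtain \<alpha>1 \<alpha>2 \<beta>1 \<beta>2 where w: "w = (\<alpha>1, \<alpha>2, \<beta>1, \<beta>2)" by (cases w)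
  have "a \<in> carrier G" "b \<in> carrier G" using assms(2) by (auto simp: w)
  with assms(2) show ?thesis
    unfolding w by unfold_locales (auto simp: Let_def gcomm_one_iff gcomm_eq_iff[symmetric])
qed

text \<open>Substituting the two power relations turns the collected form of a relator into a power
  of \<open>c ^ (p ^ 2)\<close> times a power of \<open>d ^ p\<close>.\<close>

lemma has_params_relators:
  assumes "group G" "has_params w G a b" "g \<in> relators p n m w"
  shows "frame.hm G a b (gcomm G a b) (gcomm G (gcomm G a b) a) g = \<one>\<^bsub>G\<^esub>"
proof -
  obtain \<alpha>1 \<alpha>2 \<beta>1 \<beta>2 where w: "w = (\<alpha>1, \<alpha>2, \<beta>1, \<beta>2)" by (cases w)
  define c where "c = gcomm G a b"
  define d where "d = gcomm G c a"
  interpret frame G a b c d unfolding c_def d_def by (rule has_params_frame[OF assms(1,2)])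
  obtain i j u v s t where g: "g = (int p ^ n * i, int p ^ m * j, u, v)"
    and s: "u + int p * (\<alpha>1 * i + \<beta>1 * j) = (int p)\<^sup>2 * s" and t: "v + \<alpha>2 * i + \<beta>2 * j = int p * t"
    using assms(3) unfolding w by (auto elim!: dvdE)
  have rel: "d [^]\<^bsub>G\<^esub> int p = \<one>\<^bsub>G\<^esub>" "c [^]\<^bsub>G\<^esub> ((int p)\<^sup>2) = \<one>\<^bsub>G\<^esub>"
    "a [^]\<^bsub>G\<^esub> (int p ^ n) = cd (int p * \<alpha>1) \<alpha>2" "b [^]\<^bsub>G\<^esub> (int p ^ m) = cd (int p * \<beta>1) \<beta>2"
    using assms(2) by (simp_all add: w Let_def c_def[symmetric] d_def[symmetric] cd_def)
  have "a [^]\<^bsub>G\<^esub> (int p ^ n * i) = cd (int p * \<alpha>1 * i) (\<alpha>2 * i)"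
    "b [^]\<^bsub>G\<^esub> (int p ^ m * j) = cd (int p * \<beta>1 * j) (\<beta>2 * j)"
    by (simp_all add: int_pow_pow[symmetric] rel cd_pow)
  then have "hm g = cd (u + int p * (\<alpha>1 * i + \<beta>1 * j)) (v + \<alpha>2 * i + \<beta>2 * j)"
    by (simp add: hm_def g cd_mult algebra_simps)
  also have "\<dots> = \<one>\<^bsub>G\<^esub>"
    unfolding s t cd_def by (simp add: int_pow_pow[symmetric] rel)
  finally show ?thesis by (simp add: c_def d_def)
qed

lemma iso_model:
  assumes "group G" "has_params w G a b"
    and surj: "frame.hm G a b (gcomm G a b) (gcomm G (gcomm G a b) a) ` UNIV = carrier G"
    and ker: "\<And>g. frame.hm G a b (gcomm G a b) (gcomm G (gcomm G a b) a) g = \<one>\<^bsub>G\<^esub> \<Longrightarrow> g \<in> relators p n m w"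
  shows "model w \<cong> G"
proof -
  define c where "c = gcomm G a b"
  define d where "d = gcomm G c a"
  interpret frame G a b c d unfolding c_def d_def by (rule has_params_frame[OF assms(1,2)])
  have "kernel cover G hm = relators p n m w"
    using has_params_relators[OF assms(1,2)] ker by (auto simp: kernel_def c_def d_def)
  then show ?thesis
    using hm.FactGroup_iso surj by (simp add: model_def c_def d_def)
qed

text \<open>As c and d are commutators, the values of f on a and b determine those on c and d. If
  such an f exists, an element killed by the collecting map is killed by \<open>q w\<close> too,
  which is the kernel condition of \<open>iso_model\<close>.\<close>

lemma hom_hm:
  assumes "group G" "frame G a b (gcomm G a b) (gcomm G (gcomm G a b) a)" "f \<in> hom G (model w)"
    "f a = q w (1, 0, 0, 0)" "f b = q w (0, 1, 0, 0)"
  shows "f (frame.hm G a b (gcomm G a b) (gcomm G (gcomm G a b) a) g) = q w g"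
proof -
  define c where "c = gcomm G a b"
  define d where "d = gcomm G c a"
  interpret frame G a b c d using assms(2) by (simp add: c_def d_def)
  interpret f: group_hom G "model w" f
    by (simp add: group_hom_def group_hom_axioms_def assms group_model)
  have fc: "f c = q w (0, 0, 1, 0)"
    unfolding c_def by (simp add: f.hom_gcomm assms(4,5) q_gcomm cover_gcomm)
  have fd: "f d = q w (0, 0, 0, 1)"
    unfolding d_def using fc by (simp add: f.hom_gcomm assms(4,5) q_gcomm cover_gcomm)
  obtain x y u v where g: "g = (x, y, u, v)" by (cases g)
  show ?thesis
    unfolding g c_def[symmetric] d_def[symmetric]
    by (simp add: hm_def cd_def f.hom_int_pow fc fd assms(4,5) q_split[of w x y u v])
qed

end

section \<open>Change of generators\<close>

text \<open>The absorption identity makes \<open>k * (p ^ e choose k)\<close> a multiple of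
  \<open>p ^ e\<close>, and cancelling the prime k = 2 or k = 3 loses at most one factor p.\<close>

lemma dvd_binomial_prime_power:
  assumes p: "prime p"
  shows "2 \<le> e \<Longrightarrow> p dvd (p ^ e choose 2)" "2 \<le> e \<Longrightarrow> p dvd (p ^ e choose 3)"
    "3 \<le> e \<Longrightarrow> p\<^sup>2 dvd (p ^ e choose 2)"
proof -
  have p0: "p \<noteq> 0" using p by auto
  have *: "p ^ e dvd k * (p ^ e choose k)" if k: "1 \<le> k" for e k
  proof -
    obtain k' where k': "k = Suc k'" using k by (cases k) auto
    obtain N where N: "p ^ e = Suc N" using p0 by (metis not0_implies_Suc power_not_zero)
    show ?thesis unfolding k' N using Suc_times_binomial_eq[of N k'] by (metis dvd_triv_left mult.commute)
  qed
  have **: "p ^ f dvd C" if d: "p ^ Suc f dvd k * C" and k: "prime k" for f k C :: nat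
  proof (cases "k = p")
    case True
    then show ?thesis using d p0 by simp
  next
    case False
    then have "coprime (p ^ Suc f) k" using p k by (simp add: primes_coprime)
    then have "p ^ Suc f dvd C" using d by (simp add: coprime_dvd_mult_right_iff)
    then show ?thesis by (metis dvd_trans le_imp_power_dvd le_SucI order_refl)
  qed
  have three: "prime (3 :: nat)" by simp
  have pd: "p ^ f dvd p ^ e" if "f \<le> e" for f using that by (rule le_imp_power_dvd)
  show "p dvd (p ^ e choose 2)" if "2 \<le> e"
    using **[of 1 2 "p ^ e choose 2", OF _ two_is_prime_nat] dvd_trans[OF pd[OF that] *[of 2 e]]
    by (simp add: Suc_1 power2_eq_square)
  show "p dvd (p ^ e choose 3)" if "2 \<le> e"
    using **[of 1 3 "p ^ e choose 3", OF _ three] dvd_trans[OF pd[OF that] *[of 3 e]]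
    by (simp add: Suc_1 power2_eq_square)
  show "p\<^sup>2 dvd (p ^ e choose 2)" if "3 \<le> e"
    using **[of 2 2 "p ^ e choose 2", OF _ two_is_prime_nat] dvd_trans[OF pd[OF that] *[of 2 e]]
    by (simp del: power_Suc add: eval_nat_numeral(3)[symmetric])
qed

lemma dvd_diff_iff: "(k :: int) dvd b - a \<Longrightarrow> k dvd a \<longleftrightarrow> k dvd b"
  by (metis dvd_diff_commute dvd_trans_diff)

context pnm begin

lemma prime_int: "prime (int p)" using p by simp

lemma pow_dvd_helper: "int p dvd int p ^ n" "int p dvd int p ^ m" "int p dvd int p ^ (n - m)"
  "(int p)\<^sup>2 dvd int p ^ n" "(int p)\<^sup>2 dvd int p ^ m"
  using m2 mn by (auto intro!: le_imp_power_dvd dvd_power)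

lemma pn_split: "int p ^ n = int p ^ m * int p ^ (n - m)"
  using mn by (simp add: power_add[symmetric])

text \<open>The square in the last line comes from n \<ge> 3. Its analogue for m fails when p = m =
  2, since \<open>4 choose 2\<close> is 6.\<close>

lemma choose_helper:
  "int p dvd int (p ^ n choose 2)" "int p dvd int (p ^ m choose 2)"
  "int p dvd int (p ^ n choose 3)" "int p dvd int (p ^ m choose 3)"
  "(int p)\<^sup>2 dvd int (p ^ n choose 2)"
  using m2 mn dvd_binomial_prime_power[OF p]
  by (auto simp only: int_dvd_int_iff of_nat_power[symmetric])

lemma sq_dvd: "(int p)\<^sup>2 dvd int p * x \<longleftrightarrow> int p dvd x"
  by (simp add: power2_eq_square)

lemma q_int_pow: "q w g [^]\<^bsub>model w\<^esub> (int p ^ e) = q w (g [^]\<^bsub>cover\<^esub> (p ^ e))"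
  unfolding q_pow using int_pow_int[of cover g "p ^ e"] by simp

text \<open>The new c is \<open>c ^ U d ^ V\<close> with U congruent to i k modulo p, and the new d
  is \<open>d ^ (U i)\<close>. The exponents j, u, v, u', v' drop out: they meet only powers of p,
  binomial coefficients divisible by p or, through V, the factor p in the exponent of the new c.
  What remains is linear algebra modulo p, the action on the matrix of exponents.\<close>

lemma has_params_iff:
  assumes w: "w = (\<alpha>1, \<alpha>2, \<beta>1, \<beta>2)"
    and a': "a' = q w (i, j, u, v)" and b': "b' = q w (int p ^ (n - m) * l, k, u', v')"
  shows "has_params (\<alpha>1', \<alpha>2', \<beta>1', \<beta>2') (model w) a' b' \<longleftrightarrow>
    int p dvd \<alpha>1 * i - i * k * \<alpha>1' \<and> int p dvd \<alpha>2 * i - i * i * k * \<alpha>2' \<and>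
    int p dvd \<alpha>1 * l + \<beta>1 * k - i * k * \<beta>1' \<and> int p dvd \<alpha>2 * l + \<beta>2 * k - i * i * k * \<beta>2'"
proof -
  let ?p = "int p"
  let ?P = "?p ^ (n - m)"
  define U where "U = i * k - ?P * l * j"
  define V where "V = u * (?P * l) - j * tri (?P * l) - (u' * i - k * tri i)"
  have c': "gcomm (model w) a' b' = q w (0, 0, U, V)"
    by (simp add: a' b' q_gcomm cover_gcomm U_def V_def)
  have d': "gcomm (model w) (q w (0, 0, U, V)) a' = q w (0, 0, 0, U * i)"
    by (simp add: a' q_gcomm cover_gcomm)
  have triv: "gcomm (model w) (q w (0, 0, U, V)) b' = \<one>\<^bsub>model w\<^esub>"
    "gcomm (model w) (q w (0, 0, 0, U * i)) a' = \<one>\<^bsub>model w\<^esub>"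
    "gcomm (model w) (q w (0, 0, 0, U * i)) b' = \<one>\<^bsub>model w\<^esub>"
    "q w (0, 0, 0, U * i) [^]\<^bsub>model w\<^esub> ?p = \<one>\<^bsub>model w\<^esub>"
    "q w (0, 0, U, V) [^]\<^bsub>model w\<^esub> ?p\<^sup>2 = \<one>\<^bsub>model w\<^esub>"
    using pow_dvd_helper by (simp_all add: a' b' q_gcomm cover_gcomm q_one q_cd_eq q_pow cover_int_pow_cd power2_eq_square)
  have rhs: "q w (0, 0, U, V) [^]\<^bsub>model w\<^esub> (?p * s) \<otimes>\<^bsub>model w\<^esub> q w (0, 0, 0, U * i) [^]\<^bsub>model w\<^esub> t =
      q w (0, 0, ?p * s * U, ?p * s * V + t * (U * i))" for s t
    by (simp add: q_pow cover_int_pow_cd q_mult)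
  have an: "a' [^]\<^bsub>model w\<^esub> (?p ^ n) = q w (0, 0,
      ?p ^ n * u - int (p ^ n choose 2) * i * j + ?p * (\<alpha>1 * i + \<beta>1 * (?P * j)),
      ?p ^ n * v + int (p ^ n choose 2) * i * u - int (p ^ n choose 3) * i * i * j - int (p ^ n choose 2) * j * tri i
        + \<alpha>2 * i + \<beta>2 * (?P * j))"
    unfolding a' q_int_pow cover_pow using q_pows[of \<alpha>1 \<alpha>2 \<beta>1 \<beta>2 i "?P * j"]
    by (simp add: w pn_split mult.assoc)
  have bm: "b' [^]\<^bsub>model w\<^esub> (?p ^ m) = q w (0, 0,
      ?p ^ m * u' - int (p ^ m choose 2) * (?P * l) * k + ?p * (\<alpha>1 * l + \<beta>1 * k),
      ?p ^ m * v' + int (p ^ m choose 2) * (?P * l) * u' - int (p ^ m choose 3) * (?P * l) * (?P * l) * k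
        - int (p ^ m choose 2) * k * tri (?P * l) + \<alpha>2 * l + \<beta>2 * k)"
    unfolding b' q_int_pow cover_pow using q_pows[of \<alpha>1 \<alpha>2 \<beta>1 \<beta>2 l k]
    by (simp add: w pn_split mult.assoc)
  have pU: "?p dvd U - i * k" using pow_dvd_helper by (simp add: U_def)
  have pU': "?p dvd x * U - x * (i * k)" for x
    using pU by (metis dvd_mult right_diff_distrib)
  have pU'': "?p dvd x * (U * i) - x * (i * k * i)" for x
    using pU by (metis dvd_mult dvd_mult2 right_diff_distrib left_diff_distrib)
  \<comment> \<open>The binomial coefficient contributes one factor p, and the exponent of a in b'
    the other.\<close>
  have p2C: "?p\<^sup>2 dvd int (p ^ m choose 2) * (?P * l) * k"
    using mult_dvd_mono[OF choose_helper(2) pow_dvd_helper(3)]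
    by (metis dvd_mult2 mult.assoc power2_eq_square)
  \<comment> \<open>The c-exponents are compared modulo p^2; dividing by p leaves a condition modulo
    p, in which U may be replaced by i k.\<close>
  have sq: "?p\<^sup>2 dvd A + ?p * x - ?p * s * U \<longleftrightarrow> ?p dvd y - i * k * s"
    if "?p\<^sup>2 dvd A" "?p dvd x - y" for A x s y
  proof -
    have "?p\<^sup>2 dvd A + ?p * x - ?p * s * U \<longleftrightarrow> ?p\<^sup>2 dvd ?p * (x - s * U)"
      by (rule dvd_diff_iff) (use that in \<open>simp add: algebra_simps\<close>)
    also have "\<dots> \<longleftrightarrow> ?p dvd x - s * U" by (rule sq_dvd)
    also have "\<dots> \<longleftrightarrow> ?p dvd y - i * k * s"
      by (rule dvd_diff_iff) (use dvd_diff[OF pU'[of s] that(2)] in \<open>simp add: algebra_simps\<close>)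
    finally show ?thesis .
  qed
  \<comment> \<open>The d-exponent of the power \<open>p s\<close> of the new c is
    \<open>p s V\<close>, which vanishes modulo p.\<close>
  have li: "?p dvd A - (?p * s * V + t * (U * i)) \<longleftrightarrow> ?p dvd y - i * i * k * t"
    if "?p dvd A - y" for A s t y
  proof (rule dvd_diff_iff)
    have "?p dvd (t * (U * i) - t * (i * k * i)) - (A - y) + ?p * (s * V)"
      by (intro dvd_add dvd_diff pU'' that) simp
    then show "?p dvd y - i * i * k * t - (A - (?p * s * V + t * (U * i)))"
      by (simp add: algebra_simps)
  qed
  have closed: "a' \<in> carrier (model w)" "b' \<in> carrier (model w)" by (simp_all add: a' b')
  have ea: "a' [^]\<^bsub>model w\<^esub> (?p ^ n) = q w (0, 0, ?p * \<alpha>1' * U, ?p * \<alpha>1' * V + \<alpha>2' * (U * i)) \<longleftrightarrow>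
     ?p dvd \<alpha>1 * i - i * k * \<alpha>1' \<and> ?p dvd \<alpha>2 * i - i * i * k * \<alpha>2'"
    unfolding an q_cd_eq
    by (intro arg_cong2[of _ _ _ _ "(\<and>)"] sq li)
      (use pow_dvd_helper choose_helper in \<open>auto simp: algebra_simps intro!: dvd_add dvd_diff dvd_mult2\<close>)
  have eb: "b' [^]\<^bsub>model w\<^esub> (?p ^ m) = q w (0, 0, ?p * \<beta>1' * U, ?p * \<beta>1' * V + \<beta>2' * (U * i)) \<longleftrightarrow>
     ?p dvd \<alpha>1 * l + \<beta>1 * k - i * k * \<beta>1' \<and> ?p dvd \<alpha>2 * l + \<beta>2 * k - i * i * k * \<beta>2'"
    unfolding bm q_cd_eq
    by (intro arg_cong2[of _ _ _ _ "(\<and>)"] sq li)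
      (use pow_dvd_helper choose_helper p2C in \<open>auto simp: algebra_simps intro!: dvd_add dvd_diff dvd_mult2\<close>)
  show ?thesis
    by (simp add: closed c' d' triv rhs ea eb)
qed

lemma has_params_q: "has_params w (model w) (q w (1, 0, 0, 0)) (q w (0, 1, 0, 0))"
proof -
  obtain \<alpha>1 \<alpha>2 \<beta>1 \<beta>2 where w: "w = (\<alpha>1, \<alpha>2, \<beta>1, \<beta>2)" by (cases w)
  show ?thesis
    unfolding w
    by (subst has_params_iff[OF HOL.refl, where i = 1 and j = 0 and u = 0 and v = 0 and l = 0 and k = 1 and u' = 0 and v' = 0])
      simp_all
qed


lemma q_split_in:
  assumes "subgroup H (model w)" "q w (1, 0, 0, 0) \<in> H" "q w (0, 1, 0, 0) \<in> H"
  shows "q w g \<in> H"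
proof -
  interpret E: group "model w" by (rule group_model)
  interpret H: subgroup H "model w" by (rule assms)
  have gc: "gcomm (model w) x y \<in> H" if "x \<in> H" "y \<in> H" for x y using that by (simp add: gcomm_def)
  have c: "q w (0, 0, 1, 0) \<in> H" using gc[OF assms(2,3)] by (simp add: q_gcomm cover_gcomm)
  have d: "q w (0, 0, 0, 1) \<in> H" using gc[OF c assms(2)] by (simp add: q_gcomm cover_gcomm)
  obtain x y u v where "g = (x, y, u, v)" by (cases g)
  then show ?thesis
    using assms c d by (simp add: q_split[of w x y u v] E.subgroup_int_pow_closed)
qed

text \<open>By Bezout, g is a power of \<open>g ^ i\<close> times a power of
  \<open>g ^ (p ^ e)\<close>, and the latter is trivial.\<close>

lemma coprime_pow_in:
  assumes "group G" "subgroup H G" "g \<in> carrier G" "g [^]\<^bsub>G\<^esub> (int p ^ e) = \<one>\<^bsub>G\<^esub>"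
    "\<not> int p dvd i" "g [^]\<^bsub>G\<^esub> i \<in> H"
  shows "g \<in> H"
proof -
  interpret group G by (rule assms)
  have "coprime (int p ^ e) i" using prime_int assms(5) by (simp add: prime_imp_coprime)
  then obtain s t where "s * i + t * int p ^ e = 1"
    using bezout_int[of i "int p ^ e"] by (metis coprime_commute coprime_imp_gcd_eq_1)
  then have "g [^]\<^bsub>G\<^esub> (i * s + int p ^ e * t) = g" using assms(3) by (simp add: mult.commute)
  then have "g = (g [^]\<^bsub>G\<^esub> i) [^]\<^bsub>G\<^esub> s \<otimes>\<^bsub>G\<^esub> (g [^]\<^bsub>G\<^esub> (int p ^ e)) [^]\<^bsub>G\<^esub> t"
    using assms(3) by (simp add: int_pow_mult int_pow_pow)
  also have "\<dots> \<in> H" using assms subgroup_int_pow_closed[OF assms(2)] by simp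
  finally show ?thesis .
qed

text \<open>The congruences say that a' and b' satisfy the relations with the new exponents, which
  gives a map between the models; invertibility of i and k modulo p makes it bijective. The
  exponents j, u, v, u', v' do not influence the congruences and are taken to be 0.\<close>

lemma model_transform:
  assumes ik: "\<not> int p dvd i" "\<not> int p dvd k"
    and e: "int p dvd \<alpha>1 * i - i * k * \<alpha>1'" "int p dvd \<alpha>2 * i - i * i * k * \<alpha>2'"
    "int p dvd \<alpha>1 * l + \<beta>1 * k - i * k * \<beta>1'" "int p dvd \<alpha>2 * l + \<beta>2 * k - i * i * k * \<beta>2'"
  shows "model (\<alpha>1', \<alpha>2', \<beta>1', \<beta>2') \<cong> model (\<alpha>1, \<alpha>2, \<beta>1, \<beta>2)"
proof -
  define w where "w = (\<alpha>1, \<alpha>2, \<beta>1, \<beta>2)"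
  define w' where "w' = (\<alpha>1', \<alpha>2', \<beta>1', \<beta>2')"
  let ?p = "int p"
  let ?P = "?p ^ (n - m)"
  define a' where "a' = q w (i, 0, 0, 0)"
  define b' where "b' = q w (?P * l, k, 0, 0)"
  define c' where "c' = gcomm (model w) a' b'"
  define d' where "d' = gcomm (model w) c' a'"
  define V where "V = k * tri i"
  have c'q: "c' = q w (0, 0, i * k, V)"
    by (simp add: c'_def a'_def b'_def q_gcomm cover_gcomm V_def)
  have d'q: "d' = q w (0, 0, 0, i * k * i)"
    by (simp add: d'_def c'q a'_def q_gcomm cover_gcomm)
  have has_params: "has_params w' (model w) a' b'"
    using e unfolding w'_def by (subst has_params_iff[OF w_def a'_def b'_def]) simp
  interpret F: frame "model w" a' b' c' d'
    unfolding c'_def d'_def by (rule has_params_frame[OF group_model has_params])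
  have hm_eq: "F.hm (x, y, u, v) = a' [^]\<^bsub>model w\<^esub> x \<otimes>\<^bsub>model w\<^esub> b' [^]\<^bsub>model w\<^esub> y \<otimes>\<^bsub>model w\<^esub>
      (c' [^]\<^bsub>model w\<^esub> u \<otimes>\<^bsub>model w\<^esub> d' [^]\<^bsub>model w\<^esub> v)" for x y u v
    by (simp add: F.hm_def F.cd_def)
  have "carrier (model w) \<subseteq> range F.hm"
  proof -
    have sub: "subgroup (range F.hm) (model w)" using F.hm.img_is_subgroup by simp
    interpret S: subgroup "range F.hm" "model w" by (rule sub)
    have F1: "F.hm (x, y, u, v) \<in> range F.hm" for x y u v by simp
    have a'S: "a' \<in> range F.hm" using F1[of 1 0 0 0] by (simp add: hm_eq)
    have b'S: "b' \<in> range F.hm" using F1[of 0 1 0 0] by (simp add: hm_eq)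
    \<comment> \<open>The order of a divides \<open>p ^ (n + 1)\<close>, so a is recovered from its
      i-th power. Then b is recovered from b' after the power of a is removed.\<close>
    have aS: "q w (1, 0, 0, 0) \<in> range F.hm"
    proof (rule coprime_pow_in[OF group_model sub _ _ ik(1)])
      show "q w (1, 0, 0, 0) [^]\<^bsub>model w\<^esub> (?p ^ (n + 1)) = \<one>\<^bsub>model w\<^esub>"
        using q_pows[of \<alpha>1 \<alpha>2 \<beta>1 \<beta>2 ?p 0 0 0]
        by (simp add: q_pow cover_int_pow_a q_one q_cd_eq w_def mult.commute) (simp add: q_cd_eq power2_eq_square)
      show "q w (1, 0, 0, 0) [^]\<^bsub>model w\<^esub> i \<in> range F.hm"
        using a'S by (simp add: q_pow cover_int_pow_a a'_def)
    qed simp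
    have bS: "q w (0, 1, 0, 0) \<in> range F.hm"
    proof (rule coprime_pow_in[OF group_model sub _ _ ik(2)])
      show "q w (0, 1, 0, 0) [^]\<^bsub>model w\<^esub> (?p ^ (m + 1)) = \<one>\<^bsub>model w\<^esub>"
        using q_pows[of \<alpha>1 \<alpha>2 \<beta>1 \<beta>2 0 ?p 0 0]
        by (simp add: q_pow cover_int_pow_b q_one q_cd_eq w_def mult.commute) (simp add: q_cd_eq power2_eq_square)
      have "q w (0, 1, 0, 0) [^]\<^bsub>model w\<^esub> k = q w (1, 0, 0, 0) [^]\<^bsub>model w\<^esub> (- (?P * l)) \<otimes>\<^bsub>model w\<^esub> b'"
        by (simp add: q_pow cover_int_pow_a cover_int_pow_b b'_def q_mult)
      then show "q w (0, 1, 0, 0) [^]\<^bsub>model w\<^esub> k \<in> range F.hm"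
        using S.m_closed[OF F.subgroup_int_pow_closed[OF sub aS] b'S] by simp
    qed simp
    show ?thesis unfolding carrier_model using q_split_in[OF sub aS bS] by blast
  qed
  then have surj: "range F.hm = carrier (model w)" using F.hm.hom_closed by auto
  have ker: "g \<in> relators p n m w'" if g1: "F.hm g = \<one>\<^bsub>model w\<^esub>" for g
  proof -
    obtain x y u v where g: "g = (x, y, u, v)" by (cases g)
    obtain u1 v1 where 1: "(?P * l, k, 0, 0) [^]\<^bsub>cover\<^esub> y = (y * (?P * l), y * k, u1, v1)"
      using cover_int_pow_xy by blast
    obtain u2 v2 where "F.hm g = q w (x * i + y * (?P * l), y * k, u2, v2)"
      unfolding g hm_eq unfolding c'q d'q a'_def b'_def
      by (simp add: q_pow 1 cover_int_pow_a cover_int_pow_cd q_mult)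
    then have "?p ^ n dvd x * i + y * (?P * l)" "?p ^ m dvd y * k"
      using q_dvd[of w _ _ u2 v2 0 0] g1 by (simp_all add: q_one)
    moreover have cop: "coprime (?p ^ e) k" "coprime (?p ^ e) i" for e
      using prime_int ik by (simp_all add: prime_imp_coprime)
    \<comment> \<open>The b-coordinate is settled before the a-coordinate: once \<open>p ^ m\<close>
      divides y, the mixed term is a multiple of \<open>p ^ n\<close>.\<close>
    ultimately have ym: "?p ^ m dvd y" by (simp add: coprime_dvd_mult_left_iff)
    have "?p ^ n dvd y * (?P * l)"
      using dvd_mult2[OF mult_dvd_mono[OF ym dvd_refl[of ?P]], of l] by (simp add: pn_split mult.assoc)
    then have "?p ^ n dvd x * i" using \<open>?p ^ n dvd x * i + y * (?P * l)\<close> by (simp add: dvd_add_left_iff)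
    then have "?p ^ n dvd x" using cop by (simp add: coprime_dvd_mult_left_iff)
    then obtain X where X: "x = ?p ^ n * X" by (auto elim: dvdE)
    obtain Y where Y: "y = ?p ^ m * Y" using ym by (auto elim: dvdE)
    define U where "U = u + ?p * (\<alpha>1' * X + \<beta>1' * Y)"
    define W where "W = v + \<alpha>2' * X + \<beta>2' * Y"
    \<comment> \<open>Modulo the new relators g is replaced by an element of the subgroup of c and
      d, where the kernel can be read off.\<close>
    have qq: "q w' g = q w' (0, 0, U, W)" unfolding g X Y w'_def U_def W_def by (rule q_pows)
    then have "cover_mult g (inv\<^bsub>cover\<^esub> (0, 0, U, W)) \<in> relators p n m w'" by (simp only: q_eq)
    then have "F.hm (cover_mult g (inv\<^bsub>cover\<^esub> (0, 0, U, W))) = \<one>\<^bsub>model w\<^esub>"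
      using has_params_relators[OF group_model has_params] by (simp add: c'_def d'_def)
    then have "F.hm g \<otimes>\<^bsub>model w\<^esub> inv\<^bsub>model w\<^esub> F.hm (0, 0, U, W) = \<one>\<^bsub>model w\<^esub>"
      using F.hm.hom_mult[of g "inv\<^bsub>cover\<^esub> (0, 0, U, W)"] F.hm.hom_inv[of "(0, 0, U, W)"] by (simp del: cover_inv)
    then have "F.hm (0, 0, U, W) = \<one>\<^bsub>model w\<^esub>" using g1 by (simp add: F.inv_eq_1_iff)
    then have "q w (0, 0, U * (i * k), U * V + W * (i * k * i)) = q w (0, 0, 0, 0)"
      unfolding hm_eq unfolding c'q d'q by (simp add: q_pow cover_int_pow_cd q_mult q_one)
    then have uw: "?p\<^sup>2 dvd U * (i * k)" "?p dvd U * V + W * (i * k * i)" by (simp_all add: q_cd_eq)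
    have U: "?p\<^sup>2 dvd U" using uw(1) cop[of 1] by (simp add: coprime_dvd_mult_left_iff)
    then have "?p dvd U" by (metis dvd_mult_left power2_eq_square)
    then have "?p dvd W * (i * k * i)" using uw(2) by (simp add: dvd_add_right_iff)
    then have W: "?p dvd W" using ik prime_int by (simp add: prime_dvd_mult_iff)
    show ?thesis unfolding g w'_def
      by (rule relatorsI[OF _ _ X Y]) (use U W in \<open>simp_all add: U_def W_def\<close>)
  qed
  show ?thesis
    using iso_model[OF group_model has_params] surj ker by (simp add: c'_def d'_def w_def w'_def)
qed

end

section \<open>The presented groups\<close>

primrec weval :: "('a, 'b) monoid_scheme \<Rightarrow> ('g \<Rightarrow> 'a) \<Rightarrow> 'g gword \<Rightarrow> 'a" where
  "weval G f [] = \<one>\<^bsub>G\<^esub>"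
| "weval G f (x # w) = (if snd x then f (fst x) else inv\<^bsub>G\<^esub> f (fst x)) \<otimes>\<^bsub>G\<^esub> weval G f w"

locale evaluation = group +
  fixes f :: "'g \<Rightarrow> 'a"
  assumes f [simp]: "f g \<in> carrier G"
begin

lemma weval_closed [simp]: "weval G f w \<in> carrier G" by (induction w) simp_all

lemma weval_append: "weval G f (v @ w) = weval G f v \<otimes> weval G f w" by (induction v) (simp_all add: m_assoc)

lemma weval_winv: "weval G f (winv w) = inv (weval G f w)"
  by (induction w) (auto simp: winv_def weval_append inv_mult_group)

lemma weval_power: "weval G f (concat (replicate k w)) = weval G f w [^] k"
proof (induction k)
  case (Suc k)
  then show ?case using nat_pow_Suc2[of "weval G f w" k] by (simp add: weval_append)
qed simp

lemma weval_wpow: "weval G f (w \<up> k) = weval G f w [^] k"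
proof (cases "0 \<le> k")
  case True
  then obtain j where "k = int j" by (metis nonneg_int_cases)
  then show ?thesis by (simp add: wpow_def weval_power int_pow_int)
next
  case False
  then obtain j where "k = - int j" "0 < j" by (metis neg_int_cases not_le)
  then show ?thesis by (simp add: wpow_def weval_power weval_winv int_pow_neg_int nat_pow_inv)
qed

lemma weval_wcomm: "weval G f (wcomm v w) = gcomm G (weval G f v) (weval G f w)"
  by (simp add: wcomm_def gcomm_def weval_append weval_winv m_assoc)

lemma weval_gen: "weval G f [(g, True)] = f g" by simp

lemmas weval_simps = weval_gen weval_append weval_wpow weval_wcomm

lemma weval_pres_eq:
  assumes "\<And>u v. (u, v) \<in> R \<Longrightarrow> weval G f u = weval G f v" "pres_eq S R u v"
  shows "weval G f u = weval G f v"
  using assms(2) by (induction rule: pres_eq.induct) (auto simp: weval_append assms(1))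

text \<open>A class is evaluated at an arbitrary representative; \<open>weval_pres_eq\<close> makes
  the choice irrelevant.\<close>

lemma von_dyck:
  assumes "\<And>u v. (u, v) \<in> R \<Longrightarrow> weval G f u = weval G f v"
  obtains F where "F \<in> hom (presented_group S R) G"
    "\<And>w. w \<in> gen_words S \<Longrightarrow> F (pres_class S R w) = weval G f w"
proof
  define F where "F X = weval G f (SOME w. w \<in> X)" for X
  show F: "F (pres_class S R w) = weval G f w" if "w \<in> gen_words S" for w
  proof -
    have "w \<in> pres_class S R w" using that by (simp add: pres_class_def pres_eq.refl)
    then have "(SOME v. v \<in> pres_class S R w) \<in> pres_class S R w" by (rule someI)
    then show ?thesis using weval_pres_eq[OF assms] by (simp add: F_def pres_class_def)
  qed
  show "F \<in> hom (presented_group S R) G"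
  proof (rule homI)
    fix X Y assume "X \<in> carrier (presented_group S R)" "Y \<in> carrier (presented_group S R)"
    then obtain v w where "v \<in> gen_words S" "X = pres_class S R v" "w \<in> gen_words S" "Y = pres_class S R w"
      by (auto simp: presented_group_def)
    moreover from this have "v @ w \<in> gen_words S" by (simp add: gen_words_def)
    ultimately show "F (X \<otimes>\<^bsub>presented_group S R\<^esub> Y) = F X \<otimes> F Y"
      by (simp add: presented_group_mult F weval_append)
  qed (auto simp: presented_group_def F)
qed

end

text \<open>Generators outside \<open>S\<close> get the junk value \<open>1\<close>, which keeps \<open>weval\<close> inside the carrier.\<close>

definition gen_class :: "'g set \<Rightarrow> ('g gword \<times> 'g gword) set \<Rightarrow> 'g \<Rightarrow> 'g gword set" where
  "gen_class S R g = (if g \<in> S then pres_class S R [(g, True)] else \<one>\<^bsub>presented_group S R\<^esub>)"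

lemma evaluation_gen_class: "evaluation (presented_group S R) (gen_class S R)"
proof -
  interpret group "presented_group S R" by (rule group_presented_group)
  show ?thesis
    by unfold_locales (auto simp: gen_class_def presented_group_def gen_words_def)
qed

lemma weval_gen_class:
  assumes "w \<in> gen_words S"
  shows "weval (presented_group S R) (gen_class S R) w = pres_class S R w"
  using assms
proof (induction w)
  case Nil
  then show ?case by (simp add: presented_group_def)
next
  case (Cons x w)
  interpret group "presented_group S R" by (rule group_presented_group)
  obtain g e where x: "x = (g, e)" by force
  have g: "g \<in> S" and w: "w \<in> gen_words S" using Cons.prems by (auto simp: gen_words_def x)
  have gw: "[(g, b)] \<in> gen_words S" for b using g by (simp add: gen_words_def)
  have "pres_class S R [(g, False)] = inv\<^bsub>presented_group S R\<^esub> pres_class S R [(g, True)]"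
  proof (rule inv_equality[symmetric])
    show "pres_class S R [(g, False)] \<otimes>\<^bsub>presented_group S R\<^esub> pres_class S R [(g, True)] = \<one>\<^bsub>presented_group S R\<^esub>"
      using pres_class_eqI[OF pres_eq.cancel[OF g, of R False]] by (simp add: presented_group_mult gw) (simp add: presented_group_def)
  qed (use gw in \<open>auto simp: presented_group_def\<close>)
  moreover have pg: "gen_class S R g = pres_class S R [(g, True)]" using g by (simp add: gen_class_def)
  ultimately have "weval (presented_group S R) (gen_class S R) (x # w) = pres_class S R [x] \<otimes>\<^bsub>presented_group S R\<^esub> pres_class S R w"
    using Cons.IH[OF w] pg by (cases e) (simp_all add: x)
  then show ?case by (simp add: presented_group_mult gw w x)
qed

lemma weval_gen_class_rel:
  assumes "(u, v) \<in> R" "R \<subseteq> gen_words S \<times> gen_words S"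
  shows "weval (presented_group S R) (gen_class S R) u = weval (presented_group S R) (gen_class S R) v"
proof -
  have uv: "u \<in> gen_words S" "v \<in> gen_words S" using assms by auto
  show ?thesis
    unfolding weval_gen_class[OF uv(1)] weval_gen_class[OF uv(2)]
    by (rule pres_class_eqI[OF pres_eq.relation[OF assms(1) uv]])
qed

lemma presented_group_generated:
  assumes "subgroup H (presented_group S R)" "\<And>g. g \<in> S \<Longrightarrow> gen_class S R g \<in> H"
  shows "carrier (presented_group S R) \<subseteq> H"
proof
  interpret group "presented_group S R" by (rule group_presented_group)
  interpret H: subgroup H "presented_group S R" by (rule assms)
  have "weval (presented_group S R) (gen_class S R) w \<in> H" if "w \<in> gen_words S" for w
    using that by (induction w) (auto simp: assms(2) gen_words_def)
  then have "pres_class S R w \<in> H" if "w \<in> gen_words S" for w using that weval_gen_class[OF that] by metis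
  moreover have "carrier (presented_group S R) = pres_class S R ` gen_words S" by (simp add: presented_group_def)
  ultimately show "X \<in> H" if "X \<in> carrier (presented_group S R)" for X using that by auto
qed

lemma words_simps [simp]:
  "[] \<in> gen_words S" "[(g, e)] \<in> gen_words S \<longleftrightarrow> g \<in> S"
  "v @ w \<in> gen_words S \<longleftrightarrow> v \<in> gen_words S \<and> w \<in> gen_words S"
  by (auto simp: gen_words_def)

lemma wpow_words [simp]: "w \<in> gen_words S \<Longrightarrow> w \<up> k \<in> gen_words S"
  using winv_in_words[of w S] by (auto simp: wpow_def gen_words_def)

lemma wcomm_words [simp]: "v \<in> gen_words S \<Longrightarrow> w \<in> gen_words S \<Longrightarrow> wcomm v w \<in> gen_words S"
  by (simp add: wcomm_def winv_in_words)

context pnm begin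

definition model_gen :: "quad \<Rightarrow> gen \<Rightarrow> quad set" where
  "model_gen w g = (case g of Gen_a \<Rightarrow> q w (1, 0, 0, 0) | Gen_b \<Rightarrow> q w (0, 1, 0, 0)
     | Gen_c \<Rightarrow> q w (0, 0, 1, 0) | Gen_d \<Rightarrow> q w (0, 0, 0, 1))"

lemma evaluation_model_gen: "evaluation (model w) (model_gen w)"
proof -
  interpret group "model w" by (rule group_model)
  show ?thesis by unfold_locales (auto simp: model_gen_def split: gen.split)
qed

text \<open>\<open>fwd\<close> makes P a quotient of \<open>model w\<close>; \<open>bwd\<close>
  gives a homomorphism back and so excludes any further collapse. \<open>fwd\<close> ranges over all
  groups satisfying R, which allows computing with abstract elements. It mentions
  \<open>Gen_d\<close> conditionally because only some of the presentations have this
  generator.\<close>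

lemma presented_iso_model:
  fixes S R
  defines "P \<equiv> presented_group S R"
  defines "a \<equiv> gen_class S R Gen_a" and "b \<equiv> gen_class S R Gen_b" and "c \<equiv> gen_class S R Gen_c" and "d \<equiv> gen_class S R Gen_d"
  assumes S: "{Gen_a, Gen_b, Gen_c} \<subseteq> S" and R: "R \<subseteq> gen_words S \<times> gen_words S"
    and fwd: "\<And>(H :: gen gword set monoid) f. evaluation H f \<Longrightarrow> \<forall>(u, v) \<in> R. weval H f u = weval H f v \<Longrightarrow>
      gcomm H (f Gen_a) (f Gen_b) = f Gen_c \<and> (Gen_d \<in> S \<longrightarrow> gcomm H (f Gen_c) (f Gen_a) = f Gen_d) \<and>
      has_params w H (f Gen_a) (f Gen_b)"
    and bwd: "\<forall>(u, v) \<in> R. weval (model w) (model_gen w) u = weval (model w) (model_gen w) v"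
  shows "model w \<cong> P"
proof -
  have "\<forall>(u, v) \<in> R. weval P (gen_class S R) u = weval P (gen_class S R) v"
    unfolding P_def using weval_gen_class_rel[OF _ R] by blast
  from fwd[OF evaluation_gen_class[of S R, folded P_def] this]
  have c: "gcomm P a b = c" and d: "Gen_d \<in> S \<Longrightarrow> gcomm P c a = d" and has_params: "has_params w P a b"
    by (simp_all add: a_def b_def c_def d_def)
  have rel: "weval (model w) (model_gen w) u = weval (model w) (model_gen w) v" if "(u, v) \<in> R" for u v using bwd that by blast
  show ?thesis
proof (rule iso_model[OF _ has_params])
  show "group P" by (simp add: P_def group_presented_group)
  then interpret F: frame P a b c "gcomm P c a"
    using has_params_frame[OF _ has_params] c by simp
  interpret E: evaluation "model w" "model_gen w" by (rule evaluation_model_gen)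
  have sub: "subgroup (range F.hm) P" using F.hm.img_is_subgroup by simp
  have gens: "gen_class S R g \<in> range F.hm" if g: "g \<in> S" for g
  proof -
    have F1: "F.hm (x, y, u, v) \<in> range F.hm" for x y u v by simp
    have "a \<in> range F.hm" using F1[of 1 0 0 0] by (simp add: F.hm_def F.cd_def)
    moreover have "b \<in> range F.hm" using F1[of 0 1 0 0] by (simp add: F.hm_def F.cd_def)
    moreover have "c \<in> range F.hm" using F1[of 0 0 1 0] by (simp add: F.hm_def F.cd_def)
    moreover have "gcomm P c a \<in> range F.hm" using F1[of 0 0 0 1] by (simp add: F.hm_def F.cd_def)
    ultimately show ?thesis
      using g d by (cases g) (simp_all add: a_def b_def c_def d_def)
  qed
  have "carrier P \<subseteq> range F.hm"
    using presented_group_generated[of "range F.hm" S R, folded P_def, OF sub gens] .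
  then show "frame.hm P a b (gcomm P a b) (gcomm P (gcomm P a b) a) ` UNIV = carrier P"
    using F.hm.hom_closed unfolding c by auto
  fix g assume "frame.hm P a b (gcomm P a b) (gcomm P (gcomm P a b) a) g = \<one>\<^bsub>P\<^esub>"
  then have g: "F.hm g = \<one>\<^bsub>P\<^esub>" by (simp add: c)
  obtain F where F: "F \<in> hom P (model w)" "\<And>v. v \<in> gen_words S \<Longrightarrow> F (pres_class S R v) = weval (model w) (model_gen w) v"
    using E.von_dyck[of R S] rel unfolding P_def by blast
  have Fg: "F (gen_class S R g) = model_gen w g" if "g \<in> S" for g
    using F(2)[of "[(g, True)]"] that by (simp add: gen_class_def)
  have Fa: "F a = q w (1, 0, 0, 0)" and Fb: "F b = q w (0, 1, 0, 0)"
    using Fg[of Gen_a] Fg[of Gen_b] S by (simp_all add: model_gen_def a_def b_def)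
  \<comment> \<open>The map from \<open>cover\<close> to P followed by F is the projection
    \<open>q w\<close>, so an element that becomes trivial in P is a relator.\<close>
  have "q w g = F (F.hm g)"
    using hom_hm[OF \<open>group P\<close> has_params_frame[OF \<open>group P\<close> has_params] F(1) Fa Fb, of g] unfolding c by simp
  also have "\<dots> = \<one>\<^bsub>model w\<^esub>"
    unfolding g by (rule hom_one[OF F(1) \<open>group P\<close> group_model])
  finally have "q w g = q w (0, 0, 0, 0)" by (simp add: q_one)
  then show "g \<in> relators p n m w" by (cases g) (simp only: q_eq cover_inv cover_mult.simps, simp)
qed
qed

end


section \<open>Commutator rules and inverses modulo p\<close>

context group begin

lemma gcomm_swap: "x \<in> carrier G \<Longrightarrow> y \<in> carrier G \<Longrightarrow> gcomm G y x = inv (gcomm G x y)"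
  by (simp add: gcomm_def inv_mult_group m_assoc)

text \<open>Conjugation by a sends b to \<open>b c^-1\<close>, a product of commuting elements, so
  its k-th power can be taken factor by factor.\<close>

lemma gcomm_int_pow_right:
  assumes [simp]: "a \<in> carrier G" "b \<in> carrier G" and cb: "gcomm G a b \<otimes> b = b \<otimes> gcomm G a b"
  shows "gcomm G a (b [^] (k :: int)) = gcomm G a b [^] k"
proof -
  define c where "c = gcomm G a b"
  have [simp]: "c \<in> carrier G" by (simp add: c_def)
  have ab: "a \<otimes> b = b \<otimes> a \<otimes> c" using gcomm_eq_iff[of a b c] by (simp add: c_def)
  have "inv a \<otimes> b \<otimes> a = b \<otimes> inv c"
  proof -
    have "b \<otimes> a = a \<otimes> b \<otimes> inv c" by (subst inv_solve_right) (simp_all add: ab)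
    then show ?thesis by (simp add: m_assoc)
  qed
  then have "inv a \<otimes> b [^] k \<otimes> a = (b \<otimes> inv c) [^] k" using int_pow_conj[of a b k] by simp
  also have "\<dots> = b [^] k \<otimes> inv (c [^] k)"
    using comm_inv[of c b] cb by (simp add: int_pow_mult_distrib c_def int_pow_inv)
  finally have "b [^] k \<otimes> a = a \<otimes> (b [^] k \<otimes> inv (c [^] k))"
    by (metis \<open>a \<in> carrier G\<close> \<open>b \<in> carrier G\<close> \<open>c \<in> carrier G\<close> int_pow_closed inv_cancel(1) inv_closed m_assoc m_closed)
  then have "b [^] k \<otimes> a \<otimes> c [^] k = a \<otimes> b [^] k" by (simp add: m_assoc)
  then show ?thesis by (simp add: gcomm_eq_iff c_def)
qed

lemma comm_mult:
  assumes "x \<in> carrier G" "a \<in> carrier G" "b \<in> carrier G" "x \<otimes> a = a \<otimes> x" "x \<otimes> b = b \<otimes> x"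
  shows "x \<otimes> (a \<otimes> b) = (a \<otimes> b) \<otimes> x"
  using assms by (metis m_assoc)

lemma comm_gcomm:
  assumes "x \<in> carrier G" "a \<in> carrier G" "b \<in> carrier G" "x \<otimes> a = a \<otimes> x" "x \<otimes> b = b \<otimes> x"
  shows "x \<otimes> gcomm G a b = gcomm G a b \<otimes> x"
proof -
  have "x \<otimes> inv a = inv a \<otimes> x" "x \<otimes> inv b = inv b \<otimes> x"
    using comm_inv[of a x] comm_inv[of b x] assms by simp_all
  then show ?thesis
    unfolding gcomm_def by (intro comm_mult) (simp_all add: assms)
qed

lemma int_pow_mult_eq_one:
  assumes "x \<in> carrier G" "x [^] (k :: int) = \<one>" "k dvd l"
  shows "x [^] l = \<one>"
  using assms by (auto elim!: dvdE simp: int_pow_pow[symmetric])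

lemma int_pow_cong:
  assumes "x \<in> carrier G" "x [^] (k :: int) = \<one>" "k dvd l - l'"
  shows "x [^] l = x [^] l'"
  using int_pow_mult_eq_one[OF assms] int_pow_mult[of x "l - l'" l'] assms(1) by simp

end

text \<open>A fixed inverse is needed as a function because the exponents in
  \<open>label_params\<close> contain 1 / \<nu> and 1 / t; only its class modulo p matters.\<close>

definition minv :: "nat \<Rightarrow> int \<Rightarrow> int" where
  "minv p \<nu> = fst (bezout_coefficients \<nu> (int p))"

lemma minv:
  assumes "prime p" "\<not> int p dvd \<nu>"
  shows "int p dvd \<nu> * minv p \<nu> - 1"
proof -
  have "coprime (int p) \<nu>" using assms by (simp add: prime_imp_coprime)
  then have "coprime \<nu> (int p)" by (simp add: coprime_commute)
  then have "minv p \<nu> * \<nu> + snd (bezout_coefficients \<nu> (int p)) * int p = 1"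
    using bezout_coefficients_fst_snd[of \<nu> "int p"] by (simp add: minv_def coprime_imp_gcd_eq_1)
  then have "\<nu> * minv p \<nu> - 1 = int p * - snd (bezout_coefficients \<nu> (int p))" by (simp add: algebra_simps)
  then show ?thesis by simp
qed

lemma minv_not_dvd:
  assumes p: "prime p" and x: "\<not> int p dvd x"
  shows "\<not> int p dvd minv p x"
proof
  assume "int p dvd minv p x"
  then have "int p dvd x * minv p x" by simp
  then have "int p dvd 1" using minv[OF p x] by (metis dvd_diff_commute dvd_trans_diff)
  then show False using p by auto
qed

text \<open>The exponents \<open>(\<alpha>1, \<alpha>2, \<beta>1, \<beta>2)\<close> that the presentations prescribe once every relation is written
  in terms of \<open>c ^ p\<close> and \<open>d = [c, a]\<close>; for instance \<open>[a, c] = b ^ (\<nu> p ^ m)\<close> becomes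
  \<open>b ^ (p ^ m) = d ^ (- 1 / \<nu>)\<close>.\<close>

fun label_params :: "nat \<Rightarrow> M_label \<Rightarrow> quad" where
  "label_params p (M1 \<nu> s) = (1, int s, 0, - minv p \<nu>)"
| "label_params p M2 = (1, -1, 0, 0)"
| "label_params p M3 = (1, 0, 0, 0)"
| "label_params p M4 = (0, -1, 1, 0)"
| "label_params p M5 = (0, -1, 0, 0)"
| "label_params p (M6 t) = (0, 0, 1, - minv p (int t))"
| "label_params p M7 = (0, 0, 1, 0)"
| "label_params p (M8 \<nu>) = (0, 0, 0, - minv p \<nu>)"
| "label_params p M9 = (0, 0, 0, 0)"

text \<open>The parameters whose inverse occurs in \<open>label_params\<close> must be invertible
  modulo p. This condition makes sense without a chosen non-residue.\<close>

fun good_label :: "nat \<Rightarrow> M_label \<Rightarrow> bool" where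
  "good_label p (M1 \<nu> s) \<longleftrightarrow> \<not> int p dvd \<nu>"
| "good_label p (M6 t) \<longleftrightarrow> \<not> int p dvd int t"
| "good_label p (M8 \<nu>) \<longleftrightarrow> \<not> int p dvd \<nu>"
| "good_label p _ \<longleftrightarrow> True"

text \<open>All nine presentations yield c = [a, b] and [c, b] = 1. The other relations in
  \<open>has_params\<close>, such as the orders of c and d and the commutation of d with a and b,
  have to be derived wherever the presentation does not state them.\<close>

locale pnm_group = pnm p n m + group G for p n m and G (structure) +
  fixes a b c
  assumes a [simp]: "a \<in> carrier G" and b [simp]: "b \<in> carrier G"
    and cdef: "gcomm G a b = c" and cb1: "gcomm G c b = \<one>"
begin

lemma c [simp]: "c \<in> carrier G" using cdef a b by (metis gcomm_closed)

lemma cb: "c \<otimes> b = b \<otimes> c" using cb1 by (simp add: gcomm_one_iff)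

lemma has_paramsI:
  assumes "gcomm G c a = d" "gcomm G d a = \<one>" "gcomm G d b = \<one>" "d [^] int p = \<one>" "c [^] ((int p)\<^sup>2) = \<one>"
    "a [^] (int p ^ n) = c [^] (int p * \<alpha>1) \<otimes> d [^] \<alpha>2"
    "b [^] (int p ^ m) = c [^] (int p * \<beta>1) \<otimes> d [^] \<beta>2"
  shows "has_params (\<alpha>1, \<alpha>2, \<beta>1, \<beta>2) G a b"
  using assms by (simp add: cdef cb1)

lemma pow_Suc_one: "x \<in> carrier G \<Longrightarrow> x [^] (int p ^ (e + 1)) = \<one> \<Longrightarrow> (x [^] (int p ^ e)) [^] int p = \<one>"
  by (simp add: int_pow_pow mult.commute)

lemma has_params_M3:
  assumes "a [^] (int p ^ (n + 1)) = \<one>" "b [^] (int p ^ m) = \<one>" "d [^] int p = \<one>"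
    "c [^] int p = a [^] (int p ^ n)" "gcomm G c a = d" "gcomm G d a = \<one>" "gcomm G d b = \<one>"
  shows "has_params (label_params p M3) G a b"
  unfolding label_params.simps
proof (rule has_paramsI[OF assms(5-7,3)])
  have "(c [^] int p) [^] int p = \<one>" unfolding assms(4) by (rule pow_Suc_one) (use assms in simp_all)
  then show "c [^] (int p)\<^sup>2 = \<one>" by (simp add: int_pow_pow power2_eq_square)
qed (use assms in simp_all)

lemma has_params_M7:
  assumes "a [^] (int p ^ n) = \<one>" "b [^] (int p ^ (m + 1)) = \<one>" "d [^] int p = \<one>"
    "c [^] int p = b [^] (int p ^ m)" "gcomm G c a = d" "gcomm G d a = \<one>" "gcomm G d b = \<one>"
  shows "has_params (label_params p M7) G a b"
  unfolding label_params.simps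
proof (rule has_paramsI[OF assms(5-7,3)])
  have "(c [^] int p) [^] int p = \<one>" unfolding assms(4) by (rule pow_Suc_one) (use assms in simp_all)
  then show "c [^] (int p)\<^sup>2 = \<one>" by (simp add: int_pow_pow power2_eq_square)
qed (use assms in simp_all)

lemma has_params_M9:
  assumes "a [^] (int p ^ n) = \<one>" "b [^] (int p ^ m) = \<one>" "c [^] ((int p)\<^sup>2) = \<one>" "d [^] int p = \<one>"
    "gcomm G c a = d" "gcomm G d a = \<one>" "gcomm G d b = \<one>"
  shows "has_params (label_params p M9) G a b"
  unfolding label_params.simps
  by (rule has_paramsI[OF assms(5-7,4)]) (use assms in simp_all)

text \<open>The commutator of a and \<open>b ^ k\<close> is \<open>c ^ k\<close>, and p^2 divides k
  because m \<ge> 2.\<close>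

lemma b_pow_comm_a:
  assumes "c [^] ((int p)\<^sup>2) = \<one>" "int p ^ m dvd k"
  shows "b [^] k \<otimes> a = a \<otimes> b [^] k"
proof -
  have "(int p)\<^sup>2 dvd k" using assms(2) m2 by (meson dvd_trans le_imp_power_dvd)
  then have "gcomm G a (b [^] k) = \<one>"
    using gcomm_int_pow_right[of a b k] cb int_pow_mult_eq_one[OF c assms(1)] by (simp add: cdef)
  then show ?thesis by (simp add: gcomm_one_iff)
qed

text \<open>Here d is a power of \<open>b ^ (p ^ m)\<close>, which commutes with b and, by
  \<open>b_pow_comm_a\<close>, with a. The relation is solved for \<open>b ^ (p ^ m)\<close> by
  inverting \<nu> modulo p.\<close>

lemma M1_M8_aux:
  assumes "c [^] ((int p)\<^sup>2) = \<one>" "b [^] (int p ^ (m + 1)) = \<one>" "gcomm G a c = b [^] (\<nu> * int p ^ m)"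
    and \<nu>: "\<not> int p dvd \<nu>"
  defines "d \<equiv> gcomm G c a"
  shows "d = b [^] (- (\<nu> * int p ^ m))" "gcomm G d a = \<one>" "gcomm G d b = \<one>" "d [^] int p = \<one>"
    "b [^] (int p ^ m) = d [^] (- minv p \<nu>)"
proof -
  show d: "d = b [^] (- (\<nu> * int p ^ m))"
    using assms(3) gcomm_swap[of a c] by (simp add: d_def int_pow_neg)
  show "gcomm G d a = \<one>" unfolding d by (subst gcomm_one_iff) (simp_all add: b_pow_comm_a[OF assms(1)])
  show "gcomm G d b = \<one>" unfolding d by (subst gcomm_one_iff) (simp_all add: comm_int_pow)
  show "d [^] int p = \<one>"
    unfolding d int_pow_pow[OF b] by (rule int_pow_mult_eq_one[OF b assms(2)]) simp
  have "int p * int p ^ m dvd (\<nu> * minv p \<nu> - 1) * int p ^ m"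
    using minv[OF p \<nu>] by (intro mult_dvd_mono) simp_all
  then show "b [^] (int p ^ m) = d [^] (- minv p \<nu>)"
    unfolding d int_pow_pow[OF b]
    by (intro int_pow_cong[OF b assms(2)]) (simp add: algebra_simps dvd_diff_commute)
qed

lemma has_params_M8:
  assumes "a [^] (int p ^ n) = \<one>" "b [^] (int p ^ (m + 1)) = \<one>" "c [^] ((int p)\<^sup>2) = \<one>"
    "gcomm G a c = b [^] (\<nu> * int p ^ m)" "\<not> int p dvd \<nu>"
  shows "has_params (label_params p (M8 \<nu>)) G a b"
  unfolding label_params.simps
  by (rule has_paramsI[OF HOL.refl]) (use assms M1_M8_aux[OF assms(3,2,4,5)] in simp_all)

text \<open>The presentation does not state \<open>c ^ (p ^ 2) = 1\<close>. Let A and B be the two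
  factors of \<open>c ^ p\<close>. Then A is \<open>c ^ p B^-1\<close> and commutes with b, hence
  with B, and both have trivial p-th power.\<close>

lemma has_params_M1:
  assumes "a [^] (int p ^ (n + 1)) = \<one>" "b [^] (int p ^ (m + 1)) = \<one>"
    "c [^] int p = a [^] (int p ^ n) \<otimes> b [^] (int s * \<nu> * int p ^ m)"
    "gcomm G a c = b [^] (\<nu> * int p ^ m)" "\<not> int p dvd \<nu>"
  shows "has_params (label_params p (M1 \<nu> s)) G a b"
proof -
  define B where "B = b [^] (int s * \<nu> * int p ^ m)"
  define A where "A = a [^] (int p ^ n)"
  have [simp]: "A \<in> carrier G" "B \<in> carrier G" by (simp_all add: A_def B_def)
  have Bp: "B [^] int p = \<one>" unfolding B_def int_pow_pow[OF b]
    by (rule int_pow_mult_eq_one[OF b assms(2)]) simp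
  have Ap: "A [^] int p = \<one>" unfolding A_def by (rule pow_Suc_one) (use assms in simp_all)
  have A: "A = c [^] int p \<otimes> inv B" by (subst inv_solve_right) (simp_all add: assms(3) A_def B_def)
  have bB: "b \<otimes> B = B \<otimes> b" unfolding B_def by (simp add: comm_int_pow)
  have cp: "b \<otimes> c [^] int p = c [^] int p \<otimes> b" using comm_int_pow[OF c b cb] by simp
  have "b \<otimes> A = A \<otimes> b" unfolding A
    by (rule comm_mult) (use cp comm_inv[of B b] bB in simp_all)
  then have "A \<otimes> B = B \<otimes> A" unfolding B_def by (subst comm_int_pow) simp_all
  then have "(A \<otimes> B) [^] int p = \<one>" by (simp add: int_pow_mult_distrib Ap Bp)
  then have c2: "c [^] ((int p)\<^sup>2) = \<one>"
    using assms(3) by (simp add: A_def B_def int_pow_pow[symmetric] power2_eq_square)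
  note aux = M1_M8_aux[OF c2 assms(2,4,5)]
  have "inv B = gcomm G c a [^] int s"
    unfolding aux(1) B_def int_pow_pow[OF b] by (simp add: int_pow_neg[symmetric] mult_ac)
  then show ?thesis
    unfolding label_params.simps by (intro has_paramsI[OF HOL.refl]) (use assms aux c2 A in \<open>simp_all add: A_def\<close>)
qed

text \<open>The last relation makes A = \<open>a ^ (p ^ n)\<close> commute with a, b and c. Then d =
  \<open>c ^ p A^-1\<close> commutes with c and has trivial p-th power, so conjugation by a fixes
  \<open>c ^ p\<close>, and therefore d commutes with a.\<close>

lemma has_params_M2:
  assumes "a [^] (int p ^ (n + 1)) = \<one>" "b [^] (int p ^ m) = \<one>" "c [^] ((int p)\<^sup>2) = \<one>"
    "gcomm G c a = c [^] int p \<otimes> a [^] (- (int p ^ n))" "gcomm G (a [^] (int p ^ n)) b = \<one>"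
  shows "has_params (label_params p M2) G a b"
proof -
  define A where "A = a [^] (int p ^ n)"
  define d where "d = gcomm G c a"
  have [simp]: "A \<in> carrier G" "d \<in> carrier G" by (simp_all add: A_def d_def)
  have Ap: "A [^] int p = \<one>" unfolding A_def by (rule pow_Suc_one) (use assms in simp_all)
  have d: "d = c [^] int p \<otimes> inv A" using assms(4) by (simp add: d_def A_def int_pow_neg)
  have Ab: "A \<otimes> b = b \<otimes> A" using assms(5) by (simp add: A_def gcomm_one_iff)
  have Aa: "A \<otimes> a = a \<otimes> A" by (simp add: A_def comm_int_pow)
  have Ac: "A \<otimes> c = c \<otimes> A" using comm_gcomm[of A a b] Ab Aa by (simp add: cdef)
  have cd: "c \<otimes> d = d \<otimes> c" unfolding d
    by (rule comm_mult) (use comm_int_pow[of c c] comm_inv[of A c] Ac in simp_all)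
  have dp: "d [^] int p = \<one>"
    unfolding d using comm_inv[of A "c [^] int p"] comm_int_pow[of c A "int p"] Ac assms(3)
    by (simp add: int_pow_mult_distrib int_pow_pow power2_eq_square int_pow_inv Ap)
  have db: "d \<otimes> b = b \<otimes> d" unfolding d
    by (rule comm_mult[symmetric]) (use comm_int_pow[OF c b cb] comm_inv[of A b] Ab in simp_all)
  have ca: "c \<otimes> a = a \<otimes> c \<otimes> d" using gcomm_eq_iff[of c a d] by (simp add: d_def)
  have "inv a \<otimes> c \<otimes> a = c \<otimes> d" using ca by (simp add: m_assoc)
  then have "inv a \<otimes> c [^] int p \<otimes> a = c [^] int p"
    using int_pow_conj[of a c "int p"] cd dp by (simp add: int_pow_mult_distrib)
  then have cpa: "c [^] int p \<otimes> a = a \<otimes> c [^] int p" by (metis a c int_pow_closed inv_cancel(1) inv_closed m_assoc m_closed)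
  have da: "d \<otimes> a = a \<otimes> d" unfolding d
    by (rule comm_mult[symmetric]) (use cpa comm_inv[of A a] Aa in simp_all)
  have "inv d = A \<otimes> inv (c [^] int p)" by (simp add: d inv_mult_group)
  then have "c [^] int p \<otimes> inv d = A"
    using comm_int_pow[of c A "int p"] Ac by (simp add: m_assoc[symmetric]) (simp add: m_assoc)
  then show ?thesis
    unfolding label_params.simps
    by (intro has_paramsI[of d]) (use assms dp da db in \<open>simp_all add: d_def[symmetric] gcomm_one_iff A_def int_pow_neg\<close>)
qed

text \<open>This is the argument for \<open>M2\<close> with \<open>b ^ (p ^ m)\<close> in place of
  \<open>a ^ (p ^ n)\<close>; inverting t modulo p expresses that power through \<open>c ^ p\<close>
  and d.\<close>

lemma has_params_M6:
  assumes "a [^] (int p ^ n) = \<one>" "b [^] (int p ^ (m + 1)) = \<one>" "c [^] ((int p)\<^sup>2) = \<one>"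
    "gcomm G c a = c [^] (int t * int p) \<otimes> b [^] (- (int t * int p ^ m))" "gcomm G (b [^] (int p ^ m)) a = \<one>"
    "\<not> int p dvd int t"
  shows "has_params (label_params p (M6 t)) G a b"
proof -
  define B where "B = b [^] (int p ^ m)"
  define d where "d = gcomm G c a"
  have [simp]: "B \<in> carrier G" "d \<in> carrier G" by (simp_all add: B_def d_def)
  have Bp: "B [^] int p = \<one>" unfolding B_def by (rule pow_Suc_one) (use assms in simp_all)
  have d: "d = c [^] (int p * int t) \<otimes> B [^] (- int t)"
    using assms(4) by (simp add: d_def B_def int_pow_pow mult_ac)
  have Ba: "B \<otimes> a = a \<otimes> B" using assms(5) by (simp add: B_def gcomm_one_iff)
  have Bb: "B \<otimes> b = b \<otimes> B" by (simp add: B_def comm_int_pow)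
  have Bc: "B \<otimes> c = c \<otimes> B" using comm_gcomm[of B a b] Bb Ba by (simp add: cdef)
  have Bx: "c [^] k \<otimes> B [^] l = B [^] l \<otimes> c [^] k" for k l :: int using comm_int_pow2[of c B k l] Bc by simp
  have cd: "c \<otimes> d = d \<otimes> c" unfolding d
    by (rule comm_mult) (use comm_int_pow[of c c] comm_int_pow[of B c] Bc in simp_all)
  have dp: "d [^] int p = \<one>"
  proof -
    have "c [^] (int p * int t * int p) = \<one>" by (rule int_pow_mult_eq_one[OF c assms(3)]) (simp add: power2_eq_square)
    moreover have "B [^] (- int t * int p) = \<one>" by (rule int_pow_mult_eq_one[OF _ Bp]) simp_all
    ultimately show ?thesis unfolding d using Bx by (simp add: int_pow_mult_distrib int_pow_pow)
  qed
  have db: "d \<otimes> b = b \<otimes> d" unfolding d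
    by (rule comm_mult[symmetric]) (use comm_int_pow[OF c b cb] comm_int_pow[of B b] Bb in simp_all)
  have ca: "c \<otimes> a = a \<otimes> c \<otimes> d" using gcomm_eq_iff[of c a d] by (simp add: d_def)
  have "inv a \<otimes> c \<otimes> a = c \<otimes> d" using ca by (simp add: m_assoc)
  then have "inv a \<otimes> c [^] (int p * int t) \<otimes> a = c [^] (int p * int t)"
    using int_pow_conj[of a c "int p * int t"] cd int_pow_mult_eq_one[OF _ dp] by (simp add: int_pow_mult_distrib)
  then have cpa: "c [^] (int p * int t) \<otimes> a = a \<otimes> c [^] (int p * int t)"
    by (metis a c int_pow_closed inv_cancel(1) inv_closed m_assoc m_closed)
  have da: "d \<otimes> a = a \<otimes> d" unfolding d
    by (rule comm_mult[symmetric]) (use cpa comm_int_pow[of B a] Ba in simp_all)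
  let ?u = "minv p (int t)"
  have "d [^] (- ?u) = c [^] (- (int p * int t * ?u)) \<otimes> B [^] (int t * ?u)"
    unfolding d using Bx by (simp add: int_pow_mult_distrib int_pow_pow)
  also have "B [^] (int t * ?u) = B"
    using int_pow_cong[OF _ Bp minv[OF p assms(6)]] by simp
  also have "c [^] (- (int p * int t * ?u)) = c [^] (- int p)"
  proof (rule int_pow_cong[OF c assms(3)])
    have "int p * int p dvd int p * (int t * ?u - 1)" using minv[OF p assms(6)] by (intro mult_dvd_mono) simp_all
    then show "(int p)\<^sup>2 dvd - (int p * int t * ?u) - - int p"
      by (simp add: power2_eq_square algebra_simps dvd_diff_commute)
  qed
  finally have "c [^] int p \<otimes> d [^] (- ?u) = B" by (simp add: int_pow_neg)
  then show ?thesis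
    unfolding label_params.simps
    by (intro has_paramsI[of d]) (use assms dp da db in \<open>simp_all add: d_def[symmetric] gcomm_one_iff B_def\<close>)
qed

text \<open>That A = \<open>a ^ (p ^ n)\<close> commutes with b and c is not a relation. Conjugation
  by c sends a to \<open>a A\<close>, hence A to \<open>A A ^ (p ^ n)\<close> = A. Conjugation by b
  sends a to \<open>a c\<close>, and \<open>(a c) ^ (p ^ n)\<close> collects to A, since p^2 divides
  \<open>p ^ n\<close> and p divides the binomial coefficient in the exponent of d.\<close>

lemma M4_M5_aux:
  assumes "a [^] (int p ^ (n + 1)) = \<one>" "c [^] ((int p)\<^sup>2) = \<one>" "gcomm G a c = a [^] (int p ^ n)"
  defines "d \<equiv> gcomm G c a"
  shows "d = a [^] (- (int p ^ n))" "gcomm G d a = \<one>" "gcomm G d b = \<one>" "d [^] int p = \<one>"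
proof -
  define A where "A = a [^] (int p ^ n)"
  have [simp]: "A \<in> carrier G" "d \<in> carrier G" by (simp_all add: A_def d_def)
  show d: "d = a [^] (- (int p ^ n))"
    using assms(3) gcomm_swap[of a c] by (simp add: d_def int_pow_neg)
  then have dA: "d = inv A" by (simp add: A_def int_pow_neg)
  have da: "d \<otimes> a = a \<otimes> d" unfolding d by (rule comm_int_pow) simp_all
  then show "gcomm G d a = \<one>" by (simp add: gcomm_one_iff)
  have Ap: "A [^] int p = \<one>" unfolding A_def by (rule pow_Suc_one) (use assms in simp_all)
  then show dp: "d [^] int p = \<one>" by (simp add: dA int_pow_inv)
  have "a \<otimes> c = c \<otimes> a \<otimes> A" using gcomm_eq_iff[of a c A] assms(3) by (simp add: A_def)
  then have "inv c \<otimes> a \<otimes> c = a \<otimes> A" by (simp add: m_assoc)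
  then have "inv c \<otimes> A \<otimes> c = (a \<otimes> A) [^] (int p ^ n)" unfolding A_def using int_pow_conj[of c a "int p ^ n"] by simp
  also have "\<dots> = A \<otimes> A [^] (int p ^ n)"
    using comm_int_pow[of a a "int p ^ n"] by (simp add: A_def int_pow_mult_distrib)
  also have "A [^] (int p ^ n) = \<one>" by (rule int_pow_mult_eq_one[OF _ Ap pow_dvd_helper(1)]) simp
  finally have Ac: "A \<otimes> c = c \<otimes> A" by (metis \<open>A \<in> carrier G\<close> c inv_cancel(1) inv_closed m_assoc m_closed r_one)
  have cA: "c \<otimes> d = d \<otimes> c" unfolding dA using comm_inv[of A c] Ac by simp
  have ca: "c \<otimes> a = a \<otimes> (c \<otimes> d)" using gcomm_eq_iff[of c a d] by (simp add: d_def m_assoc)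
  have cNa: "c [^] N \<otimes> a = a \<otimes> (c [^] N \<otimes> d [^] N)" for N :: nat
  proof -
    have "inv a \<otimes> c \<otimes> a = c \<otimes> d" using ca by (simp add: m_assoc)
    then have "inv a \<otimes> c [^] int N \<otimes> a = c [^] int N \<otimes> d [^] int N"
      using int_pow_conj[of a c "int N"] cA comm_int_pow2[of c d "int N" "int N"]
      by (simp add: int_pow_mult_distrib)
    then have "a \<otimes> (inv a \<otimes> c [^] int N \<otimes> a) = a \<otimes> (c [^] int N \<otimes> d [^] int N)" by simp
    then show ?thesis by (simp add: m_assoc int_pow_int)
  qed
  have acN: "(a \<otimes> c) [^] N = a [^] N \<otimes> (c [^] N \<otimes> d [^] (N choose 2))" for N :: nat
  proof (induction N)
    case (Suc N)
    have [simp]: "Suc N choose 2 = N + (N choose 2)" by (simp add: numeral_eq_Suc)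
    have "(a \<otimes> c) [^] Suc N = a [^] N \<otimes> (c [^] N \<otimes> (d [^] (N choose 2) \<otimes> a) \<otimes> c)"
      by (simp add: Suc m_assoc)
    also have "d [^] (N choose 2) \<otimes> a = a \<otimes> d [^] (N choose 2)" by (rule comm_nat_pow[OF _ _ da]) simp_all
    also have "c [^] N \<otimes> (a \<otimes> d [^] (N choose 2)) \<otimes> c = (c [^] N \<otimes> a) \<otimes> (d [^] (N choose 2) \<otimes> c)"
      by (simp add: m_assoc)
    also have "d [^] (N choose 2) \<otimes> c = c \<otimes> d [^] (N choose 2)" by (rule comm_nat_pow) (simp_all add: cA)
    also have "(c [^] N \<otimes> a) \<otimes> (c \<otimes> d [^] (N choose 2)) = a \<otimes> (c [^] N \<otimes> (d [^] N \<otimes> c) \<otimes> d [^] (N choose 2))"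
      unfolding cNa by (simp add: m_assoc)
    also have "d [^] N \<otimes> c = c \<otimes> d [^] N" by (rule comm_nat_pow) (simp_all add: cA)
    finally show ?case by (simp add: m_assoc nat_pow_mult[symmetric])
  qed (simp add: numeral_2_eq_2)
  have "a \<otimes> b = b \<otimes> (a \<otimes> c)" using gcomm_eq_iff[of a b c] by (simp add: cdef m_assoc)
  then have "inv b \<otimes> a \<otimes> b = a \<otimes> c" by (simp add: m_assoc)
  then have "inv b \<otimes> A \<otimes> b = (a \<otimes> c) [^] (p ^ n)"
    unfolding A_def using int_pow_conj[of b a "int p ^ n"] int_pow_int[of G "a \<otimes> c" "p ^ n"] by simp
  also have "\<dots> = A \<otimes> (c [^] (int p ^ n) \<otimes> d [^] int (p ^ n choose 2))"
    unfolding acN A_def using int_pow_int[of G a "p ^ n"] int_pow_int[of G c "p ^ n"] by (simp add: int_pow_int)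
  also have "c [^] (int p ^ n) = \<one>" by (rule int_pow_mult_eq_one[OF _ assms(2) pow_dvd_helper(4)]) simp
  also have "d [^] int (p ^ n choose 2) = \<one>" by (rule int_pow_mult_eq_one[OF _ dp choose_helper(1)]) simp
  finally have "A \<otimes> b = b \<otimes> A" by (metis \<open>A \<in> carrier G\<close> b inv_cancel(1) inv_closed m_assoc m_closed r_one one_closed)
  then have "d \<otimes> b = b \<otimes> d" unfolding dA by (rule comm_inv[rotated 2]) simp_all
  then show "gcomm G d b = \<one>" by (simp add: gcomm_one_iff)
qed

lemma has_params_M5:
  assumes "a [^] (int p ^ (n + 1)) = \<one>" "b [^] (int p ^ m) = \<one>" "c [^] ((int p)\<^sup>2) = \<one>" "gcomm G a c = a [^] (int p ^ n)"
  shows "has_params (label_params p M5) G a b"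
  unfolding label_params.simps
  by (rule has_paramsI[OF HOL.refl]) (use assms M4_M5_aux[OF assms(1,3,4)] in \<open>simp_all add: int_pow_neg\<close>)

lemma has_params_M4:
  assumes "a [^] (int p ^ (n + 1)) = \<one>" "b [^] (int p ^ (m + 1)) = \<one>" "c [^] int p = b [^] (int p ^ m)"
    "gcomm G a c = a [^] (int p ^ n)"
  shows "has_params (label_params p M4) G a b"
proof -
  have "(c [^] int p) [^] int p = \<one>" unfolding assms(3) by (rule pow_Suc_one) (use assms in simp_all)
  then have c2: "c [^] (int p)\<^sup>2 = \<one>" by (simp add: int_pow_pow power2_eq_square)
  show ?thesis
    unfolding label_params.simps
    by (rule has_paramsI[OF HOL.refl]) (use assms c2 M4_M5_aux[OF assms(1) c2 assms(4)] in \<open>simp_all add: int_pow_neg\<close>)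
qed

end


section \<open>Each presented group is a model\<close>

context pnm begin

lemma model_pow_a:
  "q (\<alpha>1, \<alpha>2, \<beta>1, \<beta>2) (1, 0, 0, 0) [^]\<^bsub>model (\<alpha>1, \<alpha>2, \<beta>1, \<beta>2)\<^esub> (k * int p ^ n) =
    q (\<alpha>1, \<alpha>2, \<beta>1, \<beta>2) (0, 0, int p * (\<alpha>1 * k), \<alpha>2 * k)"
  using q_pows[of \<alpha>1 \<alpha>2 \<beta>1 \<beta>2 k 0 0 0] by (simp add: q_pow cover_int_pow_a mult.commute[of k "int p ^ n"])

lemma model_pow_b:
  "q (\<alpha>1, \<alpha>2, \<beta>1, \<beta>2) (0, 1, 0, 0) [^]\<^bsub>model (\<alpha>1, \<alpha>2, \<beta>1, \<beta>2)\<^esub> (k * int p ^ m) =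
    q (\<alpha>1, \<alpha>2, \<beta>1, \<beta>2) (0, 0, int p * (\<beta>1 * k), \<beta>2 * k)"
  using q_pows[of \<alpha>1 \<alpha>2 \<beta>1 \<beta>2 0 k 0 0] by (simp add: q_pow cover_int_pow_b mult.commute[of k "int p ^ m"])

lemma model_pow_c: "q w (0, 0, u, v) [^]\<^bsub>model w\<^esub> (k :: int) = q w (0, 0, k * u, k * v)"
  by (simp add: q_pow cover_int_pow_cd)

lemmas model_pows = model_pow_a model_pow_b model_pow_a[where k = 1, simplified] model_pow_b[where k = 1, simplified]
  model_pow_a[where k = "-1", simplified] model_pow_b[where k = "-1", simplified]
  model_pow_b[where k = "- k" for k, simplified] model_pow_c

lemma M_group_iso:
  assumes "good_label p l"
  shows "model (label_params p l) \<cong> M_group p n m l"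
proof -
  note ball = ball_simps(5,7) prod.case weval.simps(1)
  have PI: "pnm_group p n m H (f Gen_a) (f Gen_b) (f Gen_c)"
    if "evaluation H f" "gcomm H (f Gen_a) (f Gen_b) = f Gen_c" "gcomm H (f Gen_c) (f Gen_b) = \<one>\<^bsub>H\<^esub>"
    for H :: "gen gword set monoid" and f
  proof -
    interpret evaluation H f by fact
    show ?thesis using that by unfold_locales simp_all
  qed
  \<comment> \<open>Some presentations state [b, c] = 1 instead of [c, b] = 1.\<close>
  have comm: "gcomm H (f Gen_c) (f Gen_b) = \<one>\<^bsub>H\<^esub>"
    if "evaluation H f" "gcomm H (f Gen_b) (f Gen_c) = \<one>\<^bsub>H\<^esub>" for H :: "gen gword set monoid" and f
  proof -
    interpret evaluation H f by fact
    show ?thesis using that gcomm_swap[of "f Gen_b" "f Gen_c"] by simp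
  qed
  note E = evaluation.weval_simps[OF evaluation_model_gen]
  note Ecalc = model_gen_def gen.case model_pows q_mult q_gcomm cover_gcomm q_one q_cd_eq
  show ?thesis
  \<comment> \<open>In each case goal 3 is \<open>fwd\<close>, settled in \<open>pnm_group\<close>,
    and goal 4 is \<open>bwd\<close>, a comparison of exponents in the model.\<close>
  proof (cases l)
    case (M1 \<nu> s)
    show ?thesis
      unfolding M1 M_group.simps
    proof (rule presented_iso_model, goal_cases)
      case (3 H f)
      show ?case using 3(2)[simplified ball evaluation.weval_simps[OF 3(1)]] pnm_group.has_params_M1[OF PI[OF 3(1) _ comm[OF 3(1)]]] assms by (simp add: M1 del: power_Suc)
    next
      case 4
      have "int p dvd \<nu> * minv p \<nu> - 1" using minv[OF p] assms by (simp add: M1)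
      \<comment> \<open>The relation for \<open>c ^ p\<close> requires the d-exponent s - s \<nu> (1
        / \<nu>) to vanish modulo p.\<close>
      moreover from dvd_mult[OF this, of "int s"] have "int p dvd \<nu> * (int s * minv p \<nu>) - int s"
        by (simp only: right_diff_distrib mult_ac mult_1)
      ultimately show ?case
        by (simp only: ball E label_params.simps) (simp add: Ecalc power2_eq_square, simp add: algebra_simps)
    qed simp_all
  next
    case M2
    show ?thesis
      unfolding M2 M_group.simps
    proof (rule presented_iso_model, goal_cases)
      case (3 H f)
      show ?case using 3(2)[simplified ball evaluation.weval_simps[OF 3(1)]] pnm_group.has_params_M2[OF PI[OF 3(1) _]] assms by (simp add: M2 del: power_Suc)
    next
      case 4
      show ?case by (simp only: ball E label_params.simps) (simp add: Ecalc power2_eq_square)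
    qed simp_all
  next
    case M3
    show ?thesis
      unfolding M3 M_group.simps
    proof (rule presented_iso_model, goal_cases)
      case (3 H f)
      show ?case using 3(2)[simplified ball evaluation.weval_simps[OF 3(1)]] pnm_group.has_params_M3[OF PI[OF 3(1) _], where d = "f Gen_d"] assms by (simp add: M3 del: power_Suc)
    next
      case 4
      show ?case by (simp only: ball E label_params.simps) (simp add: Ecalc power2_eq_square)
    qed simp_all
  next
    case M4
    show ?thesis
      unfolding M4 M_group.simps
    proof (rule presented_iso_model, goal_cases)
      case (3 H f)
      show ?case using 3(2)[simplified ball evaluation.weval_simps[OF 3(1)]] pnm_group.has_params_M4[OF PI[OF 3(1) _ comm[OF 3(1)]]] assms by (simp add: M4 del: power_Suc)
    next
      case 4
      show ?case by (simp only: ball E label_params.simps) (simp add: Ecalc power2_eq_square)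
    qed simp_all
  next
    case M5
    show ?thesis
      unfolding M5 M_group.simps
    proof (rule presented_iso_model, goal_cases)
      case (3 H f)
      show ?case using 3(2)[simplified ball evaluation.weval_simps[OF 3(1)]] pnm_group.has_params_M5[OF PI[OF 3(1) _ comm[OF 3(1)]]] assms by (simp add: M5 del: power_Suc)
    next
      case 4
      show ?case by (simp only: ball E label_params.simps) (simp add: Ecalc power2_eq_square)
    qed simp_all
  next
    case (M6 t)
    show ?thesis
      unfolding M6 M_group.simps
    proof (rule presented_iso_model, goal_cases)
      case (3 H f)
      show ?case using 3(2)[simplified ball evaluation.weval_simps[OF 3(1)]] pnm_group.has_params_M6[OF PI[OF 3(1) _]] assms by (simp add: M6 del: power_Suc)
    next
      case 4
      have "int p dvd int t * minv p (int t) - 1" using minv[OF p] assms by (simp add: M6)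
      then show ?case
        by (simp only: ball E label_params.simps) (simp add: Ecalc power2_eq_square, simp add: algebra_simps dvd_diff_commute)
    qed simp_all
  next
    case M7
    show ?thesis
      unfolding M7 M_group.simps
    proof (rule presented_iso_model, goal_cases)
      case (3 H f)
      show ?case using 3(2)[simplified ball evaluation.weval_simps[OF 3(1)]] pnm_group.has_params_M7[OF PI[OF 3(1) _], where d = "f Gen_d"] assms by (simp add: M7 del: power_Suc)
    next
      case 4
      show ?case by (simp only: ball E label_params.simps) (simp add: Ecalc power2_eq_square)
    qed simp_all
  next
    case (M8 \<nu>)
    show ?thesis
      unfolding M8 M_group.simps
    proof (rule presented_iso_model, goal_cases)
      case (3 H f)
      show ?case using 3(2)[simplified ball evaluation.weval_simps[OF 3(1)]] pnm_group.has_params_M8[OF PI[OF 3(1) _]] assms by (simp add: M8 del: power_Suc)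
    next
      case 4
      have "int p dvd \<nu> * minv p \<nu> - 1" using minv[OF p] assms by (simp add: M8)
      then show ?case
        by (simp only: ball E label_params.simps) (simp add: Ecalc power2_eq_square, simp add: algebra_simps)
    qed simp_all
  next
    case M9
    show ?thesis
      unfolding M9 M_group.simps
    proof (rule presented_iso_model, goal_cases)
      case (3 H f)
      show ?case using 3(2)[simplified ball evaluation.weval_simps[OF 3(1)]] pnm_group.has_params_M9[OF PI[OF 3(1) _], where d = "f Gen_d"] assms by (simp add: M9 del: power_Suc)
    next
      case 4
      show ?case by (simp only: ball E label_params.simps) (simp add: Ecalc power2_eq_square)
    qed simp_all
  qed
qed

end

section \<open>Normal forms of the exponents\<close>

text \<open>0 is a square modulo p, so a non-residue is invertible; for p = 2 the only value is
  1.\<close>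

lemma nu_range_not_dvd:
  assumes "prime p" "p \<noteq> 2 \<Longrightarrow> \<not> QuadRes (int p) \<nu>\<^sub>0" "\<nu> \<in> nu_range p \<nu>\<^sub>0"
  shows "\<not> int p dvd \<nu>"
proof
  assume d: "int p dvd \<nu>"
  have "\<not> int p dvd 1" using assms(1) by auto
  then have "p \<noteq> 2" "\<nu> = \<nu>\<^sub>0" using assms(3) d by (auto simp: nu_range_def split: if_splits)
  moreover have "QuadRes (int p) \<nu>"
    unfolding QuadRes_def using d by (intro exI[of _ 0]) (simp add: cong_iff_dvd_diff)
  ultimately show False using assms(2) by simp
qed

lemma good_label:
  assumes "prime p" "p \<noteq> 2 \<Longrightarrow> \<not> QuadRes (int p) \<nu>\<^sub>0" "l \<in> M_labels p \<nu>\<^sub>0"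
  shows "good_label p l"
proof (cases l)
  case (M6 t)
  then have "0 < t" "t < p" using assms(3) by (auto simp: M_labels_def)
  then show ?thesis by (simp add: M6 nat_dvd_not_less)
qed (use assms nu_range_not_dvd[OF assms(1,2)] in \<open>auto simp: M_labels_def\<close>)

text \<open>By Euler's criterion the product of two non-residues is a residue, so x or
  \<open>\<nu>\<^sub>0 * x\<close> is a square. For p = 2 every odd number is congruent to
  1.\<close>

lemma square_times_nu:
  assumes p: "prime p" and nr: "p \<noteq> 2 \<Longrightarrow> \<not> QuadRes (int p) \<nu>\<^sub>0" and x: "\<not> int p dvd x"
  shows "\<exists>\<nu> \<in> nu_range p \<nu>\<^sub>0. \<exists>i. \<not> int p dvd i \<and> int p dvd i * i - \<nu> * x"
proof (cases "p = 2")
  case True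
  then have "odd x" using x by simp
  then show ?thesis unfolding nu_range_def using True by (intro bexI[of _ 1] exI[of _ 1]) auto
next
  case False
  then have p2: "2 < p" using prime_ge_2_nat[OF p] by simp
  have *: "\<exists>i. \<not> int p dvd i \<and> int p dvd i * i - y" if "QuadRes (int p) y" "\<not> int p dvd y" for y
  proof -
    obtain i where "[i\<^sup>2 = y] (mod int p)" using \<open>QuadRes (int p) y\<close> unfolding QuadRes_def by blast
    then have i: "int p dvd i * i - y" by (simp add: cong_iff_dvd_diff power2_eq_square)
    moreover have "\<not> int p dvd i" using i that(2) by (metis dvd_diff_commute dvd_mult dvd_trans_diff)
    ultimately show ?thesis by blast
  qed
  show ?thesis
  proof (cases "QuadRes (int p) x")
    case True
    then show ?thesis using *[OF True x] False by (auto simp: nu_range_def)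
  next
    case nx: False
    let ?e = "(p - 1) div 2"
    have pnu: "\<not> int p dvd \<nu>\<^sub>0" by (rule nu_range_not_dvd[OF p nr]) (use False in \<open>auto simp: nu_range_def\<close>)
    have L: "[Legendre y (int p) = y ^ ?e] (mod int p)" for y using euler_criterion[OF p p2] by simp
    have Lm: "Legendre y (int p) = - 1" if "\<not> QuadRes (int p) y" "\<not> int p dvd y" for y
      using that by (simp add: Legendre_def cong_0_iff)
    have "[x ^ ?e = - 1] (mod int p)" "[\<nu>\<^sub>0 ^ ?e = - 1] (mod int p)"
      using L[of x] L[of "\<nu>\<^sub>0"] Lm[OF nx x] Lm[OF nr[OF False] pnu] by (simp_all add: cong_sym_eq)
    from cong_mult[OF this] have "[(\<nu>\<^sub>0 * x) ^ ?e = 1] (mod int p)" by (simp add: power_mult_distrib mult.commute)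
    then have L1: "[Legendre (\<nu>\<^sub>0 * x) (int p) = 1] (mod int p)" using L cong_trans by blast
    have nd: "\<not> int p dvd \<nu>\<^sub>0 * x" using pnu x p by (simp add: prime_dvd_mult_iff)
    have "QuadRes (int p) (\<nu>\<^sub>0 * x)"
    proof (rule ccontr)
      assume "\<not> QuadRes (int p) (\<nu>\<^sub>0 * x)"
      from L1[unfolded Lm[OF this nd]] have "int p dvd - 2" by (simp add: cong_iff_dvd_diff)
      then have "int p \<le> 2" by (intro zdvd_imp_le) simp_all
      then show False using p2 by simp
    qed
    from *[OF this nd] show ?thesis using False by (auto simp: nu_range_def)
  qed
qed

text \<open>Here \<open>a' = a ^ i b ^ j \<dots>\<close> and \<open>b' = a ^ (l p ^ (n - m)) b ^ k \<dots>\<close>, so that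
  \<open>c'\<close> is \<open>c ^ (i k)\<close> and \<open>d'\<close> is \<open>d ^ (i\<^sup>2 k)\<close> up to factors that do not matter.\<close>

definition params_equiv :: "nat \<Rightarrow> quad \<Rightarrow> quad \<Rightarrow> int \<Rightarrow> int \<Rightarrow> int \<Rightarrow> bool" where
  "params_equiv p = (\<lambda>(\<alpha>1, \<alpha>2, \<beta>1, \<beta>2) (\<alpha>1', \<alpha>2', \<beta>1', \<beta>2') i k l.
    \<not> int p dvd i \<and> \<not> int p dvd k \<and>
    int p dvd \<alpha>1 * i - i * k * \<alpha>1' \<and> int p dvd \<alpha>2 * i - i * i * k * \<alpha>2' \<and>
    int p dvd \<alpha>1 * l + \<beta>1 * k - i * k * \<beta>1' \<and> int p dvd \<alpha>2 * l + \<beta>2 * k - i * i * k * \<beta>2')"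

lemma dvd_lin2: "(d :: int) dvd x \<Longrightarrow> d dvd y \<Longrightarrow> z = r * x + s * y \<Longrightarrow> d dvd z"
  by simp

lemma dvd_lin3: "(d :: int) dvd x \<Longrightarrow> d dvd y \<Longrightarrow> d dvd t \<Longrightarrow> z = r * x + s * y + q * t \<Longrightarrow> d dvd z"
  by simp

text \<open>If \<alpha>1 is invertible, k = \<alpha>1 and l = -\<beta>1 bring (\<alpha>1, \<beta>1)
  to (1, 0), and the new \<beta>2 is the determinant up to a unit. If only \<alpha>2 is invertible,
  l clears \<beta>2. If both vanish, k and l have no effect and (\<beta>1, \<beta>2) becomes
  (\<beta>1 / i, \<beta>2 / i^2); the invariant \<beta>1^2 / \<beta>2 is what the parameter t
  records.\<close>

lemma normal_form_exists:
  assumes p: "prime p" and nr: "p \<noteq> 2 \<Longrightarrow> \<not> QuadRes (int p) \<nu>\<^sub>0"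
  shows "\<exists>l' \<in> M_labels p \<nu>\<^sub>0. \<exists>i k l. params_equiv p w (label_params p l') i k l"
proof -
  obtain \<alpha>1 \<alpha>2 \<beta>1 \<beta>2 where w: "w = (\<alpha>1, \<alpha>2, \<beta>1, \<beta>2)" by (cases w)
  let ?p = "int p"
  have pi: "prime ?p" using p by simp
  have np: "\<not> ?p dvd 1" using p by auto
  have mu: "\<not> ?p dvd x * y \<longleftrightarrow> \<not> ?p dvd x \<and> \<not> ?p dvd y" for x y
    using pi by (simp add: prime_dvd_mult_iff)
  note inv = minv_not_dvd[OF p]
  note minv = minv[OF p]
  have nu: "\<not> ?p dvd \<nu>" if "\<nu> \<in> nu_range p \<nu>\<^sub>0" for \<nu>
    using nu_range_not_dvd[OF p] nr that by blast
  consider (A) "\<not> ?p dvd \<alpha>1" | (B) "?p dvd \<alpha>1" "\<not> ?p dvd \<alpha>2" | (C) "?p dvd \<alpha>1" "?p dvd \<alpha>2" by blast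
  then show ?thesis
  proof cases
    case A
    define D where "D = \<alpha>1 * \<beta>2 - \<beta>1 * \<alpha>2"
    show ?thesis
    proof (cases "?p dvd D")
      case True
      show ?thesis
      proof (cases "?p dvd \<alpha>2")
        case a2: True
        have "params_equiv p w (label_params p M3) 1 \<alpha>1 (- \<beta>1)"
          using A True a2 np by (simp add: params_equiv_def w D_def algebra_simps)
        then show ?thesis by (intro bexI[of _ M3] exI) (auto simp: M_labels_def)
      next
        case a2: False
        \<comment> \<open>This i solves \<alpha>2 i = -i^2 \<alpha>1, the condition for the entry
          -1.\<close>
        define i where "i = - \<alpha>2 * minv p \<alpha>1"
        have "\<not> ?p dvd i" using mu A a2 inv by (simp add: i_def)
        moreover have "?p dvd \<alpha>2 * i - i * i * \<alpha>1 * (- 1)"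
          by (rule dvd_mult2[OF minv[OF A], of "- \<alpha>2 * i", THEN back_subst[of "(dvd) ?p"]]) (simp add: i_def algebra_simps)
        moreover have "?p dvd \<alpha>2 * (- \<beta>1) + \<beta>2 * \<alpha>1" using True by (simp add: D_def algebra_simps)
        ultimately have "params_equiv p w (label_params p M2) i \<alpha>1 (- \<beta>1)"
          using A by (simp add: params_equiv_def w)
        then show ?thesis by (intro bexI[of _ M2] exI) (auto simp: M_labels_def)
      qed
    next
      case False
      \<comment> \<open>The new \<beta>2 is D / (i^2 \<alpha>1) and should be -1 / \<nu>; hence i^2
        has to be -\<nu> D / \<alpha>1.\<close>
      have "\<not> ?p dvd - (D * minv p \<alpha>1)" using mu False inv[OF A] by simp
      then obtain \<nu> i0 where \<nu>: "\<nu> \<in> nu_range p \<nu>\<^sub>0" and i0: "\<not> ?p dvd i0" "?p dvd i0 * i0 - \<nu> * - (D * minv p \<alpha>1)"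
        using square_times_nu[OF p nr] by blast
      note nv = nu[OF \<nu>]
      define r where "r = (\<alpha>2 * minv p (i0 * \<alpha>1)) mod ?p"
      have r: "0 \<le> r" "r < ?p" using p by (auto simp: r_def prime_gt_0_nat)
      have ra: "?p dvd \<alpha>2 - i0 * \<alpha>1 * r"
      proof (rule dvd_lin2)
        show "?p dvd i0 * \<alpha>1 * minv p (i0 * \<alpha>1) - 1" by (rule minv) (use mu i0 A in simp)
        show "?p dvd \<alpha>2 * minv p (i0 * \<alpha>1) - r" by (simp add: r_def mod_eq_dvd_iff[symmetric])
        show "\<alpha>2 - i0 * \<alpha>1 * r = (- \<alpha>2) * (i0 * \<alpha>1 * minv p (i0 * \<alpha>1) - 1) + (i0 * \<alpha>1) * (\<alpha>2 * minv p (i0 * \<alpha>1) - r)"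
          by (simp add: algebra_simps)
      qed
      \<comment> \<open>The sign of i0 is free, and changing it replaces r by p - r; one of the two
        is at most \<open>p div 2\<close>.\<close>
      have "\<exists>i s. \<not> ?p dvd i \<and> i * i = i0 * i0 \<and> s \<le> p div 2 \<and> ?p dvd \<alpha>2 - i * \<alpha>1 * int s"
      proof (cases "r \<le> ?p div 2")
        case True
        then have "nat r \<le> p div 2" by (metis nat_int nat_mono zdiv_int of_nat_numeral)
        then show ?thesis using i0 ra r by (intro exI[of _ i0] exI[of _ "nat r"]) simp
      next
        case False
        then have "nat (?p - r) \<le> p div 2" using r by (simp add: zdiv_int[symmetric])
        moreover have "?p dvd \<alpha>2 - (- i0) * \<alpha>1 * (?p - r)"
          by (rule dvd_lin2[OF ra dvd_refl, of _ 1 "i0 * \<alpha>1"]) (simp add: algebra_simps)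
        ultimately show ?thesis using i0 r by (intro exI[of _ "- i0"] exI[of _ "nat (?p - r)"]) simp
      qed
      then obtain i s where i: "\<not> ?p dvd i" "i * i = i0 * i0" and s: "s \<le> p div 2" "?p dvd \<alpha>2 - i * \<alpha>1 * int s"
        by blast
      have 2: "?p dvd \<alpha>2 * i - i * i * \<alpha>1 * int s"
        using dvd_mult[OF s(2), of i] by (simp add: algebra_simps)
      have 4: "?p dvd \<alpha>2 * (- \<beta>1) + \<beta>2 * \<alpha>1 - i * i * \<alpha>1 * (- minv p \<nu>)"
        by (rule dvd_lin3[OF minv[OF nv] minv[OF A] i0(2)[folded i(2)], of _ "- (D * minv p \<alpha>1 * \<alpha>1)" "- D" "\<alpha>1 * minv p \<nu>"])
          (simp add: algebra_simps D_def)
      have "params_equiv p w (label_params p (M1 \<nu> s)) i \<alpha>1 (- \<beta>1)"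
        using A i 2 4 by (simp add: params_equiv_def w)
      then show ?thesis by (intro bexI[of _ "M1 \<nu> s"] exI) (use \<nu> s in \<open>auto simp: M_labels_def\<close>)
    qed
  next
    case B
    show ?thesis
    proof (cases "?p dvd \<beta>1")
      case True
      have "?p dvd \<alpha>2 * (\<beta>2 * \<alpha>2 * minv p \<alpha>2) - \<beta>2 * \<alpha>2"
        using dvd_mult[OF minv[OF B(2)], of "\<beta>2 * \<alpha>2"] by (simp add: algebra_simps)
      then have "params_equiv p w (label_params p M5) 1 (- \<alpha>2) (\<beta>2 * \<alpha>2 * minv p \<alpha>2)"
        using B True np by (simp add: params_equiv_def w)
      then show ?thesis by (intro bexI[of _ M5] exI) (auto simp: M_labels_def)
    next
      case False
      \<comment> \<open>The choice i = \<beta>1 makes the new \<beta>1 equal to 1; this k then turns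
        \<alpha>2 into -1.\<close>
      define k where "k = - \<alpha>2 * minv p \<beta>1"
      have "\<not> ?p dvd k" using mu B False inv by (simp add: k_def)
      moreover have "?p dvd \<alpha>2 * \<beta>1 - \<beta>1 * \<beta>1 * k * (- 1)"
        using dvd_mult[OF minv[OF False], of "- \<alpha>2 * \<beta>1"] by (simp add: k_def algebra_simps)
      moreover have "?p dvd \<alpha>2 * (- \<beta>2 * k * minv p \<alpha>2) + \<beta>2 * k"
        using dvd_mult[OF minv[OF B(2)], of "- \<beta>2 * k"] by (simp add: algebra_simps)
      ultimately have "params_equiv p w (label_params p M4) \<beta>1 k (- \<beta>2 * k * minv p \<alpha>2)"
        using B False by (simp add: params_equiv_def w)
      then show ?thesis by (intro bexI[of _ M4] exI) (auto simp: M_labels_def)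
    qed
  next
    case C
    show ?thesis
    proof (cases "?p dvd \<beta>1")
      case b1: True
      show ?thesis
      proof (cases "?p dvd \<beta>2")
        case True
        have "params_equiv p w (label_params p M9) 1 1 0" using C b1 True np by (simp add: params_equiv_def w)
        then show ?thesis by (intro bexI[of _ M9] exI) (auto simp: M_labels_def)
      next
        case False
        then have "\<not> ?p dvd - \<beta>2" by simp
        then obtain \<nu> i where \<nu>: "\<nu> \<in> nu_range p \<nu>\<^sub>0" and i: "\<not> ?p dvd i" "?p dvd i * i - \<nu> * - \<beta>2"
          using square_times_nu[OF p nr] by blast
        have "?p dvd \<beta>2 + i * i * minv p \<nu>"
          by (rule dvd_lin2[OF minv[OF nu[OF \<nu>]] i(2), of _ "- \<beta>2" "minv p \<nu>"]) (simp add: algebra_simps)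
        then have "params_equiv p w (label_params p (M8 \<nu>)) i 1 0" using C b1 i np by (simp add: params_equiv_def w)
        then show ?thesis by (intro bexI[of _ "M8 \<nu>"] exI) (use \<nu> in \<open>auto simp: M_labels_def\<close>)
      qed
    next
      case b1: False
      show ?thesis
      proof (cases "?p dvd \<beta>2")
        case True
        have "params_equiv p w (label_params p M7) \<beta>1 1 0" using C b1 True np by (simp add: params_equiv_def w)
        then show ?thesis by (intro bexI[of _ M7] exI) (auto simp: M_labels_def)
      next
        case False
        \<comment> \<open>With i = \<beta>1 the last two entries become 1 and \<beta>2 / \<beta>1^2,
          and the latter should be -1 / t.\<close>
        define T where "T = - (\<beta>1 * \<beta>1 * minv p \<beta>2)"
        define t where "t = nat (T mod ?p)"
        have t: "int t = T mod ?p" using p by (simp add: t_def prime_gt_0_nat)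
        have tT: "?p dvd int t - T" by (simp add: t mod_eq_dvd_iff[symmetric])
        have nT: "\<not> ?p dvd T" using mu b1 False inv by (simp add: T_def)
        have nt: "\<not> ?p dvd int t" using nT tT by (metis dvd_diff_commute dvd_trans_diff)
        have "t \<noteq> 0" using nt by (metis dvd_0_right of_nat_0)
        moreover have "int t < ?p" using p by (simp add: t prime_gt_0_nat)
        ultimately have tl: "1 \<le> t" "t < p" by simp_all
        have bb: "?p dvd \<beta>2 * int t + \<beta>1 * \<beta>1"
          by (rule dvd_lin2[OF minv[OF False] tT, of _ "- (\<beta>1 * \<beta>1)" \<beta>2]) (simp add: T_def algebra_simps)
        have "?p dvd \<beta>2 + \<beta>1 * \<beta>1 * minv p (int t)"
          by (rule dvd_lin2[OF minv[OF nt] bb, of _ "- \<beta>2" "minv p (int t)"]) (simp add: algebra_simps)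
        then have "params_equiv p w (label_params p (M6 t)) \<beta>1 1 0" using C b1 np by (simp add: params_equiv_def w)
        then show ?thesis by (intro bexI[of _ "M6 t"] exI) (use tl in \<open>auto simp: M_labels_def\<close>)
      qed
    qed
  qed
qed

text \<open>Which of \<open>\<alpha>1\<close>, \<open>\<alpha>2\<close>, \<open>\<beta>1\<close>, \<open>\<beta>2\<close> and the determinant vanish modulo \<open>p\<close>, as far as this is invariant under
  \<open>params_equiv\<close>; it tells the constructors of \<open>M_label\<close> apart.\<close>

definition shape :: "nat \<Rightarrow> quad \<Rightarrow> bool \<times> bool \<times> bool \<times> bool" where
  "shape p = (\<lambda>(\<alpha>1, \<alpha>2, \<beta>1, \<beta>2). (int p dvd \<alpha>1, int p dvd \<alpha>2,
     if int p dvd \<alpha>1 then int p dvd \<beta>1 else int p dvd \<alpha>1 * \<beta>2 - \<beta>1 * \<alpha>2,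
     if int p dvd \<alpha>1 \<and> int p dvd \<alpha>2 then int p dvd \<beta>2 else True))"

text \<open>Since i and k are units modulo p, the vanishing of an entry is preserved wherever the
  term with l vanishes, and the determinant is multiplied by a unit.\<close>

lemma params_equiv_shape:
  assumes p: "prime p" and t: "params_equiv p w w' i k l"
  shows "shape p w = shape p w'"
proof -
  obtain \<alpha>1 \<alpha>2 \<beta>1 \<beta>2 where w: "w = (\<alpha>1, \<alpha>2, \<beta>1, \<beta>2)" by (cases w)
  obtain \<gamma>1 \<gamma>2 \<delta>1 \<delta>2 where w': "w' = (\<gamma>1, \<gamma>2, \<delta>1, \<delta>2)" by (cases w')
  let ?p = "int p"
  have mu: "?p dvd x * y \<longleftrightarrow> ?p dvd x \<or> ?p dvd y" for x y
    using p by (simp add: prime_dvd_mult_iff)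
  have ik: "\<not> ?p dvd i" "\<not> ?p dvd k"
    and 1: "?p dvd \<alpha>1 * i - i * k * \<gamma>1" and 2: "?p dvd \<alpha>2 * i - i * i * k * \<gamma>2"
    and 3: "?p dvd \<alpha>1 * l + \<beta>1 * k - i * k * \<delta>1" and 4: "?p dvd \<alpha>2 * l + \<beta>2 * k - i * i * k * \<delta>2"
    using t by (simp_all add: params_equiv_def w w')
  have a1: "?p dvd \<alpha>1 \<longleftrightarrow> ?p dvd \<gamma>1" using dvd_diff_iff[OF 1] ik by (simp add: mu)
  have a2: "?p dvd \<alpha>2 \<longleftrightarrow> ?p dvd \<gamma>2" using dvd_diff_iff[OF 2] ik by (simp add: mu)
  have b1: "?p dvd \<beta>1 \<longleftrightarrow> ?p dvd \<delta>1" if "?p dvd \<alpha>1"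
    using dvd_diff_iff[OF 3] ik that by (simp add: mu dvd_add_right_iff)
  have b2: "?p dvd \<beta>2 \<longleftrightarrow> ?p dvd \<delta>2" if "?p dvd \<alpha>2"
    using dvd_diff_iff[OF 4] ik that by (simp add: mu dvd_add_right_iff)
  have "?p dvd i * k * (\<alpha>1 * \<beta>2 - \<beta>1 * \<alpha>2) - i * i * i * k * k * (\<gamma>1 * \<delta>2 - \<delta>1 * \<gamma>2)"
  proof -
    have "i * k * (\<alpha>1 * \<beta>2 - \<beta>1 * \<alpha>2) - i * i * i * k * k * (\<gamma>1 * \<delta>2 - \<delta>1 * \<gamma>2) =
      (\<alpha>2 * l + \<beta>2 * k) * (\<alpha>1 * i - i * k * \<gamma>1) + i * k * \<gamma>1 * (\<alpha>2 * l + \<beta>2 * k - i * i * k * \<delta>2)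
      - ((\<alpha>1 * l + \<beta>1 * k) * (\<alpha>2 * i - i * i * k * \<gamma>2) + i * i * k * \<gamma>2 * (\<alpha>1 * l + \<beta>1 * k - i * k * \<delta>1))"
      by (simp add: algebra_simps)
    then show ?thesis using 1 2 3 4 by simp
  qed
  from dvd_diff_iff[OF this] have "?p dvd \<alpha>1 * \<beta>2 - \<beta>1 * \<alpha>2 \<longleftrightarrow> ?p dvd \<gamma>1 * \<delta>2 - \<delta>1 * \<gamma>2"
    using ik by (simp add: mu)
  then show ?thesis using a1 a2 b1 b2 by (simp add: shape_def w w')
qed

text \<open>\<open>shape\<close> separates the constructors, so only parameters of equal
  constructors are compared. The square class determines \<nu>; for M6 the entry 1 forces i = 1
  modulo p and so fixes t; for M1 equal \<nu> forces i^2 = 1 modulo p, which fixes s up to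
  sign.\<close>

lemma normal_form_unique:
  assumes p: "prime p" and nr: "p \<noteq> 2 \<Longrightarrow> \<not> QuadRes (int p) \<nu>\<^sub>0"
    and l: "l1 \<in> M_labels p \<nu>\<^sub>0" "l2 \<in> M_labels p \<nu>\<^sub>0"
    and t: "params_equiv p (label_params p l1) (label_params p l2) i k l"
  shows "l1 = l2"
proof -
  let ?p = "int p"
  have pi: "prime ?p" using p by simp
  have np: "\<not> ?p dvd 1" using p by auto
  have mu: "?p dvd x * y \<longleftrightarrow> ?p dvd x \<or> ?p dvd y" for x y
    using pi by (simp add: prime_dvd_mult_iff)
  note inv = minv_not_dvd[OF p]
  have nu: "\<not> ?p dvd \<nu>" if "\<nu> \<in> nu_range p \<nu>\<^sub>0" for \<nu>
    using nu_range_not_dvd[OF p] nr that by blast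
  have ik: "\<not> ?p dvd i" "\<not> ?p dvd k" using t by (auto simp: params_equiv_def split: prod.splits)
  have small: "s = s'" if "?p dvd int s - int s'" "s < p" "s' < p" for s s'
    using that by (metis cong_iff_dvd_diff cong_int_iff cong_less_modulus_unique_nat)
  \<comment> \<open>The hypothesis says that \<nu>' is j^2 \<nu> modulo p, which is impossible for
    distinct elements of the range, one of which is 1 and the other a non-residue.\<close>
  have nueq: "\<nu> = \<nu>'" if "\<nu> \<in> nu_range p \<nu>\<^sub>0" "\<nu>' \<in> nu_range p \<nu>\<^sub>0" "\<not> ?p dvd j" "?p dvd minv p \<nu> - j * j * minv p \<nu>'" for \<nu> \<nu>' j
  proof -
    have nn: "?p dvd \<nu>' - j * j * \<nu>"
      by (rule dvd_lin3[OF that(4) minv[OF p nu[OF that(1)]] minv[OF p nu[OF that(2)]], of _ "\<nu> * \<nu>'" "- \<nu>'" "j * j * \<nu>"])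
        (simp add: algebra_simps)
    have "QuadRes ?p \<nu>'" if "\<nu> = 1"
      unfolding QuadRes_def using nn that by (intro exI[of _ j]) (simp add: cong_iff_dvd_diff power2_eq_square dvd_diff_commute)
    moreover have "QuadRes ?p \<nu>" if "\<nu>' = 1"
    proof -
      have "?p dvd (minv p j)\<^sup>2 - \<nu>"
        by (rule dvd_lin2[OF nn minv[OF p \<open>\<not> ?p dvd j\<close>], of _ "(minv p j)\<^sup>2" "\<nu> * (j * minv p j + 1)"])
          (simp add: that algebra_simps power2_eq_square)
      then show ?thesis unfolding QuadRes_def by (intro exI[of _ "minv p j"]) (simp add: cong_iff_dvd_diff)
    qed
    ultimately show ?thesis using that(1,2) nr by (auto simp: nu_range_def split: if_splits)
  qed
  have shapes: "shape p (label_params p l1) = shape p (label_params p l2)" by (rule params_equiv_shape[OF p t])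
  have sh: "shape p (label_params p (M1 \<nu> s)) = (False, ?p dvd int s, False, True)" if "\<not> ?p dvd \<nu>" for \<nu> s
    using np inv[OF that] by (simp add: shape_def)
  have sh6: "shape p (label_params p (M6 t)) = (True, True, False, False)" if "\<not> ?p dvd int t" for t
    using np inv[OF that] by (simp add: shape_def)
  have sh8: "shape p (label_params p (M8 \<nu>)) = (True, True, True, False)" if "\<not> ?p dvd \<nu>" for \<nu>
    using np inv[OF that] by (simp add: shape_def)
  have shr: "shape p (label_params p M2) = (False, False, True, True)" "shape p (label_params p M3) = (False, True, True, True)"
    "shape p (label_params p M4) = (True, False, False, True)" "shape p (label_params p M5) = (True, False, True, True)"
    "shape p (label_params p M7) = (True, True, False, True)" "shape p (label_params p M9) = (True, True, True, True)"
    using np by (simp_all add: shape_def)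
  have good: "good_label p l1" "good_label p l2" using good_label[OF p nr] l by auto
  consider (same) "l1 = l2" | (M1) \<nu> s \<nu>' s' where "l1 = M1 \<nu> s" "l2 = M1 \<nu>' s'"
    | (M6) t t' where "l1 = M6 t" "l2 = M6 t'" | (M8) \<nu> \<nu>' where "l1 = M8 \<nu>" "l2 = M8 \<nu>'"
    using shapes good by (cases l1; cases l2) (simp_all add: sh sh6 sh8 shr del: label_params.simps)
  then show ?thesis
  proof cases
    case M6
    have "?p dvd k * (1 - i)" "?p dvd minv p (int t') * k * (i * i) - minv p (int t) * k"
      using t by (simp_all add: M6 params_equiv_def algebra_simps)
    then have i1: "?p dvd 1 - i" using ik by (simp add: mu)
    have "?p dvd k * (minv p (int t') - minv p (int t))"
      by (rule dvd_lin2[OF \<open>?p dvd minv p (int t') * k * (i * i) - minv p (int t) * k\<close> i1, of _ 1 "minv p (int t') * k * (1 + i)"])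
        (simp add: algebra_simps)
    then have m: "?p dvd minv p (int t') - minv p (int t)" using ik by (simp add: mu)
    have "?p dvd int t - int t'"
      by (rule dvd_lin3[OF m minv[OF p] minv[OF p], of "int t'" "int t" _ "int t * int t'" "- int t" "int t'"])
        (use good M6 in \<open>simp_all add: algebra_simps\<close>)
    then show ?thesis using small l by (auto simp: M6 M_labels_def)
  next
    case M8
    have "?p dvd k * (minv p \<nu> - i * i * minv p \<nu>')"
      using t by (simp add: M8 params_equiv_def algebra_simps dvd_diff_commute)
    then have "?p dvd minv p \<nu> - i * i * minv p \<nu>'" using ik by (simp add: mu)
    then show ?thesis using nueq[OF _ _ ik(1)] l by (auto simp: M8 M_labels_def)
  next
    case M1
    have \<nu>: "\<nu> \<in> nu_range p \<nu>\<^sub>0" "\<nu>' \<in> nu_range p \<nu>\<^sub>0" and ss: "s \<le> p div 2" "s' \<le> p div 2"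
      using l by (auto simp: M1 M_labels_def)
    have "?p dvd i * (1 - k)" "?p dvd i * (int s - i * k * int s')" "?p dvd l"
      and 4: "?p dvd int s * l - minv p \<nu> * k + i * i * k * minv p \<nu>'"
      using t by (simp_all add: M1 params_equiv_def algebra_simps)
    then have k1: "?p dvd 1 - k" and s1: "?p dvd int s - i * k * int s'" using ik by (simp_all add: mu)
    have "?p dvd k * (minv p \<nu> - i * i * minv p \<nu>')"
      by (rule dvd_lin2[OF 4 \<open>?p dvd l\<close>, of _ "-1" "int s"]) (simp add: algebra_simps)
    then have m: "?p dvd minv p \<nu> - i * i * minv p \<nu>'" using ik by (simp add: mu)
    then have \<nu>\<nu>: "\<nu> = \<nu>'" using nueq[OF \<nu> ik(1)] by simp
    have "?p dvd (1 - i) * (1 + i)"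
      by (rule dvd_lin2[OF m minv[OF p nu[OF \<nu>(1)]], of _ \<nu> "i * i - 1"]) (simp add: \<nu>\<nu> algebra_simps)
    then consider "?p dvd 1 - i" | "?p dvd 1 + i" by (auto simp: mu)
    then have "s = s'"
    proof cases
      case 1
      have "?p dvd int s - int s'"
        by (rule dvd_lin3[OF s1 k1 1, of _ 1 "- (i * int s')" "- int s'"]) (simp add: algebra_simps)
      moreover have "p div 2 < p" using p by (simp add: prime_gt_0_nat)
      ultimately show ?thesis using small ss by auto
    next
      case 2
      have d: "?p dvd int s + int s'"
        by (rule dvd_lin3[OF s1 k1 2, of _ 1 "- (i * int s')" "int s'"]) (simp add: algebra_simps)
      \<comment> \<open>For odd p the sum s + s' stays below p, so both are 0; for p = 2 both are 0
        or 1 and their sum is even.\<close>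
      show ?thesis
      proof (cases "p = 2")
        case True
        then have "s = 0 \<or> s = 1" "s' = 0 \<or> s' = 1" using ss by auto
        then show ?thesis using d True by auto
      next
        case False
        then have "odd p" using p primes_dvd_imp_eq two_is_prime_nat by blast
        then have "2 * (p div 2) < p" by presburger
        then have "s + s' < p" using ss by linarith
        moreover have "p dvd s + s'" using d by (metis int_dvd_int_iff of_nat_add)
        ultimately have "s + s' = 0" using nat_dvd_not_less by blast
        then show ?thesis by simp
      qed
    qed
    then show ?thesis using M1 \<nu>\<nu> by simp
  qed simp
qed

section \<open>Isomorphisms between models\<close>

context pnm begin

lemma model_normal_form:
  assumes nr: "p \<noteq> 2 \<Longrightarrow> \<not> QuadRes (int p) \<nu>\<^sub>0"
  shows "\<exists>l \<in> M_labels p \<nu>\<^sub>0. model w \<cong> M_group p n m l"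
proof -
  obtain l' i k l where l': "l' \<in> M_labels p \<nu>\<^sub>0" and t: "params_equiv p w (label_params p l') i k l"
    using normal_form_exists[OF p nr] by blast
  have "model (label_params p l') \<cong> model w"
    using t by (cases w; cases "label_params p l'") (simp add: params_equiv_def model_transform[of i k _ _ _ _ l])
  then have "model w \<cong> model (label_params p l')" by (rule group.iso_sym[OF group_model])
  moreover have "good_label p l'" using good_label[OF p] nr l' by blast
  ultimately show ?thesis using M_group_iso l' iso_trans by blast
qed


lemma has_params_hom:
  assumes "group_hom G H f" "has_params w G a b"
  shows "has_params w H (f a) (f b)"
proof -
  interpret group_hom G H f by (rule assms)
  obtain \<alpha>1 \<alpha>2 \<beta>1 \<beta>2 where w: "w = (\<alpha>1, \<alpha>2, \<beta>1, \<beta>2)" by (cases w)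
  define c where "c = gcomm G a b"
  define d where "d = gcomm G c a"
  have ab: "a \<in> carrier G" "b \<in> carrier G" using assms(2) by (simp_all add: w)
  then have cd: "c \<in> carrier G" "d \<in> carrier G" by (simp_all add: c_def d_def)
  have fc: "gcomm H (f a) (f b) = f c" "gcomm H (f c) (f a) = f d"
    using ab cd by (simp_all add: c_def d_def hom_gcomm)
  have *: "gcomm G c b = \<one>\<^bsub>G\<^esub>" "gcomm G d a = \<one>\<^bsub>G\<^esub>" "gcomm G d b = \<one>\<^bsub>G\<^esub>"
      "d [^]\<^bsub>G\<^esub> int p = \<one>\<^bsub>G\<^esub>" "c [^]\<^bsub>G\<^esub> ((int p)\<^sup>2) = \<one>\<^bsub>G\<^esub>"
      "a [^]\<^bsub>G\<^esub> (int p ^ n) = c [^]\<^bsub>G\<^esub> (int p * \<alpha>1) \<otimes>\<^bsub>G\<^esub> d [^]\<^bsub>G\<^esub> \<alpha>2"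
      "b [^]\<^bsub>G\<^esub> (int p ^ m) = c [^]\<^bsub>G\<^esub> (int p * \<beta>1) \<otimes>\<^bsub>G\<^esub> d [^]\<^bsub>G\<^esub> \<beta>2"
    using assms(2) by (simp_all add: w Let_def c_def[symmetric] d_def[symmetric])
  from *[THEN arg_cong[of _ _ f]] show ?thesis
    using ab cd by (simp add: w fc hom_gcomm[symmetric] hom_int_pow[symmetric])
qed

end

text \<open>The images of the generators satisfy the same relations, and a power lying in the
  subgroup of c and d has first coordinates divisible by \<open>p ^ n2\<close> and
  \<open>p ^ m2\<close>. The image of c has the determinant as its c-exponent; if p divided it, the
  p-th power of this image would be trivial, although c has order p^2.\<close>

lemma model_iso_coords:
  assumes A: "pnm p n1 m1" and B: "pnm p n2 m2"
    and iso: "pnm.model p n1 m1 w1 \<cong> pnm.model p n2 m2 w2"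
  obtains x y u v x' y' u' v' where
    "pnm.has_params p n1 m1 w1 (pnm.model p n2 m2 w2) (pnm.q p n2 m2 w2 (x, y, u, v)) (pnm.q p n2 m2 w2 (x', y', u', v'))"
    "int p ^ n2 dvd int p ^ n1 * x" "int p ^ m2 dvd int p ^ n1 * y"
    "int p ^ n2 dvd int p ^ m1 * x'" "int p ^ m2 dvd int p ^ m1 * y'" "\<not> int p dvd x * y' - x' * y"
proof -
  interpret A: pnm p n1 m1 by (rule A)
  interpret B: pnm p n2 m2 by (rule B)
  obtain f where f: "f \<in> iso (A.model w1) (B.model w2)" using iso by (auto simp: is_iso_def)
  have gh: "group_hom (A.model w1) (B.model w2) f"
    using f by (simp add: group_hom_def group_hom_axioms_def A.group_model B.group_model iso_def)
  interpret f: group_hom "A.model w1" "B.model w2" f by (rule gh)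
  let ?a = "A.q w1 (1, 0, 0, 0)" and ?b = "A.q w1 (0, 1, 0, 0)"
  have "f ?a \<in> range (B.q w2)" "f ?b \<in> range (B.q w2)"
    using f.hom_closed[of ?a] f.hom_closed[of ?b] by (simp_all add: B.carrier_model)
  then obtain x y u v x' y' u' v' where fa: "f ?a = B.q w2 (x, y, u, v)" and fb: "f ?b = B.q w2 (x', y', u', v')"
    by (metis (no_types, lifting) imageE prod_cases4)
  have has_params: "A.has_params w1 (B.model w2) (B.q w2 (x, y, u, v)) (B.q w2 (x', y', u', v'))"
    using A.has_params_hom[OF gh A.has_params_q] by (simp add: fa fb)
  obtain \<alpha>1 \<alpha>2 \<beta>1 \<beta>2 where w1: "w1 = (\<alpha>1, \<alpha>2, \<beta>1, \<beta>2)" by (cases w1)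
  obtain V where c: "gcomm (B.model w2) (B.q w2 (x, y, u, v)) (B.q w2 (x', y', u', v')) = B.q w2 (0, 0, x * y' - x' * y, V)"
    by (simp add: B.q_gcomm cover_gcomm)
  obtain W where d: "gcomm (B.model w2) (B.q w2 (0, 0, x * y' - x' * y, V)) (B.q w2 (x, y, u, v)) = B.q w2 (0, 0, 0, W)"
    by (simp add: B.q_gcomm cover_gcomm)
  have pw: "\<exists>U V. B.q w2 (x, y, u, v) [^]\<^bsub>B.model w2\<^esub> (k :: int) = B.q w2 (k * x, k * y, U, V)" for x y u v k
    using cover_int_pow_xy[of x y u v k] by (metis B.q_pow)
  have qd: "int p ^ n2 dvd k * x \<and> int p ^ m2 dvd k * y"
    if k: "B.q w2 (x, y, u, v) [^]\<^bsub>B.model w2\<^esub> k \<in> {B.q w2 (0, 0, U, V) | U V. True}" for x y u v k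
  proof -
    obtain U V U' V' where "B.q w2 (k * x, k * y, U, V) = B.q w2 (0, 0, U', V')"
      using k pw[of x y u v k] by auto
    then show ?thesis by (rule B.q_dvd)
  qed
  have "B.q w2 (x, y, u, v) [^]\<^bsub>B.model w2\<^esub> (int p ^ n1) \<in> {B.q w2 (0, 0, U, V) | U V. True}"
    "B.q w2 (x', y', u', v') [^]\<^bsub>B.model w2\<^esub> (int p ^ m1) \<in> {B.q w2 (0, 0, U, V) | U V. True}"
    using has_params by (auto simp: w1 Let_def c d B.q_pow cover_int_pow_cd B.q_mult)
  then have "int p ^ n2 dvd int p ^ n1 * x \<and> int p ^ m2 dvd int p ^ n1 * y"
    "int p ^ n2 dvd int p ^ m1 * x' \<and> int p ^ m2 dvd int p ^ m1 * y'"
    using qd by blast+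
  moreover have "\<not> int p dvd x * y' - x' * y"
  proof
    assume "int p dvd x * y' - x' * y"
    then have "(int p)\<^sup>2 dvd int p * (x * y' - x' * y)" by (simp add: power2_eq_square)
    then have "gcomm (B.model w2) (f ?a) (f ?b) [^]\<^bsub>B.model w2\<^esub> int p = \<one>\<^bsub>B.model w2\<^esub>"
      by (simp add: fa fb c B.q_pow cover_int_pow_cd B.q_one B.q_cd_eq)
    then have "f (A.q w1 (0, 0, int p, 0)) = f (A.q w1 (0, 0, 0, 0))"
      by (simp add: f.hom_gcomm[symmetric] f.hom_int_pow[symmetric] A.q_gcomm cover_gcomm A.q_pow cover_int_pow_cd A.q_one[symmetric])
    moreover have "inj_on f (carrier (A.model w1))" using f by (simp add: iso_def bij_betw_def)
    ultimately have "A.q w1 (0, 0, int p, 0) = A.q w1 (0, 0, 0, 0)" by (simp add: inj_on_def)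
    then have "(int p)\<^sup>2 dvd int p" by (simp add: A.q_cd_eq)
    then have "int p dvd 1" using A.sq_dvd[of 1] by simp
    then show False using A.p by auto
  qed
  ultimately show thesis using that has_params by blast
qed

text \<open>If n1 < n2, then p divides x and x'; if m1 < m2, then p divides y' and x'. Either way p
  would divide the determinant.\<close>

lemma model_iso_le:
  assumes A: "pnm p n1 m1" and B: "pnm p n2 m2"
    and iso: "pnm.model p n1 m1 w1 \<cong> pnm.model p n2 m2 w2"
  shows "n2 \<le> n1 \<and> m2 \<le> m1"
proof -
  interpret A: pnm p n1 m1 by (rule A)
  interpret B: pnm p n2 m2 by (rule B)
  obtain x y x' y' where
    d: "int p ^ n2 dvd int p ^ n1 * x" "int p ^ m2 dvd int p ^ n1 * y"
    "int p ^ n2 dvd int p ^ m1 * x'" "int p ^ m2 dvd int p ^ m1 * y'" "\<not> int p dvd x * y' - x' * y"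
    using model_iso_coords[OF A B iso] by metis
  have *: "int p dvd z" if lt: "e < e'" and dv: "int p ^ e' dvd int p ^ e * z" for e e' z
  proof -
    have "int p ^ e * int p dvd int p ^ e'" using lt by (metis Suc_leI le_imp_power_dvd power_Suc2)
    then have "int p ^ e * int p dvd int p ^ e * z" using dv dvd_trans by blast
    then show ?thesis by simp
  qed
  have "\<not> n1 < n2"
  proof
    assume "n1 < n2"
    then have "int p dvd x" "int p dvd x'" using *[OF _ d(1)] *[OF _ d(3)] A.mn by auto
    then show False using d(5) by simp
  qed
  moreover have "\<not> m1 < m2"
  proof
    assume "m1 < m2"
    then have "int p dvd y'" "int p dvd x'" using *[OF _ d(4)] *[OF _ d(3)] B.mn by auto
    then show False using d(5) by simp
  qed
  ultimately show ?thesis by simp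
qed

context pnm begin

text \<open>The divisibility by \<open>p ^ n\<close> gives the image of b the form that
  \<open>has_params_iff\<close> treats, so the congruences can be read off from any
  isomorphism.\<close>

lemma model_iso_params_equiv:
  assumes "model w \<cong> model w'"
  shows "\<exists>i k l. params_equiv p w' w i k l"
proof -
  obtain x y u v x' y' u' v' where
    has_params: "has_params w (model w') (q w' (x, y, u, v)) (q w' (x', y', u', v'))"
    and d: "int p ^ n dvd int p ^ m * x'" "\<not> int p dvd x * y' - x' * y"
    using model_iso_coords[OF pnm_axioms pnm_axioms assms] by metis
  have "int p ^ (n - m) dvd x'" using d(1) unfolding pn_split by simp
  then obtain l where l: "x' = int p ^ (n - m) * l" by (auto elim: dvdE)
  then have "int p dvd x'" using pow_dvd_helper(3) by simp
  then have "\<not> int p dvd x" "\<not> int p dvd y'" using d(2) by auto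
  moreover obtain \<alpha>1 \<alpha>2 \<beta>1 \<beta>2 where w: "w = (\<alpha>1, \<alpha>2, \<beta>1, \<beta>2)" by (cases w)
  moreover obtain \<gamma>1 \<gamma>2 \<delta>1 \<delta>2 where w': "w' = (\<gamma>1, \<gamma>2, \<delta>1, \<delta>2)" by (cases w')
  ultimately have "params_equiv p w' w x y' l"
    using has_params has_params_iff[OF w' HOL.refl HOL.refl, of \<alpha>1 \<alpha>2 \<beta>1 \<beta>2] by (simp add: params_equiv_def l w')
  then show ?thesis by blast
qed

end

lemma M_group_not_iso:
  assumes p: "prime p" and nr: "p \<noteq> 2 \<Longrightarrow> \<not> QuadRes (int p) \<nu>\<^sub>0"
    and 1: "2 \<le> m1" "m1 < n1" "l1 \<in> M_labels p \<nu>\<^sub>0" and 2: "2 \<le> m2" "m2 < n2" "l2 \<in> M_labels p \<nu>\<^sub>0"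
    and iso: "M_group p n1 m1 l1 \<cong> M_group p n2 m2 l2"
  shows "(n1, m1, l1) = (n2, m2, l2)"
proof -
  interpret A: pnm p n1 m1 using p 1 by unfold_locales
  interpret B: pnm p n2 m2 using p 2 by unfold_locales
  have good: "good_label p l1" "good_label p l2" using good_label[OF p] nr 1 2 by blast+
  have AB: "A.model (label_params p l1) \<cong> B.model (label_params p l2)"
    using iso_trans[OF iso_trans[OF A.M_group_iso[OF good(1)] iso] group.iso_sym[OF B.group_model B.M_group_iso[OF good(2)]]] .
  have "n2 \<le> n1 \<and> m2 \<le> m1" by (rule model_iso_le[OF A.pnm_axioms B.pnm_axioms AB])
  moreover have "n1 \<le> n2 \<and> m1 \<le> m2"
    by (rule model_iso_le[OF B.pnm_axioms A.pnm_axioms group.iso_sym[OF A.group_model AB]])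
  ultimately have nm: "n1 = n2" "m1 = m2" by auto
  obtain i k l where "params_equiv p (label_params p l2) (label_params p l1) i k l"
    using A.model_iso_params_equiv AB nm by blast
  then have "l2 = l1" using normal_form_unique[OF p _ 2(3) 1(3)] nr by blast
  then show ?thesis using nm by simp
qed

section \<open>The hypotheses of the classification\<close>

lemma (in group) frattini_subgroup: "subgroup (frattini G) G"
proof (rule subgroupI)
  show "frattini G \<subseteq> carrier G" by (simp add: frattini_def)
  show "frattini G \<noteq> {}"
  proof -
    have "\<one> \<in> frattini G" by (auto simp: frattini_def maximal_subgroup_def subgroup.one_closed)
    then show ?thesis by blast
  qed
  show "inv x \<in> frattini G" if "x \<in> frattini G" for x
    using that by (auto simp: frattini_def maximal_subgroup_def subgroup.m_inv_closed)
  show "x \<otimes> y \<in> frattini G" if "x \<in> frattini G" "y \<in> frattini G" for x y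
    using that by (auto simp: frattini_def maximal_subgroup_def subgroup.m_closed)
qed

text \<open>A subgroup that is maximal among those containing all \<open>p\<close>-th powers but not \<open>x\<close> is a maximal
  subgroup.\<close>

lemma (in comm_group) frattini_subset_powers:
  assumes fin: "finite (carrier G)" and p: "prime p"
  shows "frattini G \<subseteq> (\<lambda>x. x [^] int p) ` carrier G"
proof
  fix x assume xf: "x \<in> frattini G"
  then have x: "x \<in> carrier G" by (simp add: frattini_def)
  define Q where "Q = (\<lambda>x. x [^] int p) ` carrier G"
  have Q: "subgroup Q G"
  proof (rule subgroupI)
    show "Q \<noteq> {}" by (auto simp: Q_def)
    show "inv y \<in> Q" if "y \<in> Q" for y
      using that by (auto simp: Q_def int_pow_inv[symmetric])
    show "y \<otimes> z \<in> Q" if "y \<in> Q" "z \<in> Q" for y z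
      using that by (auto simp: Q_def int_pow_distrib[symmetric])
  qed (auto simp: Q_def)
  show "x \<in> (\<lambda>x. x [^] int p) ` carrier G"
  proof (rule ccontr)
    assume "x \<notin> (\<lambda>x. x [^] int p) ` carrier G"
    then have xQ: "x \<notin> Q" by (simp add: Q_def)
    define F where "F = {K. subgroup K G \<and> Q \<subseteq> K \<and> x \<notin> K}"
    have "F \<subseteq> Pow (carrier G)" by (auto simp: F_def dest: subgroup.subset)
    then have "finite F" using fin by (simp add: finite_subset)
    moreover have "Q \<in> F" using Q xQ by (simp add: F_def)
    ultimately obtain K where K: "K \<in> F" and max: "\<And>L. L \<in> F \<Longrightarrow> K \<subseteq> L \<Longrightarrow> K = L"
      using finite_has_maximal[of F] by auto
    have Ks: "subgroup K G" and QK: "Q \<subseteq> K" and xK: "x \<notin> K" using K by (simp_all add: F_def)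
    interpret K: subgroup K G by (rule Ks)
    have xL: "x \<in> L" if "subgroup L G" "K \<subseteq> L" "L \<noteq> K" for L
      using that max[of L] QK by (auto simp: F_def)
    have "maximal_subgroup K G"
      unfolding maximal_subgroup_def
    proof (intro conjI allI impI)
      show "K \<noteq> carrier G" using x xK by auto
      fix L assume L: "subgroup L G \<and> K \<subseteq> L"
      interpret L: subgroup L G using L by simp
      show "L = K \<or> L = carrier G"
      proof (cases "L = K")
        case False
        then have "x \<in> L" using xL L by simp
        have "y \<in> L" if y: "y \<in> carrier G" for y
        proof (rule ccontr)
          assume "y \<notin> L"
          then have "y \<notin> K" using L by auto
          \<comment> \<open>For y outside L the subgroup M generated by K and y contains x, say x =
            k y^j. As y^p lies in K but x does not, p does not divide j; hence y is a combination of
            y^j and y^p, both of which lie in L.\<close>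
          define M where "M = {k \<otimes> y [^] j | k j. k \<in> K \<and> (j :: int) \<in> UNIV}"
          have kc: "k \<in> carrier G" if "k \<in> K" for k using that K.subset by auto
          have M: "subgroup M G"
          proof (rule subgroupI)
            show "M \<subseteq> carrier G" using kc y by (auto simp: M_def)
            have "\<one> \<otimes> y [^] (0 :: int) \<in> M" using K.one_closed unfolding M_def by blast
            then show "M \<noteq> {}" by blast
            fix g assume "g \<in> M"
            then obtain k j where g: "g = k \<otimes> y [^] (j :: int)" "k \<in> K" by (auto simp: M_def)
            have "inv g = inv k \<otimes> y [^] (- j)" using g kc y by (simp add: inv_mult int_pow_neg)
            then show "inv g \<in> M" using g by (auto simp: M_def)
            fix h assume "h \<in> M"
            then obtain k' j' where h: "h = k' \<otimes> y [^] (j' :: int)" "k' \<in> K" by (auto simp: M_def)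
            have "g \<otimes> h = (k \<otimes> k') \<otimes> y [^] (j + j')" using g h kc y by (simp add: int_pow_mult m_ac)
            then show "g \<otimes> h \<in> M" using g h K.m_closed by (auto simp: M_def)
          qed
          have "k \<in> M" if "k \<in> K" for k
            unfolding M_def using that kc by (auto intro!: exI[of _ k] exI[of _ 0])
          moreover have "y \<in> M" unfolding M_def using y by (auto intro!: exI[of _ \<one>] exI[of _ 1])
          ultimately have "x \<in> M" using xL[OF M] \<open>y \<notin> K\<close> by blast
          then obtain k j where kj: "x = k \<otimes> y [^] (j :: int)" "k \<in> K" by (auto simp: M_def)
          have yp: "y [^] int p \<in> K" using QK y by (auto simp: Q_def)
          have "\<not> int p dvd j"
          proof
            assume "int p dvd j"
            then obtain i where "j = int p * i" by (auto elim: dvdE)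
            then have "y [^] j \<in> K" using subgroup_int_pow_closed[OF Ks yp] y by (simp add: int_pow_pow)
            then show False using kj xK K.m_closed by simp
          qed
          then have "coprime (int p) j" using p by (simp add: prime_imp_coprime)
          then have "coprime j (int p)" by (simp add: coprime_commute)
          then obtain s t where st: "s * j + t * int p = 1"
            using bezout_int[of j "int p"] by (auto simp: coprime_imp_gcd_eq_1)
          have "y [^] j = inv k \<otimes> x" using kj kc y by (simp add: m_assoc[symmetric])
          moreover have "inv k \<in> L" using kj L by (auto intro: L.m_inv_closed)
          ultimately have "y [^] j \<in> L" using L.m_closed[OF _ \<open>x \<in> L\<close>] by metis
          then have "(y [^] j) [^] s \<otimes> (y [^] int p) [^] t \<in> L"
            using subgroup_int_pow_closed L yp by (meson L.m_closed subsetD)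
          also have "(y [^] j) [^] s \<otimes> (y [^] int p) [^] t = y [^] (s * j + t * int p)"
            using y by (simp add: int_pow_pow int_pow_mult mult.commute)
          finally show False using y \<open>y \<notin> L\<close> by (simp add: st)
        qed
        then show ?thesis using L.subset by auto
      qed simp
    qed (use Ks in simp)
    then show False using xf xK by (auto simp: frattini_def)
  qed
qed

lemma (in group) cyclic_prime_order:
  assumes iso: "G \<cong> integer_mod_group p" and p: "prime p" and t: "t \<in> carrier G"
  shows "t [^] p = \<one>" "\<lbrakk>t \<noteq> \<one>; s \<in> carrier G\<rbrakk> \<Longrightarrow> \<exists>k :: nat. s = t [^] k"
proof -
  obtain f where f: "f \<in> iso G (integer_mod_group p)" using iso by (auto simp: is_iso_def)
  interpret f: group_hom G "integer_mod_group p" f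
    using f by (simp add: group_hom_def group_hom_axioms_def iso_def is_group)
  have inj: "x = y" if "f x = f y" "x \<in> carrier G" "y \<in> carrier G" for x y
    using that f by (auto simp: iso_def bij_betw_def inj_on_def)
  have p0: "p \<noteq> 0" using p by auto
  have fk: "f (t [^] k) = (int k * f t) mod int p" for k :: nat
    using t by (simp add: f.hom_nat_pow)
  show "t [^] p = \<one>"
    by (rule inj) (use t fk[of p] f.hom_one in simp_all)
  assume "t \<noteq> \<one>" and s: "s \<in> carrier G"
  then have "f t \<noteq> 0" using inj[of t \<one>] t f.hom_one by auto
  have fr: "f t \<in> {0..<int p}" "f s \<in> {0..<int p}"
    using f.hom_closed[OF t] f.hom_closed[OF s] p0 by (simp_all add: carrier_integer_mod_group)
  then have "\<not> int p dvd f t" using \<open>f t \<noteq> 0\<close> zdvd_not_zless[of "f t" "int p"] by auto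
  then have mi: "int p dvd f t * minv p (f t) - 1" by (rule minv[OF p])
  define k where "k = nat ((f s * minv p (f t)) mod int p)"
  have "int k = (f s * minv p (f t)) mod int p" using p0 by (simp add: k_def)
  then have "int p dvd int k - f s * minv p (f t)" by (simp add: mod_eq_dvd_iff[symmetric])
  then have "int p dvd int k * f t - f s"
    by (rule dvd_lin2[OF _ mi, of _ _ "f t" "f s"]) (simp add: algebra_simps)
  then have "(int k * f t) mod int p = f s" using fr by (simp add: mod_eq_dvd_iff[symmetric])
  then have "f s = f (t [^] k)" by (simp add: fk)
  then show "\<exists>k :: nat. s = t [^] k" using inj s t by blast
qed

lemma carrier_card_iso:
  assumes "G \<cong> H" shows "card (carrier G) = card (carrier H)"
  using assms by (auto simp: is_iso_def iso_def bij_betw_same_card)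

lemma nat_pow_DirProd:
  "(x, y) [^]\<^bsub>G \<times>\<times> H\<^esub> (k :: nat) = (x [^]\<^bsub>G\<^esub> k, y [^]\<^bsub>H\<^esub> k)"
  by (induction k) (simp_all add: one_DirProd)

lemma group_triple: "group (integer_mod_group q1 \<times>\<times> (integer_mod_group q2 \<times>\<times> integer_mod_group q3))"
  by (intro DirProd_group) simp_all

lemma abelian_type3_exponent:
  assumes A: "group A" and type: "abelian_type3 A q1 q2 q3" and k: "q1 dvd k" "q2 dvd k" "q3 dvd k"
    and x: "x \<in> carrier A"
  shows "x [^]\<^bsub>A\<^esub> k = \<one>\<^bsub>A\<^esub>"
proof -
  let ?H = "integer_mod_group q1 \<times>\<times> (integer_mod_group q2 \<times>\<times> integer_mod_group q3)"
  obtain f where f: "f \<in> iso A ?H" using type by (auto simp: abelian_type3_def is_iso_def)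
  interpret f: group_hom A ?H f
    using f A group_triple by (simp add: group_hom_def group_hom_axioms_def iso_def)
  interpret A: group A by (rule A)
  obtain u v w where fx: "f x = (u, v, w)" by (cases "f x")
  have "f (x [^]\<^bsub>A\<^esub> k) = \<one>\<^bsub>?H\<^esub>"
    using x k by (simp add: f.hom_nat_pow fx nat_pow_DirProd one_DirProd)
  also have "\<dots> = f \<one>\<^bsub>A\<^esub>" by (rule f.hom_one[symmetric])
  finally show ?thesis
    using f x by (auto simp: iso_def bij_betw_def inj_on_def)
qed

lemma (in group) comm_subgroup:
  assumes "x \<in> carrier G" shows "subgroup {g \<in> carrier G. g \<otimes> x = x \<otimes> g} G"
proof (rule subgroupI)
  show "inv g \<in> {g \<in> carrier G. g \<otimes> x = x \<otimes> g}" if "g \<in> {g \<in> carrier G. g \<otimes> x = x \<otimes> g}" for g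
    using that comm_inv[of g x] assms by simp
  show "g \<otimes> h \<in> {g \<in> carrier G. g \<otimes> x = x \<otimes> g}"
    if "g \<in> {g \<in> carrier G. g \<otimes> x = x \<otimes> g}" "h \<in> {g \<in> carrier G. g \<otimes> x = x \<otimes> g}" for g h
    using that comm_mult[of x g h] assms by simp
qed (use assms in auto)

text \<open>The relations give collected words with d = 1. That a trivial word has exponents
  divisible by \<open>p ^ n\<close>, \<open>p ^ m\<close> and p is seen in the concrete quotient by
  \<open>M_p_relators\<close>, to which the presented group maps.\<close>

lemma M_p_struct:
  assumes p: "prime p" and m: "1 \<le> m" "m < n"
  obtains A B C where "frame (M_p p n m) A B C \<one>\<^bsub>M_p p n m\<^esub>"
    "A [^]\<^bsub>M_p p n m\<^esub> (int p ^ n) = \<one>\<^bsub>M_p p n m\<^esub>" "B [^]\<^bsub>M_p p n m\<^esub> (int p ^ m) = \<one>\<^bsub>M_p p n m\<^esub>"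
    "C [^]\<^bsub>M_p p n m\<^esub> int p = \<one>\<^bsub>M_p p n m\<^esub>"
    "range (frame.hm (M_p p n m) A B C \<one>\<^bsub>M_p p n m\<^esub>) = carrier (M_p p n m)"
    "\<And>x y u v. frame.hm (M_p p n m) A B C \<one>\<^bsub>M_p p n m\<^esub> (x, y, u, v) = \<one>\<^bsub>M_p p n m\<^esub> \<Longrightarrow>
       int p ^ n dvd x \<and> int p ^ m dvd y \<and> int p dvd u"
proof -
  define S where "S = {Gen_a, Gen_b, Gen_c}"
  define R where "R = {(wa \<up> (int p ^ n), []), (wb \<up> (int p ^ m), []), (wc \<up> int p, []),
     (wcomm wa wb, wc), (wcomm wc wa, []), (wcomm wc wb, [])}"
  define P where "P = presented_group S R"
  define f where "f = gen_class S R"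
  have MP: "M_p p n m = P" by (simp add: M_p_def P_def S_def R_def)
  have Rw: "R \<subseteq> gen_words S \<times> gen_words S" by (simp add: R_def S_def)
  interpret evaluation P f unfolding P_def f_def by (rule evaluation_gen_class)
  have "\<forall>(u, v) \<in> R. weval P f u = weval P f v" unfolding P_def f_def using weval_gen_class_rel[OF _ Rw] by blast
  note rel = this[unfolded R_def, simplified ball_simps(5,7) prod.case weval.simps(1) weval_simps]
  define A B C where "A = f Gen_a" and "B = f Gen_b" and "C = f Gen_c"
  note ABC = A_def[symmetric] B_def[symmetric] C_def[symmetric]
  have [simp]: "A \<in> carrier P" "B \<in> carrier P" "C \<in> carrier P" by (simp_all add: A_def B_def C_def)
  interpret F: frame P A B C "\<one>\<^bsub>P\<^esub>"
    using rel by unfold_locales (simp_all add: ABC gcomm_eq_iff gcomm_one_iff)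
  have sub: "subgroup (range F.hm) P" using F.hm.img_is_subgroup by simp
  have F1: "F.hm (x, y, u, v) \<in> range F.hm" for x y u v by simp
  have "A \<in> range F.hm" using F1[of 1 0 0 0] by (simp add: F.hm_def F.cd_def)
  moreover have "B \<in> range F.hm" using F1[of 0 1 0 0] by (simp add: F.hm_def F.cd_def)
  moreover have "C \<in> range F.hm" using F1[of 0 0 1 0] by (simp add: F.hm_def F.cd_def)
  ultimately have "f g \<in> range F.hm" if "g \<in> S" for g
    using that by (auto simp: S_def ABC)
  then have "carrier P \<subseteq> range F.hm"
    using presented_group_generated[of "range F.hm" S R, folded P_def f_def, OF sub] by blast
  then have surj: "range F.hm = carrier P" using F.hm.hom_closed by auto
  define Q where "Q = cover Mod M_p_relators p n m"
  define k where "k g = M_p_relators p n m #>\<^bsub>cover\<^esub> g" for g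
  note nMM = normal_M_p_relators[OF m, of p]
  interpret Q: group Q unfolding Q_def by (rule normal_quotient[OF nMM group_cover])
  interpret k: group_hom cover Q k
    using normal_quotient(2)[OF nMM group_cover] Q.is_group
    by (simp add: group_hom_def group_hom_axioms_def group_cover Q_def k_def[abs_def])
  have keq: "k g = k h \<longleftrightarrow> cover_mult g (inv\<^bsub>cover\<^esub> h) \<in> M_p_relators p n m" for g h
    unfolding k_def using coset_eq_iff[OF nMM group_cover, of g h] by simp
  have k1: "\<one>\<^bsub>Q\<^esub> = k (0, 0, 0, 0)" using k.hom_one by simp
  have kp: "k g [^]\<^bsub>Q\<^esub> (i :: int) = k (g [^]\<^bsub>cover\<^esub> i)" for g i using k.hom_int_pow[of g i] by simp
  have kg: "gcomm Q (k g) (k h) = k (gcomm cover g h)" for g h using k.hom_gcomm[of g h] by simp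
  have km: "k g \<otimes>\<^bsub>Q\<^esub> k h = k (cover_mult g h)" for g h using k.hom_mult[of g h] by simp
  define f' where "f' g = k (case g of Gen_a \<Rightarrow> (1, 0, 0, 0) | Gen_b \<Rightarrow> (0, 1, 0, 0) | _ \<Rightarrow> (0, 0, 1, 0))" for g
  interpret E: evaluation Q f' using k.hom_closed by unfold_locales (simp add: f'_def)
  have relQ: "\<forall>(u, v) \<in> R. weval Q f' u = weval Q f' v"
    unfolding R_def
    by (simp only: ball_simps(5,7) prod.case weval.simps(1) E.weval_simps)
      (simp add: f'_def kp kg k1 cover_gcomm cover_int_pow_cd cover_int_pow_a cover_int_pow_b keq M_p_relators_def)
  have relQ': "weval Q f' u = weval Q f' v" if "(u, v) \<in> R" for u v using relQ that by auto
  obtain h where h: "h \<in> hom P Q" and hw: "\<And>w. w \<in> gen_words S \<Longrightarrow> h (pres_class S R w) = weval Q f' w"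
    by (rule E.von_dyck[of R S, folded P_def]) (erule relQ', rule that)
  interpret h: group_hom P Q h using h by (simp add: group_hom_def group_hom_axioms_def Q.is_group is_group)
  have hg: "h (f g) = f' g" if "g \<in> S" for g
    using hw[of "[(g, True)]"] that by (simp add: f_def gen_class_def)
  have hABC: "h A = k (1, 0, 0, 0)" "h B = k (0, 1, 0, 0)" "h C = k (0, 0, 1, 0)"
    using hg[of Gen_a] hg[of Gen_b] hg[of Gen_c] by (simp_all add: S_def A_def B_def C_def f'_def)
  have hhm: "h (F.hm (x, y, u, v)) = k (x, y, u, 0)" for x y u v
    by (simp add: F.hm_def F.cd_def h.hom_int_pow hABC kp km cover_int_pow_cd cover_int_pow_a cover_int_pow_b)
  show thesis
  proof (rule that[of A B C, unfolded MP])
    show "frame P A B C \<one>\<^bsub>P\<^esub>" by (rule F.frame_axioms)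
    show "range F.hm = carrier P" by (rule surj)
    show "int p ^ n dvd x \<and> int p ^ m dvd y \<and> int p dvd u" if "F.hm (x, y, u, v) = \<one>\<^bsub>P\<^esub>" for x y u v
    proof -
      have "k (x, y, u, 0) = k (0, 0, 0, 0)"
        using hhm[of x y u v] that h.hom_one k1 by simp
      then show ?thesis by (simp add: keq M_p_relators_def)
    qed
  qed (use rel in \<open>simp_all add: ABC\<close>)
qed

lemma prime_pow_cong_self:
  assumes "prime p"
  shows "[r ^ (p ^ K) = r] (mod p)"
proof (induction K)
  case (Suc K)
  have f: "[x ^ p = x] (mod p)" for x :: nat
  proof (cases "p dvd x")
    case True
    then show ?thesis using assms by (metis cong_0_iff cong_sym cong_trans dvd_power prime_gt_0_nat dvd_trans)
  next
    case False
    then have "[x ^ (p - 1) = 1] (mod p)" by (rule fermat_theorem[OF assms])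
    then have "[x * x ^ (p - 1) = x * 1] (mod p)" by (rule cong_scalar_left)
    then show ?thesis using assms by (simp add: power_eq_if[of x p] prime_gt_0_nat)
  qed
  have "[(r ^ (p ^ K)) ^ p = r] (mod p)" using f[of "r ^ (p ^ K)"] Suc cong_trans by blast
  then show ?case by (simp add: power_mult[symmetric] mult.commute)
qed simp

section \<open>Structure of a group satisfying the hypotheses\<close>

locale class3 = group +
  fixes p n m :: nat
  assumes p: "prime p" and fin: "finite_p_group p G"
    and third: "subgrp G (third_term G) \<cong> integer_mod_group p"
    and frat: "subgrp G (frattini_third G) \<cong> integer_mod_group p \<times>\<times> integer_mod_group p"
    and m1: "1 \<le> m" and mn: "m < n"
    and quot: "G Mod frattini_third G \<cong> M_p p n m"
    and cent: "abelian_type3 (subgrp G (centralizer G (derived_subgrp G)) Mod frattini_third G)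
            (p ^ (n - 1)) (p ^ m) p"
begin

abbreviation D where "D \<equiv> derived_subgrp G"
abbreviation T where "T \<equiv> third_term G"
abbreviation N where "N \<equiv> frattini_third G"

lemma D_normal: "D \<lhd> G"
  unfolding derived_subgrp_def using derived_is_normal[OF normal_self] .

lemma D_subgroup: "subgroup D G" using D_normal by (rule normal_imp_subgroup)

lemma D_carrier: "x \<in> D \<Longrightarrow> x \<in> carrier G" using subgroup.mem_carrier[OF D_subgroup] .

lemma T_gen: "(\<Union>h\<in>D. \<Union>k\<in>carrier G. {h \<otimes> k \<otimes> inv h \<otimes> inv k}) \<subseteq> carrier G"
  using D_carrier by auto

lemma T_subgroup: "subgroup T G"
  unfolding third_term_def commutator_subgroup_def by (rule generate_is_subgroup[OF T_gen])

lemma T_carrier: "x \<in> T \<Longrightarrow> x \<in> carrier G" using subgroup.mem_carrier[OF T_subgroup] .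

lemma gcomm_T: "h \<in> D \<Longrightarrow> g \<in> carrier G \<Longrightarrow> gcomm G h g \<in> T"
proof -
  assume h: "h \<in> D" and g: "g \<in> carrier G"
  have "inv h \<otimes> inv g \<otimes> inv (inv h) \<otimes> inv (inv g) \<in> T"
    unfolding third_term_def commutator_subgroup_def
    by (rule generate.incl) (use h g subgroup.m_inv_closed[OF D_subgroup] in blast)
  then show ?thesis using h g D_carrier by (simp add: gcomm_def)
qed

lemma gcomm_D: "h \<in> carrier G \<Longrightarrow> g \<in> carrier G \<Longrightarrow> gcomm G h g \<in> D"
proof -
  assume h: "h \<in> carrier G" and g: "g \<in> carrier G"
  have "inv h \<otimes> inv g \<otimes> inv (inv h) \<otimes> inv (inv g) \<in> D"
    unfolding derived_subgrp_def derived_def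
    by (rule generate.incl) (use h g in blast)
  then show ?thesis using h g by (simp add: gcomm_def)
qed

lemma D_least:
  assumes S: "subgroup S G" and "\<And>x y. x \<in> carrier G \<Longrightarrow> y \<in> carrier G \<Longrightarrow> x \<otimes> y \<otimes> inv x \<otimes> inv y \<in> S"
  shows "D \<subseteq> S"
  unfolding derived_subgrp_def derived_def
  by (rule generate_subgroup_incl[OF _ S]) (use assms(2) in blast)

lemma T_least:
  assumes S: "subgroup S G" and "\<And>h k. h \<in> D \<Longrightarrow> k \<in> carrier G \<Longrightarrow> h \<otimes> k \<otimes> inv h \<otimes> inv k \<in> S"
  shows "T \<subseteq> S"
  unfolding third_term_def commutator_subgroup_def
  by (rule generate_subgroup_incl[OF _ S]) (use assms(2) in blast)

lemma T_sub_D: "T \<subseteq> D"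
proof (rule T_least[OF D_subgroup])
  fix h k assume h: "h \<in> D" and k: "k \<in> carrier G"
  have "k \<otimes> inv h \<otimes> inv k \<in> D"
    using normal.inv_op_closed2[OF D_normal k] subgroup.m_inv_closed[OF D_subgroup h] .
  then have "h \<otimes> (k \<otimes> inv h \<otimes> inv k) \<in> D" by (rule subgroup.m_closed[OF D_subgroup h])
  then show "h \<otimes> k \<otimes> inv h \<otimes> inv k \<in> D" using h k D_carrier by (simp add: m_assoc)
qed

lemma subgrp_pow: "x [^]\<^bsub>subgrp G H\<^esub> (k :: nat) = x [^] k" by (rule nat_pow_consistent[symmetric])

lemma T_exp: "t \<in> T \<Longrightarrow> t [^] p = \<one>"
  using group.cyclic_prime_order(1)[OF subgroup_imp_group[OF T_subgroup] third p, of t] by (simp add: subgrp_pow)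

lemma T_cyclic: "t \<in> T \<Longrightarrow> t \<noteq> \<one> \<Longrightarrow> s \<in> T \<Longrightarrow> \<exists>k :: nat. s = t [^] k"
  using group.cyclic_prime_order(2)[OF subgroup_imp_group[OF T_subgroup] third p, of t s] by (simp add: subgrp_pow)

lemma p_power_dvd:
  assumes x: "x \<in> carrier G" "x [^] p = \<one>" "x \<noteq> \<one>" "x [^] (i :: int) = \<one>"
  shows "int p dvd i"
proof (rule ccontr)
  assume "\<not> int p dvd i"
  then have "int p dvd i * minv p i - 1" by (rule minv[OF p])
  moreover have "x [^] int p = \<one>" using x by (simp add: int_pow_int)
  ultimately have "x [^] (i * minv p i) = x [^] (1 :: int)" by (intro int_pow_cong[OF x(1)])
  then show False using x by (simp add: int_pow_pow[symmetric])
qed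

text \<open>If \<open>g\<close> conjugates a generator \<open>t\<close> to \<open>t ^ r\<close>, then \<open>r ^ (p ^ K) \<equiv> 1\<close> for \<open>|G| = p ^ K\<close>, so \<open>r \<equiv> 1\<close>
  by Fermat.\<close>

lemma T_central:
  assumes t: "t \<in> T" and g: "g \<in> carrier G"
  shows "t \<otimes> g = g \<otimes> t"
proof (cases "t = \<one>")
  case False
  note [simp] = g T_carrier[OF t]
  have "gcomm G t (inv g) \<in> T" using gcomm_T T_sub_D t g by blast
  then have "t \<otimes> gcomm G t (inv g) \<in> T" by (rule subgroup.m_closed[OF T_subgroup t])
  then have "g \<otimes> t \<otimes> inv g \<in> T" by (simp add: gcomm_def m_assoc)
  then obtain r :: nat where r: "g \<otimes> t \<otimes> inv g = t [^] r" using T_cyclic[OF t False] by blast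
  have it: "g [^] k \<otimes> t \<otimes> inv (g [^] k) = t [^] (r ^ k)" for k :: nat
  proof (induction k)
    case (Suc k)
    have "g [^] Suc k \<otimes> t \<otimes> inv (g [^] Suc k) = g [^] k \<otimes> (g \<otimes> t \<otimes> inv g) \<otimes> inv (g [^] k)"
      by (simp add: inv_mult_group m_assoc)
    also have "\<dots> = inv (inv (g [^] k)) \<otimes> t [^] int r \<otimes> inv (g [^] k)" by (simp add: r int_pow_int)
    also have "\<dots> = (inv (inv (g [^] k)) \<otimes> t \<otimes> inv (g [^] k)) [^] int r"
      by (rule int_pow_conj[symmetric]) simp_all
    also have "\<dots> = t [^] (r ^ k * r)" by (simp add: Suc int_pow_int nat_pow_pow)
    finally show ?case by (simp add: mult.commute)
  qed simp
  obtain K where K: "order G = p ^ K" and f: "finite (carrier G)" using fin by (auto simp: finite_p_group_def)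
  have "g [^] (p ^ K) = \<one>" using pow_order_eq_1[OF g] K by simp
  then have "t [^] (r ^ (p ^ K)) = t" using it[of "p ^ K"] by simp
  then have "t [^] (int (r ^ (p ^ K)) - 1) = \<one>" by (simp add: int_pow_diff int_pow_int del: of_nat_power)
  then have "int p dvd int (r ^ (p ^ K)) - 1" using p_power_dvd[of t] T_exp[OF t] False by simp
  moreover have "int p dvd int (r ^ (p ^ K)) - int r"
    using prime_pow_cong_self[OF p, of r K] by (metis cong_iff_dvd_diff cong_int_iff)
  ultimately have "int p dvd int r - 1"
    using dvd_diff[of "int p" "int (r ^ p ^ K) - 1" "int (r ^ p ^ K) - int r"] by simp
  then have "t [^] int r = t [^] (1 :: int)"
    using T_exp[OF t] by (intro int_pow_cong[of t "int p"]) (simp_all add: int_pow_int)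
  then have "g \<otimes> t \<otimes> inv g = t" using r by (simp add: int_pow_int)
  then have "g \<otimes> t \<otimes> inv g \<otimes> g = t \<otimes> g" by simp
  then show ?thesis by (simp add: m_assoc)
qed (use g in simp)

text \<open>\<open>g \<mapsto> [h, g]\<close> is a homomorphism into the central subgroup \<open>G\<^sub>3\<close>, so it is trivial on \<open>G'\<close>.\<close>

lemma D_comm:
  assumes h: "h \<in> D" and k: "k \<in> D"
  shows "h \<otimes> k = k \<otimes> h"
proof -
  note [simp] = D_carrier[OF h]
  let ?S = "{g \<in> carrier G. g \<otimes> h = h \<otimes> g}"
  have "D \<subseteq> ?S"
  proof (rule D_least)
    show "subgroup ?S G" by (rule comm_subgroup) simp
    fix x y assume [simp]: "x \<in> carrier G" "y \<in> carrier G"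
    define zx zy where "zx = gcomm G h x" and "zy = gcomm G h y"
    have z: "zx \<in> T" "zy \<in> T" using h by (simp_all add: zx_def zy_def gcomm_T)
    note [simp] = z[THEN T_carrier]
    have hx: "h \<otimes> x = x \<otimes> (h \<otimes> zx)" using gcomm_eq_iff[of h x zx] by (simp add: zx_def m_assoc)
    have hy: "h \<otimes> y = y \<otimes> (h \<otimes> zy)" using gcomm_eq_iff[of h y zy] by (simp add: zy_def m_assoc)
    \<comment> \<open>Moving h past x y or past y x produces the same central factor z, so h
      commutes with the quotient of the two products.\<close>
    define w w' where "w = x \<otimes> y" and "w' = y \<otimes> x"
    have [simp]: "w \<in> carrier G" "w' \<in> carrier G" by (simp_all add: w_def w'_def)
    have "h \<otimes> w = x \<otimes> (h \<otimes> (zx \<otimes> y))" by (simp add: w_def hx m_assoc[symmetric])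
    also have "zx \<otimes> y = y \<otimes> zx" by (rule T_central[OF z(1)]) simp
    also have "x \<otimes> (h \<otimes> (y \<otimes> zx)) = x \<otimes> ((h \<otimes> y) \<otimes> zx)" by (simp add: m_assoc)
    finally have hw: "h \<otimes> w = w \<otimes> h \<otimes> (zy \<otimes> zx)" by (simp add: hy w_def m_assoc)
    have "h \<otimes> w' = y \<otimes> (h \<otimes> (zy \<otimes> x))" by (simp add: w'_def hy m_assoc[symmetric])
    also have "zy \<otimes> x = x \<otimes> zy" by (rule T_central[OF z(2)]) simp
    also have "y \<otimes> (h \<otimes> (x \<otimes> zy)) = y \<otimes> ((h \<otimes> x) \<otimes> zy)" by (simp add: m_assoc)
    finally have hw': "h \<otimes> w' = w' \<otimes> h \<otimes> (zx \<otimes> zy)" by (simp add: hx w'_def m_assoc)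
    define z where "z = zx \<otimes> zy"
    have zz: "zy \<otimes> zx = z" using T_central[OF z(2), of zx] by (simp add: z_def)
    have zT: "z \<in> T" unfolding z_def using z by (rule subgroup.m_closed[OF T_subgroup])
    note [simp] = T_carrier[OF zT]
    have "inv w' \<otimes> (h \<otimes> w') \<otimes> inv w' = h \<otimes> z \<otimes> inv w'" by (simp add: hw' m_assoc z_def)
    then have 1: "inv w' \<otimes> h = h \<otimes> (z \<otimes> inv w')" by (simp add: m_assoc)
    have "h \<otimes> (w \<otimes> inv w') = w \<otimes> (h \<otimes> (z \<otimes> inv w'))"
      using arg_cong[OF hw, of "\<lambda>x. x \<otimes> inv w'"] by (simp add: zz m_assoc)
    also have "\<dots> = (w \<otimes> inv w') \<otimes> h" by (simp add: 1[symmetric] m_assoc)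
    finally have "h \<otimes> (w \<otimes> inv w') = (w \<otimes> inv w') \<otimes> h" .
    moreover have "x \<otimes> y \<otimes> inv x \<otimes> inv y = w \<otimes> inv w'" by (simp add: w_def w'_def inv_mult_group m_assoc)
    ultimately show "x \<otimes> y \<otimes> inv x \<otimes> inv y \<in> ?S" by simp
  qed
  then show ?thesis using k by auto
qed

lemma comm_group_D: "comm_group (subgrp G D)"
proof -
  interpret S: group "subgrp G D" by (rule subgroup_imp_group[OF D_subgroup])
  show ?thesis by (rule S.group_comm_groupI) (simp add: D_comm)
qed

lemma frat_D: "frattini (subgrp G D) \<subseteq> (\<lambda>x. x [^] p) ` D" "subgroup (frattini (subgrp G D)) G"
proof -
  interpret S: comm_group "subgrp G D" by (rule comm_group_D)
  have "finite D" using fin subgroup.subset[OF D_subgroup] by (auto simp: finite_p_group_def intro: finite_subset)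
  then show "frattini (subgrp G D) \<subseteq> (\<lambda>x. x [^] p) ` D"
    using S.frattini_subset_powers[OF _ p] by (simp add: int_pow_int subgrp_pow)
  show "subgroup (frattini (subgrp G D)) G"
    by (rule incl_subgroup[OF D_subgroup S.frattini_subgroup])
qed

text \<open>Conjugation by g multiplies x by an element of \<open>third_term G\<close>, which is
  central with trivial p-th power.\<close>

lemma power_central:
  assumes x: "x \<in> D" and g: "g \<in> carrier G"
  shows "x [^] p \<otimes> g = g \<otimes> x [^] p"
proof -
  note [simp] = D_carrier[OF x] g
  define z where "z = gcomm G x g"
  have zT: "z \<in> T" using x by (simp add: z_def gcomm_T)
  note [simp] = T_carrier[OF zT]
  have "x \<otimes> g = g \<otimes> (x \<otimes> z)" using gcomm_eq_iff[of x g z] by (simp add: z_def m_assoc)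
  then have "inv g \<otimes> x \<otimes> g = x \<otimes> z" by (simp add: m_assoc)
  then have "inv g \<otimes> x [^] int p \<otimes> g = (x \<otimes> z) [^] int p" using int_pow_conj[of g x "int p"] by simp
  also have "\<dots> = x [^] int p \<otimes> z [^] int p"
    by (rule int_pow_mult_distrib) (simp_all add: T_central[OF zT, of x])
  also have "\<dots> = x [^] int p" using T_exp[OF zT] by (simp add: int_pow_int)
  finally have "g \<otimes> (inv g \<otimes> x [^] int p \<otimes> g) = g \<otimes> x [^] int p" by simp
  then show ?thesis by (simp add: int_pow_int m_assoc)
qed

lemma N_elem:
  assumes "z \<in> N" obtains x t where "x \<in> D" "x [^] p \<in> frattini (subgrp G D)" "t \<in> T" "z = x [^] p \<otimes> t"
  using assms frat_D(1) unfolding frattini_third_def set_mult_def by blast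

lemma N_central:
  assumes z: "z \<in> N" and g: "g \<in> carrier G"
  shows "z \<in> carrier G" "z \<otimes> g = g \<otimes> z"
proof -
  obtain x t where xt: "x \<in> D" "t \<in> T" "z = x [^] p \<otimes> t" using N_elem[OF z] by metis
  note [simp] = D_carrier[OF xt(1)] T_carrier[OF xt(2)] g
  show "z \<in> carrier G" by (simp add: xt)
  show "z \<otimes> g = g \<otimes> z" unfolding xt(3)
    by (rule comm_mult[symmetric]) (simp_all add: power_central[OF xt(1)] T_central[OF xt(2)])
qed

lemma N_sub_D: "N \<subseteq> D"
proof
  fix z assume z: "z \<in> N"
  obtain x t where "x \<in> D" "x [^] p \<in> frattini (subgrp G D)" "t \<in> T" "z = x [^] p \<otimes> t" using N_elem[OF z] by metis
  then show "z \<in> D" using T_sub_D subgroup.m_closed[OF D_subgroup] by (auto simp: frattini_def)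
qed

lemma N_subgroup: "subgroup N G"
proof (rule subgroupI)
  let ?F = "frattini (subgrp G D)"
  have N: "N = {f \<otimes> t | f t. f \<in> ?F \<and> t \<in> T}" by (auto simp: frattini_third_def set_mult_def)
  have Fc: "f \<in> carrier G" if "f \<in> ?F" for f using subgroup.mem_carrier[OF frat_D(2) that] .
  show "N \<subseteq> carrier G" using Fc T_carrier by (auto simp: N)
  have "\<one> \<otimes> \<one> \<in> N" unfolding N using subgroup.one_closed[OF frat_D(2)] subgroup.one_closed[OF T_subgroup] by blast
  then show "N \<noteq> {}" by blast
  fix y assume "y \<in> N"
  then obtain f t where y: "y = f \<otimes> t" "f \<in> ?F" "t \<in> T" by (auto simp: N)
  have "inv y = inv f \<otimes> inv t"
    using y Fc T_carrier T_central[OF y(3) Fc[OF y(2)]] by (metis inv_mult_group)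
  then show "inv y \<in> N" using y subgroup.m_inv_closed[OF frat_D(2)] subgroup.m_inv_closed[OF T_subgroup] by (auto simp: N)
  fix y' assume "y' \<in> N"
  then obtain f' t' where y': "y' = f' \<otimes> t'" "f' \<in> ?F" "t' \<in> T" by (auto simp: N)
  note [simp] = Fc[OF y(2)] Fc[OF y'(2)] T_carrier[OF y(3)] T_carrier[OF y'(3)]
  have "y \<otimes> y' = f \<otimes> ((t \<otimes> f') \<otimes> t')" by (simp add: y y' m_assoc)
  also have "t \<otimes> f' = f' \<otimes> t" by (rule T_central[OF y(3)]) simp
  finally have "y \<otimes> y' = (f \<otimes> f') \<otimes> (t \<otimes> t')" by (simp add: m_assoc)
  moreover have "(f \<otimes> f') \<otimes> (t \<otimes> t') \<in> N"
    unfolding N using y y' subgroup.m_closed[OF frat_D(2)] subgroup.m_closed[OF T_subgroup] by blast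
  ultimately show "y \<otimes> y' \<in> N" by simp
qed

lemma N_normal: "N \<lhd> G"
  unfolding normal_inv_iff
proof (intro conjI ballI N_subgroup)
  fix x h assume x: "x \<in> carrier G" and h: "h \<in> N"
  note [simp] = x N_central(1)[OF h x]
  have "x \<otimes> h \<otimes> inv x = h \<otimes> x \<otimes> inv x" by (simp only: N_central(2)[OF h x])
  then have "x \<otimes> h \<otimes> inv x = h" by (simp add: m_assoc)
  then show "x \<otimes> h \<otimes> inv x \<in> N" using h by simp
qed

lemma N_exp: "z \<in> N \<Longrightarrow> z [^] p = \<one>"
proof -
  assume z: "z \<in> N"
  interpret S: group "subgrp G N" by (rule subgroup_imp_group[OF N_subgroup])
  let ?H = "integer_mod_group p \<times>\<times> integer_mod_group p"
  obtain f where f: "f \<in> iso (subgrp G N) ?H" using frat by (auto simp: is_iso_def)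
  interpret f: group_hom "subgrp G N" ?H f
    using f by (simp add: group_hom_def group_hom_axioms_def iso_def S.is_group DirProd_group)
  obtain u v where fx: "f z = (u, v)" by (cases "f z")
  have "f (z [^]\<^bsub>subgrp G N\<^esub> p) = \<one>\<^bsub>?H\<^esub>"
    using z by (simp add: f.hom_nat_pow fx nat_pow_DirProd one_DirProd)
  also have "\<dots> = f \<one>" using f.hom_one by simp
  finally have "f (z [^] p) = f \<one>" by (simp add: subgrp_pow)
  moreover have "z [^] p \<in> N" using z S.nat_pow_closed[of z p] by (simp add: subgrp_pow)
  moreover have "\<one> \<in> N" by (rule subgroup.one_closed[OF N_subgroup])
  ultimately show ?thesis
    using f by (auto simp: iso_def bij_betw_def inj_on_def)
qed

lemma card_N: "card N = p * p"
  using carrier_card_iso[OF frat] p by (auto simp: carrier_integer_mod_group card_cartesian_product)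

text \<open>The quotient of the centralizer by N has exponent dividing \<open>p ^ (n - 1)\<close>,
  because n - 1 \<ge> m \<ge> 1.\<close>

lemma centralizer_exponent:
  assumes x: "x \<in> carrier G" and c: "\<And>y. y \<in> D \<Longrightarrow> x \<otimes> y = y \<otimes> x"
  shows "x [^] (p ^ (n - 1)) \<in> N"
proof -
  define C where "C = centralizer G D"
  have C: "subgroup C G"
  proof (rule subgroupI)
    have "\<one> \<in> C" using D_carrier by (simp add: C_def centralizer_def)
    then show "C \<noteq> {}" by blast
    show "inv g \<in> C" if "g \<in> C" for g
      using that comm_inv D_carrier by (simp add: C_def centralizer_def)
    show "g \<otimes> h \<in> C" if "g \<in> C" "h \<in> C" for g h
      using that comm_mult[of _ g h] D_carrier by (simp add: C_def centralizer_def)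
  qed (auto simp: C_def centralizer_def)
  have xC: "x \<in> C" using x c by (simp add: C_def centralizer_def)
  have NC: "N \<subseteq> C" unfolding C_def centralizer_def using N_central D_carrier by blast
  interpret S: group "subgrp G C" by (rule subgroup_imp_group[OF C])
  have nN: "N \<lhd> subgrp G C"
    unfolding S.normal_inv_iff
  proof (intro conjI ballI)
    show "subgroup N (subgrp G C)" by (rule subgroup_incl[OF N_subgroup C NC])
    fix g h assume g: "g \<in> carrier (subgrp G C)" and h: "h \<in> N"
    then have gC: "g \<in> C" by simp
    then have gG: "g \<in> carrier G" using subgroup.mem_carrier[OF C] by simp
    have "inv\<^bsub>subgrp G C\<^esub> g = inv g" using m_inv_consistent[OF C gC] by simp
    moreover have "g \<otimes> h \<otimes> inv g \<in> N" using normal.inv_op_closed2[OF N_normal gG h] .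
    ultimately show "g \<otimes>\<^bsub>subgrp G C\<^esub> h \<otimes>\<^bsub>subgrp G C\<^esub> inv\<^bsub>subgrp G C\<^esub> g \<in> N" by simp
  qed
  define A where "A = subgrp G C Mod N"
  have gA: "group A" unfolding A_def by (rule normal_quotient[OF nN S.is_group])
  let ?k = "\<lambda>g. N #>\<^bsub>subgrp G C\<^esub> g"
  interpret k: group_hom "subgrp G C" A ?k
    using normal_quotient(2)[OF nN S.is_group] gA by (simp add: group_hom_def group_hom_axioms_def S.is_group A_def)
  have "?k x [^]\<^bsub>A\<^esub> (p ^ (n - 1)) = \<one>\<^bsub>A\<^esub>"
    by (rule abelian_type3_exponent[OF gA cent[folded C_def, folded A_def]])
      (use mn m1 xC k.hom_closed[of x] in \<open>auto intro: le_imp_power_dvd dvd_power\<close>)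
  then have "?k (x [^] (p ^ (n - 1))) = \<one>\<^bsub>A\<^esub>"
    using k.hom_nat_pow[of x "p ^ (n - 1)"] xC by (simp add: subgrp_pow)
  then have "N #>\<^bsub>subgrp G C\<^esub> (x [^] (p ^ (n - 1))) = N" by (simp add: A_def)
  \<comment> \<open>A coset of N formed in the centralizer is the same set as the coset formed in
    G.\<close>
  then have kk: "N #> (x [^] (p ^ (n - 1))) = N" by (simp add: r_coset_def)
  have "x [^] (p ^ (n - 1)) \<in> N #> (x [^] (p ^ (n - 1)))"
    by (rule rcos_self[OF _ N_subgroup]) (use x in simp)
  then show ?thesis by (simp only: kk)
qed

text \<open>Generators of M_p(n, m, 1) are lifted to a and b, so its relations hold modulo N. Once
  [c, b] = 1 is known, N turns out to be generated by \<open>c ^ p\<close> and d, and the elements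
  \<open>a ^ (p ^ n)\<close> and \<open>b ^ (p ^ m)\<close> of N supply the exponents.\<close>

lemma model_iso: "2 \<le> m \<and> (\<exists>w. pnm.model p n m w \<cong> G)"
proof -
  define P where "P = M_p p n m"
  obtain A B C where frM: "frame P A B C \<one>\<^bsub>P\<^esub>"
    and relM: "A [^]\<^bsub>P\<^esub> (int p ^ n) = \<one>\<^bsub>P\<^esub>" "B [^]\<^bsub>P\<^esub> (int p ^ m) = \<one>\<^bsub>P\<^esub>" "C [^]\<^bsub>P\<^esub> int p = \<one>\<^bsub>P\<^esub>"
    and surjM: "range (frame.hm P A B C \<one>\<^bsub>P\<^esub>) = carrier P"
    and kerM: "\<And>x y u v. frame.hm P A B C \<one>\<^bsub>P\<^esub> (x, y, u, v) = \<one>\<^bsub>P\<^esub> \<Longrightarrow>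
       int p ^ n dvd x \<and> int p ^ m dvd y \<and> int p dvd u"
    using M_p_struct[OF p m1 mn, folded P_def] by metis
  interpret M: frame P A B C "\<one>\<^bsub>P\<^esub>" by (rule frM)
  have gQ: "group (G Mod N)" by (rule normal_quotient(1)[OF N_normal is_group])
  obtain \<phi> where \<phi>: "\<phi> \<in> iso (G Mod N) P" using quot by (auto simp: is_iso_def P_def)
  define \<pi> where "\<pi> g = \<phi> (N #> g)" for g
  have \<phi>h: "\<phi> \<in> hom (G Mod N) P" and \<phi>b: "bij_betw \<phi> (carrier (G Mod N)) (carrier P)"
    using \<phi> by (simp_all add: iso_def)
  have "\<phi> \<circ> (\<lambda>g. N #> g) \<in> hom G P"
    by (rule Group.hom_compose[OF normal_quotient(2)[OF N_normal is_group] \<phi>h])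
  then interpret \<pi>: group_hom G P \<pi>
    by (simp add: group_hom_def group_hom_axioms_def is_group M.is_group \<pi>_def[abs_def] comp_def)
  have \<pi>_surj: "\<exists>g \<in> carrier G. \<pi> g = z" if "z \<in> carrier P" for z
  proof -
    have "z \<in> \<phi> ` carrier (G Mod N)" using \<phi>b that by (simp add: bij_betw_def)
    then show ?thesis unfolding normal_quotient(3)[OF N_normal is_group] \<pi>_def by auto
  qed
  have \<pi>_N: "\<pi> g = \<one>\<^bsub>P\<^esub> \<longleftrightarrow> g \<in> N" if g: "g \<in> carrier G" for g
  proof -
    have "\<pi> g = \<pi> \<one> \<longleftrightarrow> N #> g = N #> \<one>"
      unfolding \<pi>_def using \<phi>b g normal_quotient(3)[OF N_normal is_group]
      by (auto simp: bij_betw_def inj_on_eq_iff)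
    also have "\<dots> \<longleftrightarrow> g \<in> N" using coset_eq_iff[OF N_normal is_group g one_closed] g by simp
    finally show ?thesis by simp
  qed
  obtain a b where [simp]: "a \<in> carrier G" "b \<in> carrier G" and \<pi>a: "\<pi> a = A" and \<pi>b: "\<pi> b = B"
    using \<pi>_surj[OF M.a] \<pi>_surj[OF M.b] by blast
  define c where "c = gcomm G a b"
  define d where "d = gcomm G c a"
  have cD: "c \<in> D" by (simp add: c_def gcomm_D)
  have dT: "d \<in> T" unfolding d_def by (rule gcomm_T[OF cD]) simp
  note [simp] = D_carrier[OF cD] T_carrier[OF dT]
  have \<pi>c: "\<pi> c = C" using M.ab by (simp add: c_def \<pi>.hom_gcomm \<pi>a \<pi>b M.gcomm_eq_iff)
  have TN: "T \<subseteq> N"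
  proof
    fix t assume t: "t \<in> T"
    have "\<one> \<otimes> t \<in> N" unfolding frattini_third_def set_mult_def
      using t subgroup.one_closed[OF frat_D(2)] by blast
    then show "t \<in> N" using t T_carrier by simp
  qed
  have \<pi>d: "\<pi> d = \<one>\<^bsub>P\<^esub>" using \<pi>_N[of d] dT TN by auto
  have MN: "M.hm (x, y, u, v) = A [^]\<^bsub>P\<^esub> x \<otimes>\<^bsub>P\<^esub> B [^]\<^bsub>P\<^esub> y \<otimes>\<^bsub>P\<^esub> C [^]\<^bsub>P\<^esub> u" for x y u v
    by (simp add: M.hm_def M.cd_def)
  have \<pi>w: "\<pi> (a [^] x \<otimes> b [^] y \<otimes> c [^] u) = M.hm (x, y, u, v)" for x y u v
    by (simp add: MN \<pi>.hom_int_pow \<pi>a \<pi>b \<pi>c)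
  have nf: "\<exists>x y u z. z \<in> N \<and> g = a [^] (x :: int) \<otimes> b [^] (y :: int) \<otimes> c [^] (u :: int) \<otimes> z" if g: "g \<in> carrier G" for g
  proof -
    have "\<pi> g \<in> range M.hm" using surjM g by simp
    then obtain x y u v where e: "\<pi> g = M.hm (x, y, u, v)" by (metis (no_types, lifting) imageE prod_cases4)
    let ?h = "a [^] x \<otimes> b [^] y \<otimes> c [^] u"
    have "\<pi> (inv ?h \<otimes> g) = \<one>\<^bsub>P\<^esub>"
      using e \<pi>w[of x y u v] g by (simp add: M.l_inv)
    then have "inv ?h \<otimes> g \<in> N" using \<pi>_N[of "inv ?h \<otimes> g"] g by simp
    moreover have "g = ?h \<otimes> (inv ?h \<otimes> g)" using g by simp
    ultimately show ?thesis by blast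
  qed
  \<comment> \<open>Commutators map to powers of C, so G' is contained in \<langle>c\<rangle> N. As
    N is central, commuting with c is enough to centralize G'.\<close>
  have D1: "D \<subseteq> {c [^] (u :: int) \<otimes> z | u z. z \<in> N}"
  proof (rule D_least)
    let ?S = "{c [^] (u :: int) \<otimes> z | u z. z \<in> N}"
    show "subgroup ?S G"
    proof (rule subgroupI)
      show "?S \<subseteq> carrier G" using N_central(1)[OF _ one_closed] by auto
      have "c [^] (0 :: int) \<otimes> \<one> \<in> ?S" using subgroup.one_closed[OF N_subgroup] by blast
      then show "?S \<noteq> {}" by blast
      fix g assume "g \<in> ?S"
      then obtain u z where g: "g = c [^] (u :: int) \<otimes> z" "z \<in> N" by blast
      have zc: "z \<in> carrier G" using N_central(1)[OF g(2) one_closed] .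
      have "inv g = c [^] (- u) \<otimes> inv z"
        using N_central(2)[OF g(2), of "c [^] u"] zc by (simp add: g(1) int_pow_neg) (metis \<open>c \<in> carrier G\<close> int_pow_closed inv_mult_group)
      then show "inv g \<in> ?S" using subgroup.m_inv_closed[OF N_subgroup g(2)] by blast
      fix h assume "h \<in> ?S"
      then obtain u' z' where h: "h = c [^] (u' :: int) \<otimes> z'" "z' \<in> N" by blast
      have zc': "z' \<in> carrier G" using N_central(1)[OF h(2) one_closed] .
      have "g \<otimes> h = c [^] u \<otimes> ((z \<otimes> c [^] u') \<otimes> z')" using zc zc' by (simp add: g h m_assoc)
      also have "z \<otimes> c [^] u' = c [^] u' \<otimes> z" by (rule N_central(2)[OF g(2)]) simp
      finally have "g \<otimes> h = c [^] (u + u') \<otimes> (z \<otimes> z')" using zc zc' by (simp add: int_pow_mult m_assoc)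
      then show "g \<otimes> h \<in> ?S" using subgroup.m_closed[OF N_subgroup g(2) h(2)] by blast
    qed
    fix x y assume xy: "x \<in> carrier G" "y \<in> carrier G"
    let ?k = "x \<otimes> y \<otimes> inv x \<otimes> inv y"
    have k: "?k = gcomm G (inv x) (inv y)" using xy by (simp add: gcomm_def)
    have "\<pi> (inv x) \<in> range M.hm" "\<pi> (inv y) \<in> range M.hm" unfolding surjM using xy by simp_all
    then obtain g h where gh: "\<pi> (inv x) = M.hm g" "\<pi> (inv y) = M.hm h" by auto
    have "\<pi> ?k = M.hm (gcomm cover g h)" unfolding k using xy gh by (simp add: \<pi>.hom_gcomm M.hm.hom_gcomm)
    then obtain u v where e: "\<pi> ?k = M.hm (0, 0, u, v)" by (cases g; cases h) (simp add: cover_gcomm)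
    then have "\<pi> (inv (c [^] u) \<otimes> ?k) = \<one>\<^bsub>P\<^esub>"
      using \<pi>w[of 0 0 u v] xy by (simp add: M.l_inv)
    then have "inv (c [^] u) \<otimes> ?k \<in> N" using \<pi>_N[of "inv (c [^] u) \<otimes> ?k"] xy by simp
    moreover have "?k = c [^] u \<otimes> (inv (c [^] u) \<otimes> ?k)" using xy by simp
    ultimately show "?k \<in> ?S" by blast
  qed
  have D_commI: "g \<otimes> y = y \<otimes> g" if g: "g \<in> carrier G" and gc: "g \<otimes> c = c \<otimes> g" and y: "y \<in> D" for g y
  proof -
    obtain u z where yz: "y = c [^] (u :: int) \<otimes> z" "z \<in> N" using D1 y by blast
    show ?thesis unfolding yz(1)
      by (rule comm_mult) (use g gc comm_int_pow[of c g u] N_central[OF yz(2) g] in simp_all)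
  qed
  have cb1: "gcomm G c b = \<one>"
    \<comment> \<open>otherwise some \<open>a b ^ s\<close> centralizes \<open>G'\<close>, but its order modulo \<open>N\<close> is \<open>p ^ n\<close>\<close>
  proof (rule ccontr)
    assume ne: "gcomm G c b \<noteq> \<one>"
    define t where "t = gcomm G c b"
    have tT: "t \<in> T" unfolding t_def by (rule gcomm_T[OF cD]) simp
    note [simp] = T_carrier[OF tT]
    \<comment> \<open>The nontrivial t generates the group G_3 of prime order; this s makes the
      contributions of a and \<open>b ^ s\<close> to the commutator with c cancel.\<close>
    obtain s :: nat where s: "inv d = t [^] s"
      using T_cyclic[OF tT] ne subgroup.m_inv_closed[OF T_subgroup dT] by (auto simp: t_def)
    have ct: "c \<otimes> b = b \<otimes> (c \<otimes> t)" using gcomm_eq_iff[of c b t] by (simp add: t_def m_assoc)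
    have cbs: "c \<otimes> b [^] s = b [^] s \<otimes> (c \<otimes> t [^] s)" for s :: nat
    proof (induction s)
      case (Suc s)
      have "c \<otimes> b [^] Suc s = b [^] s \<otimes> (c \<otimes> (t [^] s \<otimes> b))" by (simp add: Suc m_assoc[symmetric])
      also have "t [^] s \<otimes> b = b \<otimes> t [^] s" using T_central[OF tT, of b] by (intro comm_nat_pow) simp_all
      also have "b [^] s \<otimes> (c \<otimes> (b \<otimes> t [^] s)) = b [^] s \<otimes> ((c \<otimes> b) \<otimes> t [^] s)" by (simp add: m_assoc)
      also have "\<dots> = b [^] Suc s \<otimes> (c \<otimes> (t \<otimes> t [^] s))" unfolding ct by (simp add: m_assoc)
      also have "t \<otimes> t [^] s = t [^] Suc s" by (rule nat_pow_Suc2[symmetric]) simp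
      finally show ?case .
    qed simp
    have ca: "c \<otimes> a = a \<otimes> (c \<otimes> d)" using gcomm_eq_iff[of c a d] by (simp add: d_def m_assoc)
    define g where "g = a \<otimes> b [^] s"
    have [simp]: "g \<in> carrier G" by (simp add: g_def)
    have "c \<otimes> g = a \<otimes> (c \<otimes> (d \<otimes> b [^] s))" by (simp add: g_def m_assoc[symmetric]) (simp add: ca m_assoc)
    also have "d \<otimes> b [^] s = b [^] s \<otimes> d" by (rule T_central[OF dT]) simp
    also have "a \<otimes> (c \<otimes> (b [^] s \<otimes> d)) = a \<otimes> ((c \<otimes> b [^] s) \<otimes> d)" by (simp add: m_assoc)
    also have "\<dots> = g \<otimes> (c \<otimes> (inv d \<otimes> d))" unfolding cbs s by (simp add: g_def m_assoc)
    finally have "g \<otimes> c = c \<otimes> g" by simp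
    then have "g \<otimes> y = y \<otimes> g" if "y \<in> D" for y using D_commI[OF _ _ that, of g] by simp
    then have "g [^] (p ^ (n - 1)) \<in> N" by (rule centralizer_exponent[rotated]) simp_all
    then have "\<pi> g [^]\<^bsub>P\<^esub> (p ^ (n - 1)) = \<one>\<^bsub>P\<^esub>" using \<pi>_N[of "g [^] (p ^ (n - 1))"] by (simp add: \<pi>.hom_nat_pow)
    moreover have "\<pi> g = M.hm (1, int s, 0, 0)"
      by (simp add: g_def MN \<pi>.hom_nat_pow \<pi>a \<pi>b int_pow_int)
    ultimately have "M.hm ((1, int s, 0, 0) [^]\<^bsub>cover\<^esub> (p ^ (n - 1))) = \<one>\<^bsub>P\<^esub>" by (simp add: M.hm.hom_nat_pow)
    \<comment> \<open>The a-coordinate of \<open>g ^ (p ^ (n - 1))\<close> is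
      \<open>p ^ (n - 1)\<close>, while membership in N requires a multiple of
      \<open>p ^ n\<close>.\<close>
    then have "int p ^ n dvd int (p ^ (n - 1))" unfolding cover_pow using kerM by (metis mult.right_neutral)
    then have "p ^ n dvd p ^ (n - 1)" by (metis int_dvd_int_iff of_nat_power)
    then have "n \<le> n - 1" using p by (metis power_dvd_imp_le prime_gt_1_nat)
    then show False using mn by simp
  qed
  have cb: "c \<otimes> b = b \<otimes> c" using cb1 by (simp add: gcomm_one_iff)
  have frG: "frame G a b c d"
    using gcomm_eq_iff[of a b c] gcomm_eq_iff[of c a d] cb T_central[OF dT]
    by unfold_locales (simp_all add: c_def[symmetric] d_def[symmetric])
  interpret F: frame G a b c d by (rule frG)
  have \<pi>hm: "\<pi> (F.hm g) = M.hm g" for g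
    by (cases g) (simp add: F.hm_def F.cd_def MN \<pi>.hom_int_pow \<pi>a \<pi>b \<pi>c \<pi>d)
  \<comment> \<open>Since N is central, a commutator depends only on the collected words modulo N,
    so the formula in \<open>cover\<close> places it in the subgroup of c and d.\<close>
  have D2: "D \<subseteq> range (\<lambda>(u, v). F.cd u v)"
  proof (rule D_least)
    let ?S = "range (\<lambda>(u, v). F.cd u v)"
    have S_I: "F.cd u v \<in> ?S" for u v by (rule range_eqI[of _ _ "(u, v)"]) simp
    show "subgroup ?S G"
    proof (rule subgroupI)
      fix g assume "g \<in> ?S"
      then obtain u v where g: "g = F.cd u v" by auto
      have "inv g = F.cd (- u) (- v)"
        by (rule inv_equality) (simp_all add: g F.cd_mult, simp add: F.cd_def)
      then show "inv g \<in> ?S" using S_I by simp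
      fix h assume "h \<in> ?S"
      then obtain u' v' where h: "h = F.cd u' v'" by auto
      show "g \<otimes> h \<in> ?S" using S_I by (simp add: g h F.cd_mult)
    qed auto
    have nf': "\<exists>g z. z \<in> N \<and> x = F.hm g \<otimes> z" if x: "x \<in> carrier G" for x
    proof -
      obtain i j u z where z: "z \<in> N" "x = a [^] (i :: int) \<otimes> b [^] (j :: int) \<otimes> c [^] (u :: int) \<otimes> z"
        using nf[OF x] by blast
      have "x = F.hm (i, j, u, 0) \<otimes> z" by (simp add: z(2) F.hm_def F.cd_def)
      then show ?thesis using z(1) by blast
    qed
    fix x y assume x: "x \<in> carrier G" and y: "y \<in> carrier G"
    obtain g z where gz: "z \<in> N" "inv x = F.hm g \<otimes> z" using nf'[of "inv x"] x by auto
    obtain h z' where hz: "z' \<in> N" "inv y = F.hm h \<otimes> z'" using nf'[of "inv y"] y by auto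
    have [simp]: "z \<in> carrier G" "z' \<in> carrier G" "F.hm g \<in> carrier G" "F.hm h \<in> carrier G"
      using N_central(1)[OF gz(1) one_closed] N_central(1)[OF hz(1) one_closed] F.hm.hom_closed by simp_all
    note zc = N_central(2)[OF gz(1)] and zc' = N_central(2)[OF hz(1)]
    have e: "F.hm g \<otimes> F.hm h = F.hm h \<otimes> F.hm g \<otimes> F.hm (gcomm cover g h)"
    proof -
      have "gcomm G (F.hm g) (F.hm h) = F.hm (gcomm cover g h)" by (simp add: F.hm.hom_gcomm)
      then show ?thesis by (simp add: gcomm_eq_iff F.hm.hom_closed)
    qed
    have "inv x \<otimes> inv y = F.hm g \<otimes> ((z \<otimes> F.hm h) \<otimes> z')" by (simp add: gz hz m_assoc)
    also have "\<dots> = F.hm g \<otimes> F.hm h \<otimes> (z \<otimes> z')" by (simp add: zc m_assoc)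
    also have "\<dots> = F.hm h \<otimes> (F.hm g \<otimes> (F.hm (gcomm cover g h) \<otimes> (z \<otimes> z')))" by (simp add: e m_assoc F.hm.hom_closed)
    also have "F.hm (gcomm cover g h) \<otimes> (z \<otimes> z') = (z' \<otimes> z) \<otimes> F.hm (gcomm cover g h)"
    proof -
      have "F.hm (gcomm cover g h) \<otimes> (z \<otimes> z') = z \<otimes> (z' \<otimes> F.hm (gcomm cover g h))"
        by (simp add: zc' m_assoc[symmetric] F.hm.hom_closed) (simp add: zc m_assoc F.hm.hom_closed)
      also have "\<dots> = (z' \<otimes> z) \<otimes> F.hm (gcomm cover g h)" by (simp add: zc[of z'] m_assoc[symmetric] F.hm.hom_closed)
      finally show ?thesis .
    qed
    also have "F.hm h \<otimes> (F.hm g \<otimes> ((z' \<otimes> z) \<otimes> F.hm (gcomm cover g h))) =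
        F.hm h \<otimes> ((F.hm g \<otimes> z') \<otimes> (z \<otimes> F.hm (gcomm cover g h)))" by (simp add: m_assoc F.hm.hom_closed)
    also have "F.hm g \<otimes> z' = z' \<otimes> F.hm g" by (simp add: zc')
    finally have "inv x \<otimes> inv y = inv y \<otimes> inv x \<otimes> F.hm (gcomm cover g h)"
      by (simp add: gz hz m_assoc F.hm.hom_closed)
    then have "gcomm G (inv x) (inv y) = F.hm (gcomm cover g h)"
      using x y by (simp add: gcomm_eq_iff F.hm.hom_closed)
    then have "x \<otimes> y \<otimes> inv x \<otimes> inv y = F.hm (gcomm cover g h)" using x y by (simp add: gcomm_def)
    also have "\<dots> \<in> ?S" using S_I by (cases g; cases h) (simp add: cover_gcomm F.hm_def)
    finally show "x \<otimes> y \<otimes> inv x \<otimes> inv y \<in> ?S" .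
  qed
  have N2: "\<exists>i j. z = F.cd (int p * i) j" if z: "z \<in> N" for z
  proof -
    obtain u v where uv: "z = F.cd u v" using D2 N_sub_D z by auto
    have "M.hm (0, 0, u, v) = \<one>\<^bsub>P\<^esub>"
      using \<pi>hm[of "(0, 0, u, v)"] \<pi>_N[of z] z uv by (simp add: F.hm_def)
    then have "int p dvd u" using kerM by blast
    then obtain i where "u = int p * i" by (rule dvdE)
    then show ?thesis using uv by blast
  qed
  have cpN: "c [^] int p \<in> N" using \<pi>_N[of "c [^] int p"] relM(3) by (simp add: \<pi>.hom_int_pow \<pi>c)
  have c2: "c [^] ((int p)\<^sup>2) = \<one>"
    using N_exp[OF cpN] by (simp add: power2_eq_square int_pow_pow[symmetric] int_pow_int)
  have d1: "d [^] int p = \<one>" using T_exp[OF dT] by (simp add: int_pow_int)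
  have cd_cong: "F.cd (int p * i) j = F.cd (int p * i') j'" if "int p dvd i - i'" "int p dvd j - j'" for i j i' j'
  proof -
    have "int p * int p dvd int p * (i - i')" using that(1) by (intro mult_dvd_mono) simp_all
    then have "c [^] (int p * i) = c [^] (int p * i')"
      by (intro int_pow_cong[OF _ c2]) (simp_all add: power2_eq_square right_diff_distrib)
    moreover have "d [^] j = d [^] j'" by (rule int_pow_cong[OF _ d1 that(2)]) simp
    ultimately show ?thesis by (simp add: F.cd_def)
  qed
  \<comment> \<open>N has p^2 elements and is covered by the p^2 products indexed by the box, so
    these are distinct. Thus the order of N yields the independence of \<open>c ^ p\<close> and
    d.\<close>
  let ?box = "{0..<int p} \<times> {0..<int p}"
  let ?f = "\<lambda>(i, j). F.cd (int p * i) j"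
  have p0: "0 < int p" using p by (simp add: prime_gt_0_nat)
  have red: "?f (i, j) = ?f (i mod int p, j mod int p)" for i j
    by simp (rule cd_cong; simp add: mod_eq_dvd_iff[symmetric])
  have "N \<subseteq> ?f ` ?box"
  proof
    fix z assume "z \<in> N"
    then obtain i j where "z = F.cd (int p * i) j" using N2 by blast
    then have "z = ?f (i, j)" by simp
    then have "z = ?f (i mod int p, j mod int p)" using red by simp
    then show "z \<in> ?f ` ?box" using p0 by (intro image_eqI[where x = "(i mod int p, j mod int p)"]) simp_all
  qed
  then have "card N \<le> card (?f ` ?box)" by (intro card_mono) simp_all
  moreover have "card ?box = p * p" by (simp add: card_cartesian_product)
  ultimately have "card (?f ` ?box) = card ?box"
    using card_N card_image_le[of ?box ?f] by simp
  then have inj: "inj_on ?f ?box" by (intro eq_card_imp_inj_on) simp_all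
  have indep: "int p dvd i \<and> int p dvd j" if "F.cd (int p * i) j = \<one>" for i j
  proof -
    have "?f (i mod int p, j mod int p) = ?f (0, 0)"
      using red[of i j] that by (simp add: F.cd_def)
    then have "(i mod int p, j mod int p) = (0, 0)" using p0 by (intro inj_onD[OF inj]) simp_all
    then show ?thesis by (simp add: mod_eq_0_iff_dvd)
  qed
  have apN: "a [^] (int p ^ n) \<in> N" using \<pi>_N[of "a [^] (int p ^ n)"] relM(1) by (simp add: \<pi>.hom_int_pow \<pi>a)
  have bpN: "b [^] (int p ^ m) \<in> N" using \<pi>_N[of "b [^] (int p ^ m)"] relM(2) by (simp add: \<pi>.hom_int_pow \<pi>b)
  \<comment> \<open>For m = 1 the power b^p would lie in the central subgroup N, forcing c^p =
    [a, b^p] = 1.\<close>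
  have m2: "2 \<le> m"
  proof (rule ccontr)
    assume "\<not> 2 \<le> m"
    then have m: "m = 1" using m1 by simp
    have "gcomm G a (b [^] int p) = \<one>"
      using N_central(2)[OF bpN, of a] by (simp add: m gcomm_one_iff)
    then have "c [^] int p = \<one>" using gcomm_int_pow_right[of a b "int p"] cb by (simp add: c_def)
    then have "F.cd (int p * 1) 0 = \<one>" by (simp add: F.cd_def)
    then have "int p dvd 1" using indep by blast
    then show False using p by auto
  qed
  interpret pnm p n m using p m2 mn by unfold_locales
  obtain \<alpha>1 \<alpha>2 where \<alpha>: "a [^] (int p ^ n) = F.cd (int p * \<alpha>1) \<alpha>2" using N2[OF apN] by blast
  obtain \<beta>1 \<beta>2 where \<beta>: "b [^] (int p ^ m) = F.cd (int p * \<beta>1) \<beta>2" using N2[OF bpN] by blast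
  define w where "w = (\<alpha>1, \<alpha>2, \<beta>1, \<beta>2)"
  have has_params: "has_params w G a b"
    using \<alpha> \<beta> cb1 d1 c2 T_central[OF dT]
    by (simp add: w_def Let_def c_def[symmetric] d_def[symmetric] gcomm_one_iff F.cd_def)
  have "model w \<cong> G"
  proof (rule iso_model[OF is_group has_params, folded c_def, folded d_def])
    show "range F.hm = carrier G"
    proof
      show "range F.hm \<subseteq> carrier G" using F.hm.hom_closed by auto
      show "carrier G \<subseteq> range F.hm"
      proof
        fix g assume "g \<in> carrier G"
        then obtain x y u z where z: "z \<in> N" "g = a [^] (x :: int) \<otimes> b [^] (y :: int) \<otimes> c [^] (u :: int) \<otimes> z" using nf by blast
        obtain i j where "z = F.cd (int p * i) j" using N2[OF z(1)] by blast
        then have "g = a [^] x \<otimes> b [^] y \<otimes> (F.cd u 0 \<otimes> F.cd (int p * i) j)" using z(2) by (simp add: F.cd_def m_assoc)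
        then have "g = F.hm (x, y, u + int p * i, j)" by (simp add: F.cd_mult F.hm_def)
        then show "g \<in> range F.hm" by blast
      qed
    qed
    fix g assume g1: "F.hm g = \<one>"
    obtain x y u v where g: "g = (x, y, u, v)" by (cases g)
    have "M.hm (x, y, u, v) = \<one>\<^bsub>P\<^esub>" using \<pi>hm[of g] g1 g by simp
    \<comment> \<open>Triviality in M_p(n, m, 1) gives the divisibility of x, y and u; the power
      relations then reduce the claim to the independence of \<open>c ^ p\<close> and d.\<close>
    then obtain i j k where ijk: "x = int p ^ n * i" "y = int p ^ m * j" "u = int p * k"
      using kerM by (meson dvdE)
    have "a [^] (int p ^ n * i) = F.cd (int p * \<alpha>1 * i) (\<alpha>2 * i)"
      "b [^] (int p ^ m * j) = F.cd (int p * \<beta>1 * j) (\<beta>2 * j)"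
      by (simp_all add: int_pow_pow[symmetric] \<alpha> \<beta> F.cd_pow)
    then have "F.hm g = F.cd (int p * (k + (\<alpha>1 * i + \<beta>1 * j))) (v + \<alpha>2 * i + \<beta>2 * j)"
      by (simp add: F.hm_def g ijk F.cd_mult algebra_simps)
    then have "int p dvd k + (\<alpha>1 * i + \<beta>1 * j)" "int p dvd v + \<alpha>2 * i + \<beta>2 * j"
      using indep g1 by metis+
    moreover from this(1) have "int p * int p dvd int p * (k + (\<alpha>1 * i + \<beta>1 * j))"
      by (intro mult_dvd_mono) simp_all
    ultimately show "g \<in> relators p n m w"
      unfolding g w_def by (intro relatorsI[OF _ _ ijk(1,2)]) (simp_all add: ijk(3) power2_eq_square algebra_simps)
  qed
  then show ?thesis using m2 by blast
qed

end

theorem theorem5p8: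
  fixes G :: "('a, 'b) monoid_scheme" and p n m :: nat and \<nu>\<^sub>0 :: int
  assumes "prime p"
    and "p \<noteq> 2 \<Longrightarrow> \<not> QuadRes (int p) \<nu>\<^sub>0"
  shows "(finite_p_group p G \<and>
          subgrp G (third_term G) \<cong> integer_mod_group p \<and>
          subgrp G (frattini_third G) \<cong> integer_mod_group p \<times>\<times> integer_mod_group p \<and>
          1 \<le> m \<and> m < n \<and>
          G Mod frattini_third G \<cong> M_p p n m \<and>
          abelian_type3 (subgrp G (centralizer G (derived_subgrp G)) Mod frattini_third G)
            (p ^ (n - 1)) (p ^ m) p
          \<longrightarrow> 2 \<le> m \<and> (\<exists>l \<in> M_labels p \<nu>\<^sub>0. G \<cong> M_group p n m l))
       \<and> (\<forall>n1 m1 l1 n2 m2 l2.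
            2 \<le> m1 \<and> m1 < n1 \<and> l1 \<in> M_labels p \<nu>\<^sub>0 \<and>
            2 \<le> m2 \<and> m2 < n2 \<and> l2 \<in> M_labels p \<nu>\<^sub>0 \<and>
            (n1, m1, l1) \<noteq> (n2, m2, l2)
            \<longrightarrow> \<not> M_group p n1 m1 l1 \<cong> M_group p n2 m2 l2)"
proof (intro conjI[of "_ \<longrightarrow> _"] impI allI, goal_cases)
  case 1
  then interpret group G by (simp add: finite_p_group_def)
  interpret class3 G p n m using 1 assms(1) by unfold_locales simp_all
  obtain w where m2: "2 \<le> m" and w: "pnm.model p n m w \<cong> G" using model_iso by blast
  interpret pnm p n m using assms(1) m2 1 by unfold_locales simp_all
  obtain l where l: "l \<in> M_labels p \<nu>\<^sub>0" "model w \<cong> M_group p n m l"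
    using model_normal_form[of \<nu>\<^sub>0 w] assms(2) by blast
  have "G \<cong> M_group p n m l" using iso_trans[OF group.iso_sym[OF group_model w] l(2)] .
  then show ?case using m2 l(1) by blast
next
  case (2 n1 m1 l1 n2 m2 l2)
  then show ?case
    using M_group_not_iso[OF assms(1), of \<nu>\<^sub>0 m1 n1 l1 m2 n2 l2] assms(2) by blast
qed

end
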